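(* Let $d\in\mathbb{R}\setminus\{0\}$, $\zeta,\omega,f_0\in\mathbb{R}$ and $e\in H^2(0,2\pi)$ be fixed. For $f_1\in\mathbb{R}$ consider the equation $$-d u''+\mathrm{i}\omega u'+(\zeta-\mathrm{i})u-|u|^2u+\mathrm{i}f_0+\mathrm{i}f_1e(s)=0,\qquad u\ 2\pi\text{-periodic}. \qquad ( * )$$ Let $u_0\in\mathbb{C}$ be a constant non-degenerate solution of $( * )$ for $f_1=0$, and let $\mathcal{C}^+\subset[0,\infty)\times H^2_{\mathrm{per}}(0,2\pi)$ be the maximal continuum of solutions $(f_1,u)$ of $( * )$ with $(0,u_0)\in\mathcal{C}^+$. Set $$C(d,f_0)=|f_0|\big(1+2\pi^2f_0^2|d|^{-1}\big).$$ Then $\operatorname{pr}_1(\mathcal{C}^+)=[0,\infty)$, where $\operatorname{pr}_1$ denotes projection onto the $f_1$-component, in any of the following three cases: (i) $\displaystyle \operatorname{sign}(d)\,\zeta<-C(d,f_0)^2\,\mathbf{1}_{d<0}-27\Big(1+\frac{\pi f_0^2|\omega|}{|d|}+\frac{\pi^2f_0^4}{|d|}\Big)C(d,f_0)^6$; (ii) $\displaystyle \operatorname{sign}(d)\,\zeta>3C(d,f_0)^2+\frac{\omega^2}{4|d|}$; (iii) $\sqrt{3}\,C(d,f_0)<1$. In particular, it is sufficient that $|\zeta|$ is sufficiently large (depending on $d,f_0,\omega$) or that $|f_0|$ is sufficiently small (depending on $d$).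
   Context: All functions are complex valued and function spaces are regarded as vector spaces over $\mathbb{R}$. $\mathbf{1}_{d<0}$ equals $1$ if $d<0$ and $0$ otherwise. $H^2(0,2\pi)$ is the usual Sobolev space; $e\in H^2(0,2\pi)$ is regarded as extended $2\pi$-periodically to $\mathbb{R}$ (not necessarily continuously). $H^2_{\mathrm{per}}(0,2\pi)$ is the space of locally square-integrable $2\pi$-periodic functions on $\mathbb{R}$ whose weak derivatives on $\mathbb{R}$ up to order $2$ are locally square-integrable, with the norm $\big(\sum_{j=0}^2\|u^{(j)}\|_{L^2(0,2\pi)}^2\big)^{1/2}$. A continuum is a closed and connected set; the maximal continuum containing a point is the largest one in the indicated set that consists of solutions and contains the point. A solution $u\in H^2_{\mathrm{per}}(0,2\pi)$ of $( * )$ for $f_1=0$ is called non-degenerate if the kernel of the ($\mathbb{R}$-linear) operator $L_u\varphi=-d\varphi''+\mathrm{i}\omega\varphi'+(\zeta-\mathrm{i}-2|u|^2)\varphi-u^2\overline{\varphi}$, $\varphi\in H^2_{\mathrm{per}}(0,2\pi)$, equals $\operatorname{span}_{\mathbb{R}}\{u'\}$. (For constant $u=u_0$ this means that $L_{u_0}$ is injective.) *)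

theory Defs
  imports "HOL-Analysis.Analysis"
begin

section \<open>Weak derivatives on open subsets of the line\<close>

definition test_function :: "real set \<Rightarrow> (real \<Rightarrow> real) \<Rightarrow> bool" where
  "test_function \<Omega> \<phi> \<longleftrightarrow>
     (\<forall>n x. ((deriv ^^ n) \<phi>) field_differentiable (at x)) \<and>
     (\<exists>K. compact K \<and> K \<subseteq> \<Omega> \<and> (\<forall>x. x \<notin> K \<longrightarrow> \<phi> x = 0))"

definition locally_integrable :: "real set \<Rightarrow> (real \<Rightarrow> complex) \<Rightarrow> bool" where
  "locally_integrable \<Omega> f \<longleftrightarrow> (\<forall>K. compact K \<longrightarrow> K \<subseteq> \<Omega> \<longrightarrow> set_integrable lebesgue K f)"

definition has_weak_deriv :: "nat \<Rightarrow> real set \<Rightarrow> (real \<Rightarrow> complex) \<Rightarrow> (real \<Rightarrow> complex) \<Rightarrow> bool" where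
  "has_weak_deriv k \<Omega> f g \<longleftrightarrow> locally_integrable \<Omega> f \<and> locally_integrable \<Omega> g \<and>
     (\<forall>\<phi>. test_function \<Omega> \<phi> \<longrightarrow>
        (LINT x:\<Omega>|lebesgue. (deriv ^^ k) \<phi> x *\<^sub>R f x) =
        (-1) ^ k * (LINT x:\<Omega>|lebesgue. \<phi> x *\<^sub>R g x))"

definition weak_deriv :: "nat \<Rightarrow> (real \<Rightarrow> complex) \<Rightarrow> real \<Rightarrow> complex" where
  "weak_deriv k f = (SOME g. has_weak_deriv k UNIV f g)"

definition square_integrable :: "real set \<Rightarrow> (real \<Rightarrow> complex) \<Rightarrow> bool" where
  "square_integrable S f \<longleftrightarrow> set_borel_measurable lebesgue S f \<and>
     set_integrable lebesgue S (\<lambda>x. (cmod (f x))\<^sup>2)"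

definition locally_square_integrable :: "(real \<Rightarrow> complex) \<Rightarrow> bool" where
  "locally_square_integrable f \<longleftrightarrow> (\<forall>K. compact K \<longrightarrow> square_integrable K f)"

definition sobolev_H2 :: "real set \<Rightarrow> (real \<Rightarrow> complex) set" where
  "sobolev_H2 \<Omega> = {f. square_integrable \<Omega> f \<and>
     (\<forall>k\<in>{1,2}. \<exists>g. has_weak_deriv k \<Omega> f g \<and> square_integrable \<Omega> g)}"

definition H2per_funs :: "(real \<Rightarrow> complex) set" where
  "H2per_funs = {u. (\<forall>x. u (x + 2 * pi) = u x) \<and> locally_square_integrable u \<and>
     (\<forall>k\<in>{1,2}. \<exists>g. has_weak_deriv k UNIV u g \<and> locally_square_integrable g)}"


section \<open>Uniqueness of weak derivatives\<close>

lemma deriv_closed_imp_smooth: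
  assumes "f \<in> A" and step: "\<And>f. f \<in> A \<Longrightarrow> \<exists>f'\<in>A. \<forall>x. (f has_field_derivative f' x) (at x)"
  shows "((deriv ^^ n) f) field_differentiable (at x)"
proof -
  have "(deriv ^^ n) f \<in> A" for n
  proof (induction n)
    case (Suc n)
    then obtain f' where f': "f' \<in> A" "\<forall>x. ((deriv ^^ n) f has_field_derivative f' x) (at x)"
      using step by blast
    then have "deriv ((deriv ^^ n) f) = f'"
      by (auto intro!: ext DERIV_imp_deriv)
    then show ?case using f' by simp
  qed (use assms in auto)
  then show ?thesis
    using step unfolding field_differentiable_def by blast
qed

definition flat :: "nat \<Rightarrow> real \<Rightarrow> real" where
  "flat k x = (if x > 0 then (1/x)^k * exp (-(1/x)) else 0)"

lemma flat_tendsto_0: "(flat k \<longlongrightarrow> 0) (at 0)"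
proof -
  have "((\<lambda>y::real. y^k / exp y) \<longlongrightarrow> 0) at_top"
    by (rule tendsto_power_div_exp_0)
  then have "((\<lambda>x::real. (inverse x)^k / exp (inverse x)) \<longlongrightarrow> 0) (at_right 0)"
    by (rule filterlim_compose) (rule filterlim_inverse_at_top_right)
  then have "(flat k \<longlongrightarrow> 0) (at_right 0)"
    by (rule Lim_transform_eventually)
      (auto simp: flat_def eventually_at_right_field field_simps exp_minus intro!: exI[of _ 1])
  moreover have "(flat k \<longlongrightarrow> 0) (at_left 0)"
    by (rule Lim_transform_eventually[OF tendsto_const])
      (auto simp: flat_def eventually_at_left_field intro!: exI[of _ "-1"])
  ultimately show ?thesis
    by (simp add: filterlim_at_split)
qed

lemma flat_deriv: "(flat k has_field_derivative (- real k * flat (Suc k) x + flat (k+2) x)) (at x)"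
proof -
  consider "x > 0" | "x < 0" | "x = 0" by linarith
  then show ?thesis
  proof cases
    case 1
    have D: "((\<lambda>x. 1/x) has_field_derivative (- ((1/x)^2))) (at x)"
      using 1 by (auto intro!: derivative_eq_intros simp: field_simps power2_eq_square)
    have P: "((\<lambda>x. (1/x)^k) has_field_derivative (real k * (1/x)^(k-1) * (- ((1/x)^2)))) (at x)"
      using DERIV_power[OF D, of k] by (simp add: mult_ac)
    have E: "((\<lambda>x. exp (-(1/x))) has_field_derivative (exp (-(1/x)) * (1/x)^2)) (at x)"
      using DERIV_fun_exp[OF DERIV_minus[OF D]] by simp
    have "real k * y^(k-1) * (- (y^2)) = - real k * y^(Suc k)" for y :: real
      by (cases k) (simp_all add: power2_eq_square algebra_simps)
    note this[of "1/x"]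
    then have "((\<lambda>x. (1/x)^k * exp (-(1/x))) has_field_derivative
       (- real k * flat (Suc k) x + flat (k+2) x)) (at x)"
      using DERIV_mult[OF P E] 1 by (simp add: flat_def power_add power2_eq_square mult_ac)
    then show ?thesis
      by (rule has_field_derivative_transform_within_open[where S="{0<..}"]) (use 1 in \<open>auto simp: flat_def\<close>)
  next
    case 2
    have "((\<lambda>x. 0) has_field_derivative (- real k * flat (Suc k) x + flat (k+2) x)) (at x)"
      using 2 by (auto simp: flat_def)
    then show ?thesis
      by (rule has_field_derivative_transform_within_open[where S="{..<0}"]) (use 2 in \<open>auto simp: flat_def\<close>)
  next
    case 3
    have "((\<lambda>h. (flat k (0 + h) - flat k 0) / h) \<longlongrightarrow> 0) (at 0)"
      by (rule Lim_transform_eventually[OF flat_tendsto_0[of "Suc k"]])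
        (auto simp: flat_def eventually_at_filter field_simps)
    then show ?thesis using 3 by (simp add: DERIV_def flat_def)
  qed
qed

inductive_set bump_alg :: "(real \<Rightarrow> real) set" where
  flat: "(\<lambda>x. flat k (a * x + b)) \<in> bump_alg"
| const: "(\<lambda>x. c) \<in> bump_alg"
| add: "f \<in> bump_alg \<Longrightarrow> g \<in> bump_alg \<Longrightarrow> (\<lambda>x. f x + g x) \<in> bump_alg"
| mult: "f \<in> bump_alg \<Longrightarrow> g \<in> bump_alg \<Longrightarrow> (\<lambda>x. f x * g x) \<in> bump_alg"

lemma bump_alg_deriv:
  "f \<in> bump_alg \<Longrightarrow> \<exists>f'\<in>bump_alg. \<forall>x. (f has_field_derivative f' x) (at x)"
proof (induction rule: bump_alg.induct)
  case (flat k a b)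
  have "((\<lambda>x. flat k (a * x + b)) has_field_derivative
      ((- real k) * flat (Suc k) (a * x + b) + flat (k+2) (a * x + b)) * a) (at x)" for x
    by (rule DERIV_chain2[OF flat_deriv]) (auto intro!: derivative_eq_intros)
  moreover have "(\<lambda>x. ((- real k) * flat (Suc k) (a * x + b) + flat (k+2) (a * x + b)) * a) \<in> bump_alg"
    by (intro bump_alg.mult bump_alg.add bump_alg.const bump_alg.flat)
  ultimately show ?case by (intro bexI[where x = "\<lambda>x. _ x"]) auto
next
  case (const c)
  then show ?case
    using bump_alg.const[of 0] by (intro bexI[of _ "\<lambda>x. 0"]) auto
next
  case (add f g)
  then obtain f' g' where "f' \<in> bump_alg" "g' \<in> bump_alg"
    "\<And>x. (f has_field_derivative f' x) (at x)" "\<And>x. (g has_field_derivative g' x) (at x)" by blast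
  then show ?case
    by (intro bexI[of _ "\<lambda>x. f' x + g' x"]) (auto intro!: bump_alg.intros derivative_eq_intros)
next
  case (mult f g)
  then obtain f' g' where fg: "f' \<in> bump_alg" "g' \<in> bump_alg"
    "\<And>x. (f has_field_derivative f' x) (at x)" "\<And>x. (g has_field_derivative g' x) (at x)" by blast
  have "(\<lambda>x. f' x * g x + g' x * f x) \<in> bump_alg"
    using fg mult by (intro bump_alg.intros)
  moreover have "((\<lambda>x. f x * g x) has_field_derivative (f' x * g x + g' x * f x)) (at x)" for x
    by (rule DERIV_mult[OF fg(3) fg(4)])
  ultimately show ?case
    by (intro bexI[of _ "\<lambda>x. f' x * g x + g' x * f x"]) auto
qed

definition bump :: "real \<Rightarrow> real \<Rightarrow> nat \<Rightarrow> real \<Rightarrow> real" where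
  "bump a b n x = flat 0 (real n * x + (- real n * a)) * flat 0 (- real n * x + real n * b)"

lemma bump_outside: "x \<notin> {a<..<b} \<Longrightarrow> bump a b n x = 0"
proof -
  assume "x \<notin> {a<..<b}"
  then consider "x \<le> a" | "b \<le> x" by (auto simp: not_less)
  then show ?thesis
  proof cases
    case 1
    then have "real n * x + (- real n * a) \<le> 0" by (simp add: mult_left_mono)
    then show ?thesis by (simp add: bump_def flat_def)
  next
    case 2
    then have "- real n * x + real n * b \<le> 0" by (simp add: mult_left_mono)
    then show ?thesis by (simp add: bump_def flat_def)
  qed
qed

lemma bump_bound: "\<bar>bump a b n x\<bar> \<le> indicator {a..b} x"
proof (cases "x \<in> {a<..<b}")
  case True
  have "\<bar>flat 0 y\<bar> \<le> 1" for y by (auto simp: flat_def)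
  then have "\<bar>bump a b n x\<bar> \<le> 1 * 1"
    unfolding bump_def abs_mult by (intro mult_mono) auto
  then show ?thesis using True by auto
qed (simp add: bump_outside)

lemma test_function_bump: "test_function UNIV (bump a b n)"
proof -
  have "bump a b n \<in> bump_alg"
    unfolding bump_def by (intro bump_alg.intros)
  then have "((deriv ^^ m) (bump a b n)) field_differentiable (at x)" for m x
    by (rule deriv_closed_imp_smooth) (rule bump_alg_deriv)
  then show ?thesis
    unfolding test_function_def using bump_outside[of _ a b n]
    by (auto intro!: exI[of _ "{a..b}"])
qed

lemma bump_tendsto: "(\<lambda>n. bump a b n x) \<longlonglongrightarrow> indicator {a<..<b} x"
proof (cases "x \<in> {a<..<b}")
  case True
  have *: "(\<lambda>n. flat 0 (real n * y)) \<longlonglongrightarrow> 1" if "y > 0" for y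
  proof -
    have "(\<lambda>n. exp (-(1 / (real n * y)))) \<longlonglongrightarrow> exp (- 0)"
    proof (intro tendsto_intros)
      have "(\<lambda>n. (1/y) * (1 / real n)) \<longlonglongrightarrow> (1/y) * 0"
        by (intro tendsto_intros lim_1_over_n)
      then show "(\<lambda>n. 1 / (real n * y)) \<longlonglongrightarrow> 0" by (simp add: mult.commute)
    qed
    moreover have "\<forall>\<^sub>F n in sequentially. exp (-(1 / (real n * y))) = flat 0 (real n * y)"
      using eventually_gt_at_top[of "0::nat"] by eventually_elim (use that in \<open>simp add: flat_def\<close>)
    ultimately show ?thesis
      using Lim_transform_eventually by fastforce
  qed
  have "(\<lambda>n. flat 0 (real n * (x - a)) * flat 0 (real n * (b - x))) \<longlonglongrightarrow> 1 * 1"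
    using True by (intro tendsto_mult *) auto
  then show ?thesis using True by (simp add: bump_def algebra_simps)
qed (simp add: bump_outside)

lemma integral_intervals_0_imp_AE_0:
  fixes h :: "real \<Rightarrow> complex"
  assumes h: "integrable lebesgue h"
    and 0: "\<And>a b. (LINT x:{a<..<b}|lebesgue. h x) = 0" and "(LINT x|lebesgue. h x) = 0"
  shows "AE x in lebesgue. h x = 0"
proof (rule sigma_finite_measure.density_zero[OF _ h])
  show "sigma_finite_measure (lebesgue :: real measure)"
  proof
    show "\<exists>A. countable A \<and> A \<subseteq> sets lebesgue \<and> \<Union>A = space (lebesgue :: real measure) \<and>
        (\<forall>a\<in>A. emeasure lebesgue a \<noteq> \<infinity>)"
    proof (intro exI conjI)
      let ?A = "range (\<lambda>n::nat. {- real n..real n})"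
      have "\<exists>n::nat. x \<in> {- real n..real n}" for x
      proof -
        obtain n :: nat where "\<bar>x\<bar> < real n" using reals_Archimedean2 by blast
        then show ?thesis by (intro exI[of _ n]) auto
      qed
      then show "\<Union>?A = space (lebesgue :: real measure)" by auto
    qed auto
  qed
  have sint: "set_integrable lebesgue A h" if "A \<in> sets lebesgue" for A
    unfolding set_integrable_def using h that by (rule integrable_mult_indicator[rotated])
  let ?E = "range (\<lambda>(a, b). box a b :: real set)"
  have borel: "(LINT x:A|lebesgue. h x) = 0" if "A \<in> sets borel" for A
  proof -
    have "Int_stable ?E"
      by (auto simp: Int_stable_def box_Int_box)
    moreover have "?E \<subseteq> Pow UNIV" by simp
    moreover have "A \<in> sigma_sets UNIV ?E"
      using that by (simp add: borel_eq_box del: box_real)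
    ultimately show ?thesis
    proof (induction rule: sigma_sets_induct_disjoint)
      case (basic A) then show ?case using 0 by (auto simp: box_real)
    next
      case empty then show ?case by (simp add: set_lebesgue_integral_def)
    next
      case (compl A)
      have A: "A \<in> sets borel" using compl by (simp add: borel_eq_box del: box_real)
      have "(LINT x:A \<union> (UNIV - A)|lebesgue. h x) =
            (LINT x:A|lebesgue. h x) + (LINT x:UNIV - A|lebesgue. h x)"
        by (rule set_integral_Un) (use A in \<open>auto intro!: sint\<close>)
      moreover have "(LINT x:A \<union> (UNIV - A)|lebesgue. h x) = 0"
        using assms(3) by (simp add: set_lebesgue_integral_def)
      ultimately show ?case using compl by simp
    next
      case (union A)
      have A: "A i \<in> sets borel" for i
        using union by (auto simp add: borel_eq_box simp del: box_real)
      have "(LINT x:(\<Union>i. A i)|lebesgue. h x) = (\<Sum>i. (LINT x:A i|lebesgue. h x))"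
        by (rule lebesgue_integral_countable_add)
          (use A union(1) in \<open>auto intro!: sint simp: disjoint_family_on_def\<close>)
      then show ?case using union by simp
    qed
  qed
  fix A :: "real set" assume "A \<in> sets lebesgue"
  then obtain S N N' where A: "A = S \<union> N" "S \<in> sets borel" "N \<subseteq> N'" "N' \<in> null_sets lborel"
    by (auto elim!: sets_completionE)
  have N: "N \<in> null_sets lebesgue"
    using A by (meson null_sets_completion_iff2 null_sets_completionI)
  have "(LINT x:A|lebesgue. h x) = (LINT x:S|lebesgue. h x)"
    unfolding set_lebesgue_integral_def
  proof (rule integral_cong_AE)
    show "AE x in lebesgue. indicator A x *\<^sub>R h x = indicator S x *\<^sub>R h x"
      using AE_not_in[OF N] by eventually_elim (auto simp: A(1) indicator_def)
  qed (use sint[of A] sint[of S] A \<open>A \<in> sets lebesgue\<close> in \<open>auto simp: set_integrable_def intro!: borel_measurable_integrable\<close>)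
  then show "(LINT x:A|lebesgue. h x) = 0" using borel A by simp
qed

lemma locally_integrable_cinterval:
  "locally_integrable UNIV f \<Longrightarrow> set_integrable lebesgue {a..b} f"
  by (simp add: locally_integrable_def)

lemma test_integral_0_imp_AE_0:
  assumes g: "locally_integrable UNIV g"
    and 0: "\<And>\<phi>. test_function UNIV \<phi> \<Longrightarrow> (LINT x|lebesgue. \<phi> x *\<^sub>R g x) = 0"
  shows "AE x in lebesgue. g x = 0"
proof -
  have int0: "(LINT x|lebesgue. indicator {a<..<b} x *\<^sub>R g x) = 0" for a b
  proof -
    have gi: "integrable lebesgue (\<lambda>x. indicator {a..b} x *\<^sub>R g x)"
      using locally_integrable_cinterval[OF g, of a b] by (simp add: set_integrable_def)
    have meas: "(\<lambda>x. bump a b n x *\<^sub>R g x) \<in> borel_measurable lebesgue" for n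
    proof -
      have "continuous_on UNIV (bump a b n)"
        using test_function_bump[of a b n] unfolding test_function_def
        by (metis DERIV_isCont continuous_at_imp_continuous_on field_differentiable_def funpow_0)
      then have "bump a b n \<in> borel_measurable borel"
        by (rule borel_measurable_continuous_onI)
      then have "bump a b n \<in> borel_measurable lebesgue"
        by (simp add: measurable_completion)
      then have "(\<lambda>x. bump a b n x *\<^sub>R (indicator {a..b} x *\<^sub>R g x)) \<in> borel_measurable lebesgue"
        using borel_measurable_integrable[OF gi] by (rule borel_measurable_scaleR)
      moreover have "(\<lambda>x. bump a b n x *\<^sub>R (indicator {a..b} x *\<^sub>R g x)) = (\<lambda>x. bump a b n x *\<^sub>R g x)"
      proof
        fix x
        show "bump a b n x *\<^sub>R (indicator {a..b} x *\<^sub>R g x) = bump a b n x *\<^sub>R g x"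
          using bump_outside[of x a b n] by (cases "x \<in> {a..b}") auto
      qed
      ultimately show ?thesis by simp
    qed
    have "(\<lambda>n. LINT x|lebesgue. bump a b n x *\<^sub>R g x) \<longlonglongrightarrow>
          (LINT x|lebesgue. indicator {a<..<b} x *\<^sub>R g x)"
    proof (rule integral_dominated_convergence)
      have "(\<lambda>x. indicator {a<..<b} x *\<^sub>R (indicator {a..b} x *\<^sub>R g x)) \<in> borel_measurable lebesgue"
        by (rule borel_measurable_scaleR[OF _ borel_measurable_integrable[OF gi]])
          (simp add: borel_measurable_indicator)
      moreover have "(\<lambda>x. indicator {a<..<b} x *\<^sub>R (indicator {a..b} x *\<^sub>R g x)) =
          (\<lambda>x. indicat_real {a<..<b} x *\<^sub>R g x)"
        by (auto simp: indicator_def)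
      ultimately show "(\<lambda>x. indicat_real {a<..<b} x *\<^sub>R g x) \<in> borel_measurable lebesgue" by simp
      show "integrable lebesgue (\<lambda>x. norm (indicat_real {a..b} x *\<^sub>R g x))"
        using gi by (rule integrable_norm)
      show "AE x in lebesgue. (\<lambda>n. bump a b n x *\<^sub>R g x) \<longlonglongrightarrow> indicator {a<..<b} x *\<^sub>R g x"
        by (intro AE_I2 tendsto_intros bump_tendsto)
      show "AE x in lebesgue. norm (bump a b n x *\<^sub>R g x) \<le> norm (indicat_real {a..b} x *\<^sub>R g x)" for n
        using bump_bound[of a b n] by (intro AE_I2) (auto intro!: mult_right_mono)
    qed (rule meas)
    moreover have "(\<lambda>n. LINT x|lebesgue. bump a b n x *\<^sub>R g x) = (\<lambda>n. 0)"
      using 0[OF test_function_bump] by simp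
    ultimately show ?thesis by (simp add: LIMSEQ_const_iff)
  qed
  have "AE x in lebesgue. indicator {- real n<..<real n} x *\<^sub>R g x = 0" for n :: nat
  proof (rule integral_intervals_0_imp_AE_0)
    have "set_integrable lebesgue {- real n<..<real n} g"
      by (rule set_integrable_subset[OF locally_integrable_cinterval[OF g, of "- real n" "real n"]]) auto
    then show "integrable lebesgue (\<lambda>x. indicat_real {- real n<..<real n} x *\<^sub>R g x)"
      by (simp add: set_integrable_def)
    show "(LINT x|lebesgue. indicat_real {- real n<..<real n} x *\<^sub>R g x) = 0"
      by (rule int0)
    fix a b
    have "(LINT x:{a<..<b}|lebesgue. indicat_real {- real n<..<real n} x *\<^sub>R g x) =
      (LINT x|lebesgue. indicat_real {max a (- real n)<..<min b (real n)} x *\<^sub>R g x)"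
      unfolding set_lebesgue_integral_def by (intro Bochner_Integration.integral_cong) (auto simp: indicator_def)
    then show "(LINT x:{a<..<b}|lebesgue. indicat_real {- real n<..<real n} x *\<^sub>R g x) = 0"
      using int0 by simp
  qed
  then have "AE x in lebesgue. \<forall>n::nat. indicator {- real n<..<real n} x *\<^sub>R g x = 0"
    by (intro AE_all_countable[THEN iffD2] allI)
  then show ?thesis
  proof eventually_elim
    case (elim x)
    obtain n :: nat where "\<bar>x\<bar> < real n" using reals_Archimedean2 by blast
    then have "x \<in> {- real n<..<real n}" by auto
    then show ?case using elim[rule_format, of n] by simp
  qed
qed

lemma test_function_derivs:
  assumes "test_function UNIV \<phi>"
  obtains a b where "\<And>k x. x \<notin> {a..b} \<Longrightarrow> (deriv ^^ k) \<phi> x = 0" "a \<le> b"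
    "\<And>k. continuous_on UNIV ((deriv ^^ k) \<phi>)"
    "\<And>k x. ((deriv ^^ k) \<phi> has_field_derivative (deriv ^^ Suc k) \<phi> x) (at x)"
proof -
  have sm: "((deriv ^^ n) \<phi>) field_differentiable (at x)" for n x
    using assms by (simp add: test_function_def)
  have D: "((deriv ^^ k) \<phi> has_field_derivative (deriv ^^ Suc k) \<phi> x) (at x)" for k x
    using sm[of k x] by (simp add: DERIV_deriv_iff_field_differentiable)
  obtain K where K: "compact K" "\<And>x. x \<notin> K \<Longrightarrow> \<phi> x = 0"
    using assms by (auto simp: test_function_def)
  obtain M where M: "\<And>x. x \<in> K \<Longrightarrow> \<bar>x\<bar> \<le> M"
    using compact_imp_bounded[OF K(1)] by (auto simp: bounded_iff)
  define B where "B = \<bar>M\<bar>"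
  have "\<forall>x. x \<notin> {-B..B} \<longrightarrow> (deriv ^^ k) \<phi> x = 0" for k
  proof (induction k)
    case 0 
    have "x \<notin> K" if "x \<notin> {-B..B}" for x using that M[of x] by (auto simp: B_def)
    then show ?case using K by auto
  next
    case (Suc k)
    show ?case
    proof (intro allI impI)
      fix x assume x: "x \<notin> {-B..B}"
      have "((deriv ^^ k) \<phi> has_field_derivative 0) (at x)"
        by (rule has_field_derivative_transform_within_open[where S="- {-B..B}" and f="\<lambda>x. 0"])
          (use x Suc in auto)
      then show "(deriv ^^ Suc k) \<phi> x = 0" using D DERIV_unique by blast
    qed
  qed
  moreover have "continuous_on UNIV ((deriv ^^ k) \<phi>)" for k
    using D by (meson DERIV_isCont continuous_at_imp_continuous_on)
  moreover have "-B \<le> B" by (simp add: B_def)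
  ultimately show ?thesis using D by (intro that[of "-B" B]) auto
qed

lemma integrable_test_scaleR:
  assumes "test_function UNIV \<phi>" "locally_integrable UNIV f"
  shows "integrable lebesgue (\<lambda>x. (deriv ^^ k) \<phi> x *\<^sub>R f x)"
proof -
  obtain a b where ab: "\<And>k x. x \<notin> {a..b} \<Longrightarrow> (deriv ^^ k) \<phi> x = 0" "a \<le> b"
    and cont: "\<And>k. continuous_on UNIV ((deriv ^^ k) \<phi>)"
    using test_function_derivs[OF assms(1)] by metis
  have "bounded ((deriv ^^ k) \<phi> ` {a..b})"
    by (intro compact_imp_bounded compact_continuous_image continuous_on_subset[OF cont]) auto
  then obtain B where B: "\<And>x. x \<in> {a..b} \<Longrightarrow> \<bar>(deriv ^^ k) \<phi> x\<bar> \<le> B"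
    unfolding bounded_iff by (metis imageI real_norm_def)
  have fi: "integrable lebesgue (\<lambda>x. indicator {a..b} x *\<^sub>R f x)"
    using locally_integrable_cinterval[OF assms(2), of a b] by (simp add: set_integrable_def)
  have "(deriv ^^ k) \<phi> \<in> borel_measurable lebesgue"
    using borel_measurable_continuous_onI[OF cont] by (simp add: measurable_completion)
  then have meas: "(\<lambda>x. (deriv ^^ k) \<phi> x *\<^sub>R (indicator {a..b} x *\<^sub>R f x)) \<in> borel_measurable lebesgue"
    using borel_measurable_integrable[OF fi] by (rule borel_measurable_scaleR)
  have "integrable lebesgue (\<lambda>x. (deriv ^^ k) \<phi> x *\<^sub>R (indicator {a..b} x *\<^sub>R f x))"
  proof (rule Bochner_Integration.integrable_bound[OF integrable_scaleR_right[OF fi, of B] meas], rule AE_I2)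
    fix x
    have "\<bar>(deriv ^^ k) \<phi> x\<bar> * cmod (f x) \<le> \<bar>B\<bar> * cmod (f x)" if "x \<in> {a..b}"
      using B[OF that] by (intro mult_right_mono) auto
    then show "norm ((deriv ^^ k) \<phi> x *\<^sub>R (indicator {a..b} x *\<^sub>R f x)) \<le>
          norm (B *\<^sub>R (indicator {a..b} x *\<^sub>R f x))"
      by (auto simp: indicator_def)
  qed
  moreover have "(\<lambda>x. (deriv ^^ k) \<phi> x *\<^sub>R (indicator {a..b} x *\<^sub>R f x)) = (\<lambda>x. (deriv ^^ k) \<phi> x *\<^sub>R f x)"
    using ab by (force simp: indicator_def)
  ultimately show ?thesis by simp
qed

lemma integrable_test_scaleR_0:
  assumes "test_function UNIV \<phi>" "locally_integrable UNIV f"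
  shows "integrable lebesgue (\<lambda>x. \<phi> x *\<^sub>R f x)"
  using integrable_test_scaleR[OF assms, of 0] by simp

lemma locally_integrable_add:
  "locally_integrable \<Omega> f \<Longrightarrow> locally_integrable \<Omega> g \<Longrightarrow> locally_integrable \<Omega> (\<lambda>x. f x + g x)"
  by (simp add: locally_integrable_def)

lemma locally_integrable_scaleR:
  "locally_integrable \<Omega> f \<Longrightarrow> locally_integrable \<Omega> (\<lambda>x. (c::real) *\<^sub>R f x)"
  by (auto simp: locally_integrable_def)

lemma has_weak_deriv_UNIV_iff:
  "has_weak_deriv k UNIV f g \<longleftrightarrow> locally_integrable UNIV f \<and> locally_integrable UNIV g \<and>
     (\<forall>\<phi>. test_function UNIV \<phi> \<longrightarrow>
        (LINT x|lebesgue. (deriv ^^ k) \<phi> x *\<^sub>R f x) = (-1) ^ k * (LINT x|lebesgue. \<phi> x *\<^sub>R g x))"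
  by (simp add: has_weak_deriv_def set_lebesgue_integral_def)

lemma has_weak_deriv_add:
  assumes "has_weak_deriv k UNIV f f'" "has_weak_deriv k UNIV g g'"
  shows "has_weak_deriv k UNIV (\<lambda>x. f x + g x) (\<lambda>x. f' x + g' x)"
  using assms unfolding has_weak_deriv_UNIV_iff
  by (auto simp: locally_integrable_add scaleR_add_right integrable_test_scaleR
      integrable_test_scaleR_0 Bochner_Integration.integral_add distrib_left)

lemma has_weak_deriv_scaleR:
  assumes "has_weak_deriv k UNIV f f'"
  shows "has_weak_deriv k UNIV (\<lambda>x. (c::real) *\<^sub>R f x) (\<lambda>x. c *\<^sub>R f' x)"
  using assms unfolding has_weak_deriv_UNIV_iff
  by (auto simp: locally_integrable_scaleR scaleR_left_commute[of _ c] simp del: scaleR_scaleR)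

lemma has_weak_deriv_unique:
  assumes "has_weak_deriv k UNIV f g" "has_weak_deriv k UNIV f h"
  shows "AE x in lebesgue. g x = h x"
proof -
  have m: "locally_integrable UNIV (\<lambda>x. g x + (-1::real) *\<^sub>R h x)"
    using assms by (intro locally_integrable_add locally_integrable_scaleR) (auto simp: has_weak_deriv_def)
  have "AE x in lebesgue. g x + (-1::real) *\<^sub>R h x = 0"
  proof (rule test_integral_0_imp_AE_0[OF m])
    fix \<phi> assume t: "test_function UNIV \<phi>"
    have "(-1) ^ k * (LINT x|lebesgue. \<phi> x *\<^sub>R g x) = (-1) ^ k * (LINT x|lebesgue. \<phi> x *\<^sub>R h x)"
      using assms t unfolding has_weak_deriv_UNIV_iff by metis
    then have "(LINT x|lebesgue. \<phi> x *\<^sub>R g x) = (LINT x|lebesgue. \<phi> x *\<^sub>R h x)" by simp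
    then show "(LINT x|lebesgue. \<phi> x *\<^sub>R (g x + (-1::real) *\<^sub>R h x)) = 0"
      using assms t
      by (simp add: has_weak_deriv_def scaleR_diff_right integrable_test_scaleR_0 Bochner_Integration.integral_diff)
  qed
  then show ?thesis by simp
qed

lemma has_weak_deriv_weak_deriv:
  "has_weak_deriv k UNIV f g \<Longrightarrow> has_weak_deriv k UNIV f (weak_deriv k f)"
  unfolding weak_deriv_def by (rule someI[of "has_weak_deriv k UNIV f"])

lemma weak_deriv_AE_eq:
  "has_weak_deriv k UNIV f g \<Longrightarrow> AE x in lebesgue. weak_deriv k f x = g x"
  using has_weak_deriv_unique has_weak_deriv_weak_deriv by blast


section \<open>The space of periodic Sobolev functions\<close>

lemma square_integrable_iff:
  "square_integrable S f \<longleftrightarrow> (\<lambda>x. indicator S x *\<^sub>R f x) \<in> borel_measurable lebesgue \<and>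
     integrable lebesgue (\<lambda>x. (cmod (indicator S x *\<^sub>R f x))\<^sup>2)"
proof -
  have "(\<lambda>x. indicat_real S x *\<^sub>R (cmod (f x))\<^sup>2) = (\<lambda>x. (cmod (indicat_real S x *\<^sub>R f x))\<^sup>2)"
    by (auto simp: indicator_def)
  then show ?thesis
    by (simp add: square_integrable_def set_borel_measurable_def set_integrable_def)
qed

lemma square_integrable_add:
  assumes "square_integrable S f" "square_integrable S g"
  shows "square_integrable S (\<lambda>x. f x + g x)"
proof -
  define F where "F = (\<lambda>x. indicat_real S x *\<^sub>R f x)"
  define G where "G = (\<lambda>x. indicat_real S x *\<^sub>R g x)"
  have [measurable]: "F \<in> borel_measurable lebesgue" "G \<in> borel_measurable lebesgue"
    and i: "integrable lebesgue (\<lambda>x. (cmod (F x))\<^sup>2)" "integrable lebesgue (\<lambda>x. (cmod (G x))\<^sup>2)"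
    using assms by (simp_all add: square_integrable_iff F_def G_def)
  have "integrable lebesgue (\<lambda>x. (cmod (F x + G x))\<^sup>2)"
  proof (rule Bochner_Integration.integrable_bound)
    show "integrable lebesgue (\<lambda>x. 2 * (cmod (F x))\<^sup>2 + 2 * (cmod (G x))\<^sup>2)"
      using i by simp
    have "(cmod (z + w))\<^sup>2 \<le> 2 * (cmod z)\<^sup>2 + 2 * (cmod w)\<^sup>2" for z w
    proof -
      have "(cmod (z + w))\<^sup>2 \<le> (cmod z + cmod w)\<^sup>2"
        by (intro power_mono norm_triangle_ineq) auto
      also have "\<dots> \<le> 2 * (cmod z)\<^sup>2 + 2 * (cmod w)\<^sup>2"
        using zero_le_power2[of "cmod z - cmod w"] unfolding power2_diff power2_sum by linarith
      finally show ?thesis .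
    qed
    then show "AE x in lebesgue. norm ((cmod (F x + G x))\<^sup>2) \<le> norm (2 * (cmod (F x))\<^sup>2 + 2 * (cmod (G x))\<^sup>2)"
      by (intro AE_I2) simp
  qed measurable
  moreover have "(\<lambda>x. F x + G x) \<in> borel_measurable lebesgue" by measurable
  ultimately show ?thesis
    unfolding square_integrable_iff scaleR_add_right F_def G_def by blast
qed

lemma square_integrable_scaleR:
  assumes "square_integrable S f"
  shows "square_integrable S (\<lambda>x. (c::real) *\<^sub>R f x)"
proof -
  have "(\<lambda>x. c *\<^sub>R (indicat_real S x *\<^sub>R f x)) \<in> borel_measurable lebesgue"
    using assms by (intro borel_measurable_scaleR[OF borel_measurable_const]) (simp add: square_integrable_iff)
  moreover have "integrable lebesgue (\<lambda>x. c\<^sup>2 * (cmod (indicat_real S x *\<^sub>R f x))\<^sup>2)"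
    using assms by (simp add: square_integrable_iff)
  ultimately show ?thesis
    by (simp add: square_integrable_iff mult_ac power_mult_distrib)
qed

lemma square_integrable_AE_cong:
  assumes "square_integrable S f" "AE x in lebesgue. f x = g x"
  shows "square_integrable S g"
proof -
  have ae: "AE x in lebesgue. indicat_real S x *\<^sub>R f x = indicat_real S x *\<^sub>R g x"
    using assms(2) by eventually_elim simp
  have f: "(\<lambda>x. indicat_real S x *\<^sub>R f x) \<in> borel_measurable lebesgue"
    "integrable lebesgue (\<lambda>x. (cmod (indicat_real S x *\<^sub>R f x))\<^sup>2)"
    using assms(1) by (simp_all add: square_integrable_iff)
  have g: "(\<lambda>x. indicat_real S x *\<^sub>R g x) \<in> borel_measurable lebesgue"
    by (rule borel_measurable_AE[OF f(1) ae])
  have "integrable lebesgue (\<lambda>x. (cmod (indicat_real S x *\<^sub>R g x))\<^sup>2)"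
  proof (rule integrable_cong_AE_imp[OF f(2)])
    show "(\<lambda>x. (cmod (indicat_real S x *\<^sub>R g x))\<^sup>2) \<in> borel_measurable lebesgue"
      using g by measurable
    show "AE x in lebesgue. (cmod (indicat_real S x *\<^sub>R f x))\<^sup>2 = (cmod (indicat_real S x *\<^sub>R g x))\<^sup>2"
      using ae by eventually_elim metis
  qed
  then show ?thesis using g by (simp add: square_integrable_iff)
qed

lemma H2per_funs_weak_deriv:
  assumes "u \<in> H2per_funs" "k \<in> {1, 2}"
  obtains g where "has_weak_deriv k UNIV u g" "locally_square_integrable g"
proof -
  have "\<forall>k\<in>{1,2}. \<exists>g. has_weak_deriv k UNIV u g \<and> locally_square_integrable g"
    using assms(1) unfolding H2per_funs_def mem_Collect_eq by (elim conjE)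
  from bspec[OF this assms(2)] show ?thesis using that by (elim exE conjE)
qed

lemma H2per_funs_add:
  assumes "u \<in> H2per_funs" "v \<in> H2per_funs"
  shows "(\<lambda>x. u x + v x) \<in> H2per_funs"
proof -
  have "\<exists>g. has_weak_deriv k UNIV (\<lambda>x. u x + v x) g \<and> locally_square_integrable g"
    if k: "k \<in> {1, 2}" for k
  proof -
    obtain f where f: "has_weak_deriv k UNIV u f" "locally_square_integrable f"
      by (rule H2per_funs_weak_deriv[OF assms(1) k])
    obtain g where g: "has_weak_deriv k UNIV v g" "locally_square_integrable g"
      by (rule H2per_funs_weak_deriv[OF assms(2) k])
    have "has_weak_deriv k UNIV (\<lambda>x. u x + v x) (\<lambda>x. f x + g x)"
      by (rule has_weak_deriv_add[OF f(1) g(1)])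
    moreover have "locally_square_integrable (\<lambda>x. f x + g x)"
      using f(2) g(2) by (simp add: locally_square_integrable_def square_integrable_add)
    ultimately show ?thesis by (intro exI conjI)
  qed
  then show ?thesis
    using assms unfolding H2per_funs_def locally_square_integrable_def
    by (auto simp: square_integrable_add)
qed

lemma H2per_funs_scaleR:
  assumes "u \<in> H2per_funs"
  shows "(\<lambda>x. (c::real) *\<^sub>R u x) \<in> H2per_funs"
proof -
  have "\<exists>g. has_weak_deriv k UNIV (\<lambda>x. c *\<^sub>R u x) g \<and> locally_square_integrable g"
    if k: "k \<in> {1, 2}" for k
  proof -
    obtain f where f: "has_weak_deriv k UNIV u f" "locally_square_integrable f"
      by (rule H2per_funs_weak_deriv[OF assms k])
    have "has_weak_deriv k UNIV (\<lambda>x. c *\<^sub>R u x) (\<lambda>x. c *\<^sub>R f x)"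
      by (rule has_weak_deriv_scaleR[OF f(1)])
    moreover have "locally_square_integrable (\<lambda>x. c *\<^sub>R f x)"
      using f(2) by (simp add: locally_square_integrable_def square_integrable_scaleR)
    ultimately show ?thesis by (intro exI conjI)
  qed
  then show ?thesis
    using assms unfolding H2per_funs_def locally_square_integrable_def
    by (auto simp: square_integrable_scaleR)
qed


lemma locally_integrable_AE_cong:
  assumes f: "locally_integrable UNIV f" and ae: "AE x in lebesgue. f x = g x"
  shows "locally_integrable UNIV g"
  unfolding locally_integrable_def
proof (intro allI impI)
  fix K :: "real set" assume "compact K"
  then have i: "integrable lebesgue (\<lambda>x. indicat_real K x *\<^sub>R f x)"
    using f by (simp add: locally_integrable_def set_integrable_def)
  have e: "AE x in lebesgue. indicat_real K x *\<^sub>R f x = indicat_real K x *\<^sub>R g x"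
    using ae by eventually_elim simp
  show "set_integrable lebesgue K g"
    unfolding set_integrable_def
    by (rule integrable_cong_AE_imp[OF i borel_measurable_AE[OF borel_measurable_integrable[OF i] e] e])
qed

lemma has_weak_deriv_AE_cong:
  assumes w: "has_weak_deriv k UNIV f h" and ae: "AE x in lebesgue. f x = g x"
  shows "has_weak_deriv k UNIV g h"
proof -
  have f: "locally_integrable UNIV f" using w by (simp add: has_weak_deriv_def)
  have g: "locally_integrable UNIV g" by (rule locally_integrable_AE_cong[OF f ae])
  have "(LINT x|lebesgue. (deriv ^^ k) \<phi> x *\<^sub>R f x) = (LINT x|lebesgue. (deriv ^^ k) \<phi> x *\<^sub>R g x)"
    if t: "test_function UNIV \<phi>" for \<phi>
  proof (rule integral_cong_AE)
    show "AE x in lebesgue. (deriv ^^ k) \<phi> x *\<^sub>R f x = (deriv ^^ k) \<phi> x *\<^sub>R g x"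
      using ae by eventually_elim simp
  qed (intro borel_measurable_integrable integrable_test_scaleR t f g)+
  then show ?thesis using w g by (simp add: has_weak_deriv_UNIV_iff)
qed

lemma integrable_indicator_compact:
  fixes c :: "'a::{banach, second_countable_topology}"
  assumes "compact K"
  shows "integrable lebesgue (\<lambda>x. indicat_real K x *\<^sub>R c)"
proof -
  have "integrable lebesgue (indicat_real K)"
  proof (rule integrable_real_indicator)
    show "K \<in> sets lebesgue" by (rule fmeasurableD[OF lmeasurable_compact[OF assms]])
    show "emeasure lebesgue K < \<infinity>"
      using fmeasurableD2[OF lmeasurable_compact[OF assms]] by (simp add: less_top)
  qed
  then show ?thesis by (rule integrable_scaleR_left)
qed

lemma locally_integrable_const: "locally_integrable UNIV (\<lambda>x. c)"
  by (simp add: locally_integrable_def set_integrable_def integrable_indicator_compact)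

lemma has_weak_deriv_const:
  assumes "k > 0"
  shows "has_weak_deriv k UNIV (\<lambda>x. c) (\<lambda>x. 0)"
  unfolding has_weak_deriv_UNIV_iff
proof (intro conjI allI impI locally_integrable_const)
  fix \<phi> assume t: "test_function UNIV \<phi>"
  obtain m where k: "k = Suc m" using assms gr0_implies_Suc by blast
  obtain a b where ab: "\<And>k x. x \<notin> {a..b} \<Longrightarrow> (deriv ^^ k) \<phi> x = 0" "a \<le> b"
    and D: "\<And>k x. ((deriv ^^ k) \<phi> has_field_derivative (deriv ^^ Suc k) \<phi> x) (at x)"
    using test_function_derivs[OF t] by metis
  let ?F = "\<lambda>x. (deriv ^^ m) \<phi> x *\<^sub>R c" and ?f = "\<lambda>x. (deriv ^^ k) \<phi> x *\<^sub>R c"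
  have i: "integrable lebesgue ?f"
    using integrable_test_scaleR[OF t locally_integrable_const] .
  have "(?f has_integral ?F (b+1) - ?F (a-1)) {a-1..b+1}"
  proof (rule fundamental_theorem_of_calculus)
    show "a - 1 \<le> b + 1" using ab(2) by simp
    fix x
    have "((deriv ^^ m) \<phi> has_vector_derivative (deriv ^^ k) \<phi> x) (at x within {a-1..b+1})"
      using D[of m x] unfolding k
      by (simp only: has_real_derivative_iff_has_vector_derivative has_vector_derivative_at_within)
    then show "(?F has_vector_derivative ?f x) (at x within {a-1..b+1})"
      by (rule bounded_linear.has_vector_derivative[OF bounded_linear_scaleR_left])
  qed
  then have 1: "(?f has_integral 0) {a-1..b+1}"
    using ab(1)[of "b+1" m] ab(1)[of "a-1" m] by simp
  have "set_integrable lebesgue {a-1..b+1} ?f"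
    unfolding set_integrable_def using i by (rule integrable_mult_indicator[rotated]) simp
  then have "(?f has_integral (LINT x:{a-1..b+1}|lebesgue. ?f x)) {a-1..b+1}"
    by (rule has_integral_set_lebesgue)
  then have 0: "(LINT x:{a-1..b+1}|lebesgue. ?f x) = 0"
    using 1 has_integral_unique by blast
  have "(LINT x:{a-1..b+1}|lebesgue. ?f x) = (LINT x|lebesgue. ?f x)"
    unfolding set_lebesgue_integral_def
  proof (rule Bochner_Integration.integral_cong)
    fix x show "indicat_real {a-1..b+1} x *\<^sub>R ?f x = ?f x"
      using ab(1)[of x k] by (cases "x \<in> {a..b}") auto
  qed simp
  then show "(LINT x|lebesgue. ?f x) = (-1) ^ k * (LINT x|lebesgue. \<phi> x *\<^sub>R 0)"
    using 0 by simp
qed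

lemma square_integrable_const: "compact K \<Longrightarrow> square_integrable K (\<lambda>x. c)"
proof -
  assume "compact K"
  then have "integrable lebesgue (\<lambda>x. indicat_real K x *\<^sub>R z)" for z :: complex
    by (rule integrable_indicator_compact)
  then show ?thesis
    using integrable_indicator_compact[OF \<open>compact K\<close>, of "(cmod c)\<^sup>2"]
    by (simp add: square_integrable_def set_borel_measurable_def set_integrable_def
        borel_measurable_integrable del: real_scaleR_def)
qed

lemma H2per_funs_const: "(\<lambda>x. c) \<in> H2per_funs"
  unfolding H2per_funs_def locally_square_integrable_def
proof (intro CollectI conjI ballI allI impI square_integrable_const)
  fix k :: nat assume "k \<in> {1, 2}"
  then have "has_weak_deriv k UNIV (\<lambda>x. c) (\<lambda>x. 0)"
    by (intro has_weak_deriv_const) auto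
  then show "\<exists>g. has_weak_deriv k UNIV (\<lambda>x. c) g \<and> (\<forall>K. compact K \<longrightarrow> square_integrable K g)"
    using square_integrable_const by blast
qed simp_all

definition H2per_rel :: "(real \<Rightarrow> complex) \<Rightarrow> (real \<Rightarrow> complex) \<Rightarrow> bool" where
  "H2per_rel u v \<longleftrightarrow> u \<in> H2per_funs \<and> v \<in> H2per_funs \<and> (AE x in lebesgue. u x = v x)"

quotient_type h2per = "real \<Rightarrow> complex" / partial: H2per_rel
proof (rule part_equivpI)
  show "\<exists>u. H2per_rel u u"
    using H2per_funs_const by (auto simp: H2per_rel_def)
  show "symp H2per_rel"
    by (auto intro!: sympI simp: H2per_rel_def elim: eventually_mono)
  show "transp H2per_rel"
    by (rule transpI) (auto simp: H2per_rel_def elim: eventually_elim2)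
qed

lemma rep_h2per_in: "rep_h2per u \<in> H2per_funs"
  using Quotient3_rep_reflp[OF Quotient3_h2per] by (simp add: H2per_rel_def)

lemma rep_abs_h2per: "f \<in> H2per_funs \<Longrightarrow> AE x in lebesgue. rep_h2per (abs_h2per f) x = f x"
  using rep_abs_rsp_left[OF Quotient3_h2per, of f f] by (simp add: H2per_rel_def)

lemma h2per_eqI: "(AE x in lebesgue. rep_h2per u x = rep_h2per v x) \<Longrightarrow> u = v"
  using Quotient3_rel_rep[OF Quotient3_h2per, of u v] rep_h2per_in by (simp add: H2per_rel_def)

definition h2per_deriv :: "nat \<Rightarrow> h2per \<Rightarrow> real \<Rightarrow> complex" where
  "h2per_deriv k u = weak_deriv k (rep_h2per u)"

lift_definition const_h2per :: "complex \<Rightarrow> h2per" is "\<lambda>c x. c"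
  by (simp add: H2per_rel_def H2per_funs_const)

lemma h2per_deriv_0: "AE x in lebesgue. h2per_deriv 0 u x = rep_h2per u x"
proof -
  have "locally_integrable UNIV (rep_h2per u)"
    using rep_h2per_in[of u] by (auto simp: H2per_funs_def has_weak_deriv_def)
  then have "has_weak_deriv 0 UNIV (rep_h2per u) (rep_h2per u)"
    by (simp add: has_weak_deriv_def)
  then show ?thesis unfolding h2per_deriv_def by (rule weak_deriv_AE_eq)
qed

lemma h2per_deriv:
  assumes "k \<le> 2"
  shows "has_weak_deriv k UNIV (rep_h2per u) (h2per_deriv k u)"
    and "locally_square_integrable (h2per_deriv k u)"
proof -
  have "\<exists>g. has_weak_deriv k UNIV (rep_h2per u) g \<and> locally_square_integrable g"
  proof (cases "k = 0")
    case True
    have "locally_integrable UNIV (rep_h2per u)"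
      using rep_h2per_in[of u] by (auto simp: H2per_funs_def has_weak_deriv_def)
    then have "has_weak_deriv 0 UNIV (rep_h2per u) (rep_h2per u)"
      by (simp add: has_weak_deriv_def)
    then show ?thesis using True rep_h2per_in[of u] by (auto simp: H2per_funs_def)
  next
    case False
    then have "k \<in> {1, 2}" using assms by auto
    from H2per_funs_weak_deriv[OF rep_h2per_in this] show ?thesis by metis
  qed
  then obtain g where g: "has_weak_deriv k UNIV (rep_h2per u) g" "locally_square_integrable g" by blast
  show *: "has_weak_deriv k UNIV (rep_h2per u) (h2per_deriv k u)"
    unfolding h2per_deriv_def by (rule has_weak_deriv_weak_deriv[OF g(1)])
  show "locally_square_integrable (h2per_deriv k u)"
    using g(2) square_integrable_AE_cong has_weak_deriv_unique[OF g(1) *]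
    unfolding locally_square_integrable_def by blast
qed


instantiation h2per :: real_inner
begin

lift_definition zero_h2per :: h2per is "\<lambda>x. 0"
  by (simp add: H2per_rel_def H2per_funs_const)

lift_definition plus_h2per :: "h2per \<Rightarrow> h2per \<Rightarrow> h2per" is "\<lambda>u v x. u x + v x"
  by (auto simp: H2per_rel_def H2per_funs_add elim: eventually_elim2)

lift_definition scaleR_h2per :: "real \<Rightarrow> h2per \<Rightarrow> h2per" is "\<lambda>c u x. c *\<^sub>R u x"
  by (auto simp: H2per_rel_def H2per_funs_scaleR elim: eventually_mono)

definition uminus_h2per :: "h2per \<Rightarrow> h2per" where "- u = (-1) *\<^sub>R u" for u :: h2per

definition minus_h2per :: "h2per \<Rightarrow> h2per \<Rightarrow> h2per" where "u - v = u + (- v)" for u v :: h2per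

definition inner_h2per :: "h2per \<Rightarrow> h2per \<Rightarrow> real" where
  "inner u v = (\<Sum>k\<le>2. LINT x:{0..2 * pi}|lebesgue. inner (h2per_deriv k u x) (h2per_deriv k v x))"

definition norm_h2per :: "h2per \<Rightarrow> real" where
  "norm u = sqrt (\<Sum>k\<le>2. LINT x:{0..2 * pi}|lebesgue. (cmod (h2per_deriv k u x))\<^sup>2)"

definition dist_h2per :: "h2per \<Rightarrow> h2per \<Rightarrow> real" where "dist u v = norm (u - v)" for u v :: h2per

definition sgn_h2per :: "h2per \<Rightarrow> h2per" where "sgn u = inverse (norm u) *\<^sub>R u" for u :: h2per

definition uniformity_h2per :: "(h2per \<times> h2per) filter" where
  "uniformity_h2per = (INF e\<in>{0<..}. principal {(u, v). dist u v < e})"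

definition open_h2per :: "h2per set \<Rightarrow> bool" where
  "open_h2per U \<longleftrightarrow> (\<forall>u\<in>U. eventually (\<lambda>(u', v). u' = u \<longrightarrow> v \<in> U) uniformity)"

instance
proof
  have rep_add: "AE x in lebesgue. rep_h2per (u + v) x = rep_h2per u x + rep_h2per v x" for u v
    by (simp add: plus_h2per_def rep_abs_h2per H2per_funs_add rep_h2per_in)
  have rep_scaleR: "AE x in lebesgue. rep_h2per (c *\<^sub>R u) x = c *\<^sub>R rep_h2per u x" for c u
    using rep_abs_h2per[OF H2per_funs_scaleR[OF rep_h2per_in]] by (simp add: scaleR_h2per_def)
  have rep_0: "AE x in lebesgue. rep_h2per 0 x = 0"
    by (simp add: zero_h2per_def rep_abs_h2per H2per_funs_const)
  fix u v w :: h2per and c c' :: real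
  show "u + v + w = u + (v + w)"
    by (rule h2per_eqI)
      (use rep_add[of "u + v" w] rep_add[of u v] rep_add[of u "v + w"] rep_add[of v w] in \<open>eventually_elim, simp\<close>)
  show "u + v = v + u"
    by (rule h2per_eqI)
      (use rep_add[of u v] rep_add[of v u] in \<open>eventually_elim, simp\<close>)
  show "0 + u = u"
    by (rule h2per_eqI)
      (use rep_add[of 0 u] rep_0 in \<open>eventually_elim, simp\<close>)
  have "(-1) *\<^sub>R u + u = 0"
    by (rule h2per_eqI)
      (use rep_add[of "(-1) *\<^sub>R u" u] rep_scaleR[of "-1" u] rep_0 in \<open>eventually_elim, simp\<close>)
  then show "- u + u = 0" by (simp add: uminus_h2per_def)
  show "u - v = u + - v" by (simp add: minus_h2per_def)
  show "c *\<^sub>R (u + v) = c *\<^sub>R u + c *\<^sub>R v"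
    by (rule h2per_eqI)
      (use rep_add[of u v] rep_scaleR[of c "u + v"] rep_add[of "c *\<^sub>R u" "c *\<^sub>R v"]
      rep_scaleR[of c u] rep_scaleR[of c v] in \<open>eventually_elim, simp add: scaleR_add_right\<close>)
  show "(c + c') *\<^sub>R u = c *\<^sub>R u + c' *\<^sub>R u"
    by (rule h2per_eqI)
      (use rep_scaleR[of "c + c'" u] rep_add[of "c *\<^sub>R u" "c' *\<^sub>R u"]
      rep_scaleR[of c u] rep_scaleR[of c' u] in \<open>eventually_elim, simp add: scaleR_add_left\<close>)
  show "c *\<^sub>R c' *\<^sub>R u = (c * c') *\<^sub>R u"
    by (rule h2per_eqI)
      (use rep_scaleR[of c "c' *\<^sub>R u"] rep_scaleR[of c' u] rep_scaleR[of "c * c'" u] in \<open>eventually_elim, simp\<close>)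
  show "1 *\<^sub>R u = u"
    by (rule h2per_eqI)
      (use rep_scaleR[of 1 u] in \<open>eventually_elim, simp\<close>)
  show "sgn u = inverse (norm u) *\<^sub>R u" by (simp add: sgn_h2per_def)
  show "dist u v = norm (u - v)" by (simp add: dist_h2per_def)
  show "uniformity = (INF e\<in>{0<..}. principal {(u::h2per, v). dist u v < e})"
    by (simp add: uniformity_h2per_def)
  show "open U \<longleftrightarrow> (\<forall>u\<in>U. eventually (\<lambda>(u', v). u' = u \<longrightarrow> v \<in> U) uniformity)" for U :: "h2per set"
    by (simp add: open_h2per_def)
  show "inner u v = inner v u" by (simp add: inner_h2per_def inner_commute)
  show "norm u = sqrt (inner u u)" by (simp add: norm_h2per_def inner_h2per_def power2_norm_eq_inner)

  let ?D = "\<lambda>k u x. indicat_real {0..2*pi} x *\<^sub>R h2per_deriv k u x"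
  have I: "inner u v = (\<Sum>k\<le>2. LINT x|lebesgue. inner (?D k u x) (?D k v x))" for u v
    unfolding inner_h2per_def set_lebesgue_integral_def
    by (intro sum.cong Bochner_Integration.integral_cong) (auto simp: indicator_def)
  have sq: "?D k u \<in> borel_measurable lebesgue" "integrable lebesgue (\<lambda>x. (cmod (?D k u x))\<^sup>2)"
    if "k \<le> 2" for k u
    using h2per_deriv(2)[OF that, of u] unfolding locally_square_integrable_def square_integrable_iff
    by blast+
  have int: "integrable lebesgue (\<lambda>x. inner (?D k u x) (?D k v x))" if k: "k \<le> 2" for k u v
  proof (rule Bochner_Integration.integrable_bound)
    show "integrable lebesgue (\<lambda>x. (cmod (?D k u x))\<^sup>2 + (cmod (?D k v x))\<^sup>2)"
      by (intro Bochner_Integration.integrable_add sq k)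
    show "(\<lambda>x. inner (?D k u x) (?D k v x)) \<in> borel_measurable lebesgue"
      by (intro borel_measurable_inner sq k)
    have *: "norm (inner z w) \<le> norm ((cmod z)\<^sup>2 + (cmod w)\<^sup>2)" for z w :: complex
    proof -
      have "\<bar>inner z w\<bar> \<le> cmod z * cmod w" by (rule Cauchy_Schwarz_ineq2)
      also have "\<dots> \<le> (cmod z)\<^sup>2 + (cmod w)\<^sup>2"
        using zero_le_power2[of "cmod z - cmod w"] zero_le_power2[of "cmod z"] zero_le_power2[of "cmod w"]
        unfolding power2_diff by linarith
      finally show ?thesis by simp
    qed
    show "AE x in lebesgue. norm (inner (?D k u x) (?D k v x)) \<le>
        norm ((cmod (?D k u x))\<^sup>2 + (cmod (?D k v x))\<^sup>2)"
      by (intro AE_I2 *)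
  qed
  have D_add: "AE x in lebesgue. h2per_deriv k (u + v) x = h2per_deriv k u x + h2per_deriv k v x"
    if k: "k \<le> 2" for k u v
    by (rule has_weak_deriv_unique[OF h2per_deriv(1)[OF k]],
        rule has_weak_deriv_AE_cong[OF has_weak_deriv_add[OF h2per_deriv(1)[OF k] h2per_deriv(1)[OF k]]])
      (use rep_add[of u v] in \<open>eventually_elim, simp\<close>)
  have D_scaleR: "AE x in lebesgue. h2per_deriv k (c *\<^sub>R u) x = c *\<^sub>R h2per_deriv k u x"
    if k: "k \<le> 2" for k c u
    by (rule has_weak_deriv_unique[OF h2per_deriv(1)[OF k]],
        rule has_weak_deriv_AE_cong[OF has_weak_deriv_scaleR[OF h2per_deriv(1)[OF k]]])
      (use rep_scaleR[of c u] in \<open>eventually_elim, simp\<close>)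
  show "inner (u + v) w = inner u w + inner v w"
    unfolding I sum.distrib[symmetric]
  proof (rule sum.cong)
    fix k :: nat assume "k \<in> {..2}" then have k: "k \<le> 2" by simp
    have "(LINT x|lebesgue. inner (?D k (u + v) x) (?D k w x)) =
          (LINT x|lebesgue. inner (?D k u x) (?D k w x) + inner (?D k v x) (?D k w x))"
    proof (rule integral_cong_AE)
      show "AE x in lebesgue. inner (?D k (u + v) x) (?D k w x) =
          inner (?D k u x) (?D k w x) + inner (?D k v x) (?D k w x)"
        using D_add[OF k, of u v] by eventually_elim (simp only: scaleR_add_right inner_add_left)
    qed (intro borel_measurable_add borel_measurable_inner sq k)+
    then show "(LINT x|lebesgue. inner (?D k (u + v) x) (?D k w x)) =
        (LINT x|lebesgue. inner (?D k u x) (?D k w x)) + (LINT x|lebesgue. inner (?D k v x) (?D k w x))"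
      using Bochner_Integration.integral_add[OF int[OF k, of u w] int[OF k, of v w]] by simp
  qed simp
  have scaleR: "inner (c *\<^sub>R u) v = c * inner u v" for c :: real and u v :: h2per
    unfolding I sum_distrib_left
  proof (rule sum.cong)
    fix k :: nat assume "k \<in> {..2}" then have k: "k \<le> 2" by simp
    have "(LINT x|lebesgue. inner (?D k (c *\<^sub>R u) x) (?D k v x)) =
          (LINT x|lebesgue. c * inner (?D k u x) (?D k v x))"
    proof (rule integral_cong_AE)
      show "AE x in lebesgue. inner (?D k (c *\<^sub>R u) x) (?D k v x) = c * inner (?D k u x) (?D k v x)"
        using D_scaleR[OF k, of c u] by eventually_elim simp
    qed (intro borel_measurable_times borel_measurable_const borel_measurable_inner sq k)+
    then show "(LINT x|lebesgue. inner (?D k (c *\<^sub>R u) x) (?D k v x)) =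
        c * (LINT x|lebesgue. inner (?D k u x) (?D k v x))" by simp
  qed simp
  show "inner (c *\<^sub>R u) v = c * inner u v" by (rule scaleR)
  show "0 \<le> inner u u" unfolding I by (intro sum_nonneg integral_nonneg) simp
  show "inner u u = 0 \<longleftrightarrow> u = 0"
  proof
    assume "inner u u = 0"
    then have "\<forall>k\<in>{..2}. (LINT x|lebesgue. inner (?D k u x) (?D k u x)) = 0"
      unfolding I by (subst (asm) sum_nonneg_eq_0_iff) (auto intro!: integral_nonneg)
    then have "(LINT x|lebesgue. inner (?D 0 u x) (?D 0 u x)) = 0" by blast
    then have "AE x in lebesgue. inner (?D 0 u x) (?D 0 u x) = 0"
      using integral_nonneg_eq_0_iff_AE[OF int[of 0 u u]] by simp
    then have "AE x in lebesgue. x \<in> {0..2*pi} \<longrightarrow> rep_h2per u x = 0"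
      using h2per_deriv_0[of u] by eventually_elim (auto simp: indicator_def)
    then obtain N where N: "N \<in> null_sets lebesgue"
      "\<And>x. x \<in> space lebesgue - N \<Longrightarrow> x \<in> {0..2*pi} \<longrightarrow> rep_h2per u x = 0"
      by (rule AE_E3) (rule that)
    have neg: "negligible {x \<in> {0..2*pi}. rep_h2per u x \<noteq> 0}" (is "negligible ?N")
      by (rule negligible_subset[of N]) (use N in \<open>auto simp: negligible_iff_null_sets\<close>)
    have per: "rep_h2per u (x + 2 * pi) = rep_h2per u x" for x
      using rep_h2per_in[of u] by (simp add: H2per_funs_def)
    interpret periodic_fun_simple "rep_h2per u" "2 * pi" by unfold_locales (rule per)
    have cover: "x \<in> (\<Union>n::int. (+) (of_int n * (2 * pi)) ` ?N)" if x: "rep_h2per u x \<noteq> 0" for x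
    proof -
      define n where "n = \<lfloor>x / (2 * pi)\<rfloor>"
      have "of_int n \<le> x / (2 * pi)" "x / (2 * pi) \<le> of_int n + 1"
        unfolding n_def by linarith+
      then have "x - of_int n * (2 * pi) \<in> {0..2*pi}"
        using pi_gt_zero by (auto simp: field_simps)
      moreover have "rep_h2per u (x - of_int n * (2 * pi)) = rep_h2per u x"
        by (rule minus_of_int)
      ultimately have "x - of_int n * (2 * pi) \<in> ?N" using x by simp
      then show ?thesis by (intro UN_I[of n] image_eqI[of _ _ "x - of_int n * (2 * pi)"]) auto
    qed
    have "negligible (\<Union>n::int. (+) (of_int n * (2 * pi)) ` ?N)"
      using neg by (intro negligible_countable_Union) (auto intro: negligible_translation)
    then have "negligible {x. rep_h2per u x \<noteq> 0}"
    proof (rule negligible_subset)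
      show "{x. rep_h2per u x \<noteq> 0} \<subseteq> (\<Union>n::int. (+) (of_int n * (2 * pi)) ` ?N)"
        by (rule subsetI) (rule cover, simp)
    qed
    then have "{x. rep_h2per u x \<noteq> 0} \<in> null_sets lebesgue"
      by (simp add: negligible_iff_null_sets)
    then have ae: "AE x in lebesgue. rep_h2per u x = 0"
      by (rule AE_I'[of "{x. rep_h2per u x \<noteq> 0}"]) auto
    show "u = 0" by (rule h2per_eqI) (use ae rep_0 in \<open>eventually_elim, simp\<close>)
  next
    assume "u = 0"
    have "0 *\<^sub>R (0::h2per) = 0"
      by (rule h2per_eqI) (use rep_scaleR[of 0 0] rep_0 in \<open>eventually_elim, simp\<close>)
    then show "inner u u = 0" using scaleR[of 0 0 u] \<open>u = 0\<close> by simp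
  qed
qed

end


section \<open>The Lugiato--Lefever equation\<close>

text \<open>Only the values of \<open>e\<close> on \<open>{0<..<2*pi}\<close> matter (up to null sets).\<close>

definition periodic_ext :: "(real \<Rightarrow> complex) \<Rightarrow> real \<Rightarrow> complex" where
  "periodic_ext e s = e (s - 2 * pi * of_int \<lfloor>s / (2 * pi)\<rfloor>)"

definition LLE_solution ::
  "real \<Rightarrow> real \<Rightarrow> real \<Rightarrow> real \<Rightarrow> (real \<Rightarrow> complex) \<Rightarrow> real \<Rightarrow> h2per \<Rightarrow> bool" where
  "LLE_solution d \<zeta> \<omega> f\<^sub>0 e f\<^sub>1 u \<longleftrightarrow>
     (AE s in lebesgue.
        - complex_of_real d * h2per_deriv 2 u s + \<i> * complex_of_real \<omega> * h2per_deriv 1 u s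
        + (complex_of_real \<zeta> - \<i>) * rep_h2per u s
        - complex_of_real ((cmod (rep_h2per u s))\<^sup>2) * rep_h2per u s
        + \<i> * complex_of_real f\<^sub>0 + \<i> * complex_of_real f\<^sub>1 * periodic_ext e s = 0)"

definition linearization ::
  "real \<Rightarrow> real \<Rightarrow> real \<Rightarrow> h2per \<Rightarrow> h2per \<Rightarrow> real \<Rightarrow> complex" where
  "linearization d \<zeta> \<omega> u \<phi> s =
     - complex_of_real d * h2per_deriv 2 \<phi> s + \<i> * complex_of_real \<omega> * h2per_deriv 1 \<phi> s
     + (complex_of_real \<zeta> - \<i> - 2 * complex_of_real ((cmod (rep_h2per u s))\<^sup>2)) * rep_h2per \<phi> s
     - (rep_h2per u s)\<^sup>2 * cnj (rep_h2per \<phi> s)"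

text \<open>
  The right-hand side is the real span of \<open>u'\<close>; it is written with representatives because \<open>u'\<close>
  is only known to have an \<open>h2per\<close> representative once \<open>u\<close> solves the equation.
\<close>

definition nondegenerate :: "real \<Rightarrow> real \<Rightarrow> real \<Rightarrow> h2per \<Rightarrow> bool" where
  "nondegenerate d \<zeta> \<omega> u \<longleftrightarrow>
     {\<phi>. AE s in lebesgue. linearization d \<zeta> \<omega> u \<phi> s = 0} =
     {\<phi>. \<exists>c::real. AE s in lebesgue. rep_h2per \<phi> s = c *\<^sub>R h2per_deriv 1 u s}"

definition LLE_solution_set ::
  "real \<Rightarrow> real \<Rightarrow> real \<Rightarrow> real \<Rightarrow> (real \<Rightarrow> complex) \<Rightarrow> (real \<times> h2per) set" where
  "LLE_solution_set d \<zeta> \<omega> f\<^sub>0 e = {(f\<^sub>1, u). 0 \<le> f\<^sub>1 \<and> LLE_solution d \<zeta> \<omega> f\<^sub>0 e f\<^sub>1 u}"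

definition maximal_continuum :: "'a::topological_space set \<Rightarrow> 'a \<Rightarrow> 'a set" where
  "maximal_continuum S p = (GREATEST C. closed C \<and> connected C \<and> C \<subseteq> S \<and> p \<in> C)"

lemma maximal_continuum_eq_component:
  assumes "closed S" "p \<in> S"
  shows "maximal_continuum S p = connected_component_set S p"
  unfolding maximal_continuum_def
proof (rule Greatest_equality)
  show "closed (connected_component_set S p) \<and> connected (connected_component_set S p) \<and>
      connected_component_set S p \<subseteq> S \<and> p \<in> connected_component_set S p"
    using assms by (auto simp: closed_connected_component dest: connected_component_in)
  show "C \<subseteq> connected_component_set S p" if "closed C \<and> connected C \<and> C \<subseteq> S \<and> p \<in> C" for C
    using that by (intro connected_component_maximal) auto
qed

definition C_bound :: "real \<Rightarrow> real \<Rightarrow> real" where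
  "C_bound d f\<^sub>0 = \<bar>f\<^sub>0\<bar> * (1 + 2 * pi\<^sup>2 * f\<^sub>0\<^sup>2 / \<bar>d\<bar>)"

end

theory Submission
  imports Defs "HOL-Complex_Analysis.Great_Picard"
begin

text \<open>
  Write the equation as \<open>L u = \<bar>u\<bar>\<^sup>2 u - \<i> f\<close> with \<open>L u = - d u'' + \<i> \<omega> u' + (\<zeta> - \<i>) u\<close> and
  \<open>f = f\<^sub>0 + f\<^sub>1 e\<close>. Testing \<open>L u = g\<close> with \<open>u\<close>, the damping term \<open>- \<i> u\<close> gives
  \<open>\<parallel>u\<parallel> \<le> \<parallel>g\<parallel>\<close> in \<open>L\<^sup>2\<close>; hence \<open>L\<close> is invertible on periodic functions
  (\<open>elliptic_estimate\<close>, \<open>LLop_solution_exists\<close>), and the solutions are the fixed points of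
  \<open>T f\<^sub>1 u = L\<^sup>-\<^sup>1 (\<bar>u\<bar>\<^sup>2 u - \<i> f)\<close>. Since \<open>H\<^sup>2\<close> embeds compactly into the continuous functions, \<open>T\<close> is
  continuous and compact.

  After testing with \<open>u\<close> the cubic term is real, so it drops out of the imaginary part: every
  \<open>u = t T f\<^sub>1 u\<close> with \<open>0 \<le> t \<le> 1\<close> satisfies \<open>\<parallel>u\<parallel> \<le> \<parallel>f\<parallel>\<close> in \<open>L\<^sup>2\<close>. In the real part the resulting
  quartic term is subcritical in one dimension, so that \<open>u\<close> is bounded in \<open>H\<^sup>2\<close> as long as \<open>f\<^sub>1\<close> stays
  bounded (\<open>T_bound\<close>). In the language of degree theory, \<open>id - T f\<^sub>1\<close> has degree one on large balls
  for every \<open>f\<^sub>1\<close>. If the solution for \<open>f\<^sub>1 = 0\<close> is unique, its component therefore cannot end before any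
  given \<open>f\<^sub>1\<close>. This is \<open>leray_schauder_continuum\<close>, which is deduced from Schauder's fixed point
  theorem without a degree: if the component ended, the compact solution set would split into two
  closed parts, and a function separating them would give a fixed point problem on the product of
  the parameter interval and a ball without any solution.

  It remains to prove uniqueness for \<open>f\<^sub>1 = 0\<close> (\<open>unique_solution\<close>). There all solutions obey
  \<open>\<bar>u\<bar> \<le> C(d, f\<^sub>0)\<close>, so the difference of two cubic terms is at most \<open>3 C\<^sup>2\<close> times the difference of
  the solutions. Testing the equation for the difference with itself settles the case \<open>3 C\<^sup>2 < 1\<close> by the
  imaginary part and the case of large \<open>sgn d * \<zeta>\<close> by the real part. If \<open>- sgn d * \<zeta>\<close> is large, the
  real part of the energy identity for a single solution makes its mean square so small that
  \<open>3 \<bar>u\<bar>\<^sup>2 < 1\<close>, and the first argument applies again.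
\<close>

section \<open>Schauder's fixed point theorem\<close>

text \<open>
  The finite-dimensional cubes all live in this one compact space: coordinates from some index on are
  ignored, so the dimension can be a variable.
\<close>

definition hilbert_cube :: "(nat \<Rightarrow> real) set" where
  "hilbert_cube = {x. \<forall>i. x i \<in> {0..1}}"

lemma compact_hilbert_cube: "compact hilbert_cube"
proof -
  have "hilbert_cube = PiE UNIV (\<lambda>i. {0..1})"
    by (auto simp: hilbert_cube_def PiE_def Pi_def)
  moreover have "compactin (product_topology (\<lambda>i. euclidean) UNIV) (PiE UNIV (\<lambda>i::nat. {0..1::real}))"
    by (simp add: compactin_PiE)
  ultimately show ?thesis
    by (simp add: euclidean_product_topology)
qed

lemma dist_fun_le:
  fixes x y :: "nat \<Rightarrow> real"
  assumes "\<And>i. dist (x i) (y i) \<le> r"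
  shows "dist x y \<le> 2 * r"
proof -
  have "0 \<le> r" using assms[of 0] zero_le_dist order_trans by blast
  have s: "summable (\<lambda>n. (1 / 2) ^ n * min (dist (x (from_nat n)) (y (from_nat n))) 1)"
    by (rule summable_comparison_test'[of "\<lambda>n. (1/2)^n"]) (auto simp: summable_geometric)
  have "dist x y \<le> (\<Sum>n. (1/2)^n * r)"
    unfolding dist_fun_def
    using assms by (intro suminf_le[OF _ s] summable_mult2 mult_left_mono)
      (auto intro: min.coboundedI1 summable_geometric)
  also have "\<dots> = 2 * r"
    using suminf_geometric[of "1/2::real"] by (simp add: suminf_mult2[symmetric] summable_geometric)
  finally show ?thesis .
qed

text \<open>
  Kuhn's combinatorial lemma on a fine grid, labelling a grid point by the direction in which \<open>f\<close> moves
  its coordinates. Near the resulting grid cell every coordinate is moved both up and down, so by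
  uniform continuity it is hardly moved at all.
\<close>

lemma approximate_brouwer_cube:
  fixes f :: "(nat \<Rightarrow> real) \<Rightarrow> nat \<Rightarrow> real"
  assumes range: "\<And>x i. x \<in> hilbert_cube \<Longrightarrow> i < n \<Longrightarrow> f x i \<in> {0..1}"
    and cont: "\<And>i. i < n \<Longrightarrow> continuous_on hilbert_cube (\<lambda>x. f x i)"
    and "0 < e"
  obtains x where "x \<in> hilbert_cube" "\<And>i. i < n \<Longrightarrow> \<bar>f x i - x i\<bar> \<le> e"
proof -
  have "\<exists>d>0. \<forall>x\<in>hilbert_cube. \<forall>y\<in>hilbert_cube. dist y x < d \<longrightarrow> dist (f y i) (f x i) < e/2"
    if "i < n" for i
    using compact_uniformly_continuous[OF cont[OF that] compact_hilbert_cube] \<open>0 < e\<close>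
    unfolding uniformly_continuous_on_def by (meson half_gt_zero)
  then obtain d where d: "\<And>i. i < n \<Longrightarrow> d i > 0"
    "\<And>i x y. i < n \<Longrightarrow> x \<in> hilbert_cube \<Longrightarrow> y \<in> hilbert_cube \<Longrightarrow> dist y x < d i \<Longrightarrow> dist (f y i) (f x i) < e/2"
    by metis
  define D where "D = Min (insert 1 (d ` {..<n}))"
  have D: "D > 0" "\<And>i. i < n \<Longrightarrow> D \<le> d i" using d(1) by (auto simp: D_def)
  obtain p :: nat where p: "p > 0" "2 / real p < D" "1 / real p < e/2"
  proof -
    obtain p :: nat where "max (2/D) (2/e) < real p" using reals_Archimedean2 by blast
    then have "2/D < p" "2/e < p" by auto
    moreover from this have "0 < p" using D \<open>0<e\<close> by (metis divide_pos_pos less_trans of_nat_0_less_iff zero_less_numeral)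
    ultimately show ?thesis using D \<open>0<e\<close> by (intro that[of p]) (auto simp: field_simps)
  qed
  define pt :: "(nat \<Rightarrow> nat) \<Rightarrow> nat \<Rightarrow> real" where "pt q = (\<lambda>i. if i < n then real (q i) / real p else 0)" for q
  have pt: "pt q \<in> hilbert_cube" if "\<forall>i<n. q i \<le> p" for q
    using that p(1) by (auto simp: pt_def hilbert_cube_def)
  define label where
    "label q i = (if q i \<noteq> p \<and> (q i = 0 \<or> pt q i \<le> f (pt q) i) then 0 else 1::nat)" for q i
  obtain q where q: "\<forall>i<n. q i < p"
    and rs: "\<forall>i<n. \<exists>r s. (\<forall>j<n. q j \<le> r j \<and> r j \<le> q j + 1) \<and> (\<forall>j<n. q j \<le> s j \<and> s j \<le> q j + 1) \<and>
      label r i \<noteq> label s i"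
    by (rule kuhn_lemma[OF p(1), of n label]) (use p(1) in \<open>auto simp: label_def\<close>)
  have l0: "pt r i \<le> f (pt r) i" if "\<forall>j<n. r j \<le> p" "i < n" "label r i = 0" for r i
    using that range[OF pt[OF that(1)] that(2)] by (auto simp: label_def pt_def split: if_splits)
  have l1: "f (pt r) i \<le> pt r i" if "\<forall>j<n. r j \<le> p" "i < n" "label r i \<noteq> 0" for r i
    using that range[OF pt[OF that(1)] that(2)] p(1) by (auto simp: label_def pt_def split: if_splits)
  have close: "\<bar>pt r i - pt q i\<bar> \<le> 1 / p \<and> \<bar>f (pt r) i - f (pt q) i\<bar> < e/2 \<and> (\<forall>j<n. r j \<le> p)"
    if r: "\<forall>j<n. q j \<le> r j \<and> r j \<le> q j + 1" and i: "i < n" for r i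
  proof -
    have rp: "\<forall>j<n. r j \<le> p" using r q by (metis Suc_eq_plus1 less_eq_Suc_le order_trans)
    have c: "dist (pt r j) (pt q j) \<le> 1 / p" for j
    proof (cases "j < n")
      case True
      then have "\<bar>real (r j) - real (q j)\<bar> \<le> 1" using r by force
      then have "\<bar>real (r j) - real (q j)\<bar> / p \<le> 1 / p" by (intro divide_right_mono) auto
      then show ?thesis using True p(1)
        by (simp add: pt_def dist_real_def diff_divide_distrib[symmetric])
    qed (simp add: pt_def)
    have "dist (pt r) (pt q) \<le> 2 * (1/p)" by (rule dist_fun_le) (rule c)
    then have "dist (pt r) (pt q) < d i" using p(2) D(2)[OF i] by simp
    then have "dist (f (pt r) i) (f (pt q) i) < e/2"
      using q by (intro d(2)[OF i] pt rp) (auto intro: less_imp_le)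
    then show ?thesis using c[of i] rp by (simp add: dist_real_def)
  qed
  show thesis
  proof (rule that)
    show "pt q \<in> hilbert_cube" using q by (intro pt) (auto intro: less_imp_le)
    fix i assume i: "i < n"
    obtain r s where r: "\<forall>j<n. q j \<le> r j \<and> r j \<le> q j + 1" and s: "\<forall>j<n. q j \<le> s j \<and> s j \<le> q j + 1"
      and "label r i \<noteq> label s i" using rs i by blast
    moreover have "\<And>r. label r i = 0 \<or> label r i = 1" by (auto simp: label_def)
    ultimately obtain r s where r: "\<forall>j<n. q j \<le> r j \<and> r j \<le> q j + 1" and s: "\<forall>j<n. q j \<le> s j \<and> s j \<le> q j + 1"
      and "label r i = 0" "label s i \<noteq> 0" by metis
    then have "pt r i \<le> f (pt r) i" "f (pt s) i \<le> pt s i"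
      using close[OF r i] close[OF s i] l0[of r i] l1[of s i] i by blast+
    then show "\<bar>f (pt q) i - pt q i\<bar> \<le> e"
      using close[OF r i] close[OF s i] p(3) by linarith
  qed
qed

text \<open>
  The Schauder projection \<open>z \<mapsto> (\<Sum>i<n. \<mu> i z *\<^sub>R y i)\<close>: a partition of unity subordinate to a
  finite \<open>e\<close>-net moves no point of \<open>K\<close> by more than \<open>e\<close>.
\<close>

lemma schauder_projection:
  fixes K :: "'a::real_normed_vector set"
  assumes "compact K" "K \<noteq> {}" "0 < e"
  obtains n :: nat and y \<mu> where "\<And>i. i < n \<Longrightarrow> y i \<in> K" "n > 0"
    "\<And>i. i < n \<Longrightarrow> continuous_on K (\<mu> i)"
    "\<And>i z. i < n \<Longrightarrow> z \<in> K \<Longrightarrow> \<mu> i z \<in> {0..1::real}"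
    "\<And>z. z \<in> K \<Longrightarrow> (\<Sum>i<n. \<mu> i z) = 1"
    "\<And>z. z \<in> K \<Longrightarrow> norm ((\<Sum>i<n. \<mu> i z *\<^sub>R y i) - z) \<le> e"
proof -
  obtain A where A: "finite A" "A \<subseteq> K" "K \<subseteq> (\<Union>x\<in>A. ball x e)"
    using seq_compact_imp_totally_bounded[of K] compact_imp_seq_compact[OF assms(1)] assms(3) by metis
  obtain y where y: "bij_betw y {0..<card A} A" using ex_bij_betw_nat_finite[OF A(1)] by blast
  let ?n = "card A"
  have yA: "y ` {..<?n} = A" using y by (simp add: bij_betw_def atLeast0LessThan)
  define m where "m i z = max 0 (e - norm (z - y i))" for i z
  define \<mu> where "\<mu> i z = m i z / (\<Sum>j<?n. m j z)" for i z
  have pos: "0 < (\<Sum>j<?n. m j z)" if "z \<in> K" for z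
  proof -
    obtain a where "a \<in> A" "dist a z < e" using A(3) \<open>z \<in> K\<close> by auto
    then obtain i where "i < ?n" "norm (z - y i) < e" using yA by (metis imageE lessThan_iff dist_norm dist_commute)
    then show ?thesis by (intro sum_pos2[of _ i]) (auto simp: m_def)
  qed
  show thesis
  proof (rule that[of ?n y \<mu>])
    show "y i \<in> K" if "i < ?n" for i using that yA A(2) by auto
    show "?n > 0" using A assms(2) by (auto simp: card_gt_0_iff)
    show "continuous_on K (\<mu> i)" for i
      unfolding \<mu>_def m_def
      by (intro continuous_intros) (use pos in \<open>fastforce simp: m_def\<close>)
    show \<mu>1: "(\<Sum>i<?n. \<mu> i z) = 1" if "z \<in> K" for z
      using pos[OF that] by (simp add: \<mu>_def sum_divide_distrib[symmetric])
    have \<mu>0: "0 \<le> \<mu> i z" if "z \<in> K" for i z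
      using pos[OF that] by (auto simp: \<mu>_def m_def intro!: divide_nonneg_pos)
    show "\<mu> i z \<in> {0..1}" if i: "i < ?n" and z: "z \<in> K" for i z
      using member_le_sum[of i "{..<?n}" "\<lambda>i. \<mu> i z"] \<mu>0[OF z] \<mu>1[OF z] i by auto
    show "norm ((\<Sum>i<?n. \<mu> i z *\<^sub>R y i) - z) \<le> e" if z: "z \<in> K" for z
    proof -
      have "(\<Sum>i<?n. \<mu> i z *\<^sub>R y i) - z = (\<Sum>i<?n. \<mu> i z *\<^sub>R (y i - z))"
        using \<mu>1[OF z] by (simp add: scaleR_diff_right sum_subtractf scaleR_sum_left[symmetric])
      also have "norm \<dots> \<le> (\<Sum>i<?n. \<mu> i z * e)"
      proof (rule sum_norm_le)
        fix i assume "i \<in> {..<?n}"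
        have "\<mu> i z = 0" if "norm (y i - z) > e" using that by (simp add: \<mu>_def m_def norm_minus_commute)
        then show "norm (\<mu> i z *\<^sub>R (y i - z)) \<le> \<mu> i z * e"
          using \<mu>0[OF z, of i] by (cases "norm (y i - z) > e") (auto intro!: mult_left_mono)
      qed
      also have "\<dots> = e" using \<mu>1[OF z] by (simp add: sum_distrib_right[symmetric])
      finally show ?thesis .
    qed
  qed
qed

text \<open>
  Read through the Schauder projection, \<open>T\<close> becomes a map of weight vectors. The weights are
  kept in a cube instead of a simplex; \<open>c x\<close> below turns an arbitrary point of the cube into
  weights of a convex combination, which changes a point of the simplex not at all and an approximate fixed
  point only slightly.
\<close>

lemma schauder_approximate:
  fixes T :: "'a::real_normed_vector \<Rightarrow> 'a"
  assumes C: "convex C" "C \<noteq> {}" and T: "continuous_on C T" "T ` C \<subseteq> K" "compact K" "K \<subseteq> C"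
    and "0 < e"
  obtains x where "x \<in> C" "norm (T x - x) \<le> e"
proof -
  have "K \<noteq> {}" using C T by blast
  from schauder_projection[OF \<open>compact K\<close> this half_gt_zero[OF \<open>0 < e\<close>]]
  obtain n :: nat and y \<mu> where y: "\<And>i. i < n \<Longrightarrow> y i \<in> K" and n: "n > 0"
    and \<mu>c: "\<And>i. i < n \<Longrightarrow> continuous_on K (\<mu> i)"
    and \<mu>01: "\<And>i z. i < n \<Longrightarrow> z \<in> K \<Longrightarrow> \<mu> i z \<in> {0..1::real}"
    and \<mu>1: "\<And>z. z \<in> K \<Longrightarrow> (\<Sum>i<n. \<mu> i z) = 1"
    and \<mu>e: "\<And>z. z \<in> K \<Longrightarrow> norm ((\<Sum>i<n. \<mu> i z *\<^sub>R y i) - z) \<le> e/2"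
    by blast
  \<comment> \<open>If the sum of the weights is too small, weight \<open>0\<close> takes the rest; if it is too large, all are rescaled.\<close>
  define c :: "(nat \<Rightarrow> real) \<Rightarrow> nat \<Rightarrow> real" where
    "c x i = (x i + (if i = 0 then max 0 (1 - (\<Sum>j<n. x j)) else 0)) / max 1 (\<Sum>j<n. x j)" for x i
  define g where "g x = (\<Sum>i<n. c x i *\<^sub>R y i)" for x
  have c_sum: "(\<Sum>i<n. c x i) = 1" for x
  proof -
    have "(\<Sum>i<n. x i + (if i = 0 then max 0 (1 - (\<Sum>j<n. x j)) else 0)) = max 1 (\<Sum>j<n. x j)"
      using n by (simp add: sum.distrib sum.delta' max_def)
    then show ?thesis by (simp add: c_def sum_divide_distrib[symmetric])
  qed
  have c_nonneg: "0 \<le> c x i" if "x \<in> hilbert_cube" for x i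
    using that by (auto simp: c_def hilbert_cube_def intro!: divide_nonneg_pos)
  have gC: "g x \<in> C" if "x \<in> hilbert_cube" for x
    unfolding g_def by (rule convex_sum) (use C y T(4) c_sum c_nonneg[OF that] in auto)
  have coord: "continuous_on hilbert_cube (\<lambda>x. x i)" for i
    by (rule continuous_on_subset[OF continuous_on_product_coordinates]) simp
  have gc: "continuous_on hilbert_cube g"
  proof -
    have "continuous_on hilbert_cube (\<lambda>x. if i = 0 then max 0 (1 - (\<Sum>j<n. x j)) else 0)" for i :: nat
      by (cases "i = 0") (auto intro!: continuous_intros coord)
    then show ?thesis
      unfolding g_def c_def by (intro continuous_intros coord) auto
  qed
  obtain Y where Y: "Y \<ge> 0" "\<And>i. i < n \<Longrightarrow> norm (y i) \<le> Y"
  proof -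
    obtain Y where "\<And>z. z \<in> K \<Longrightarrow> norm z \<le> Y"
      using compact_imp_bounded[OF \<open>compact K\<close>] by (auto simp: bounded_iff)
    then show ?thesis using y by (intro that[of "max 0 Y"]) (auto intro: max.coboundedI2)
  qed
  define \<delta> where "\<delta> = (e/2) / (real n * (real n + 1) * (Y + 1))"
  have \<delta>: "\<delta> > 0" using n Y \<open>0<e\<close> by (simp add: \<delta>_def)
  obtain x where x: "x \<in> hilbert_cube" "\<And>i. i < n \<Longrightarrow> \<bar>\<mu> i (T (g x)) - x i\<bar> \<le> \<delta>"
  proof (rule approximate_brouwer_cube[of n "\<lambda>x i. \<mu> i (T (g x))" \<delta>])
    show "\<mu> i (T (g x)) \<in> {0..1}" if "x \<in> hilbert_cube" "i < n" for x i
      using that gC T by (intro \<mu>01) auto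
    show "continuous_on hilbert_cube (\<lambda>x. \<mu> i (T (g x)))" if "i < n" for i
    proof (rule continuous_on_compose2[OF \<mu>c[OF that]])
      show "continuous_on hilbert_cube (\<lambda>x. T (g x))"
        by (rule continuous_on_compose2[OF T(1) gc]) (use gC in auto)
    qed (use gC T in auto)
  qed (use \<delta> in auto)
  define z where "z = T (g x)"
  have z: "z \<in> K" using gC[OF x(1)] T by (auto simp: z_def)
  define \<sigma> where "\<sigma> = (\<Sum>i<n. x i)"
  have "\<sigma> - 1 = (\<Sum>i<n. x i - \<mu> i z)" using \<mu>1[OF z] by (simp add: sum_subtractf \<sigma>_def)
  also have "\<bar>\<dots>\<bar> \<le> (\<Sum>i<n. \<delta>)"
    by (intro order_trans[OF sum_abs] sum_mono)
      (use x(2) in \<open>auto simp: z_def abs_minus_commute\<close>)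
  finally have \<sigma>: "\<bar>\<sigma> - 1\<bar> \<le> n * \<delta>" by simp
  have "\<bar>c x i - x i\<bar> \<le> n * \<delta>" if "i < n" for i
  proof (cases "\<sigma> \<le> 1")
    case True
    then have "c x i - x i = (if i = 0 then 1 - \<sigma> else 0)" by (simp add: c_def \<sigma>_def)
    then show ?thesis using \<sigma> True \<delta> by auto
  next
    case False
    then have "c x i - x i = - (x i * (\<sigma> - 1) / \<sigma>)" 
      by (auto simp: c_def \<sigma>_def[symmetric] field_simps)
    then have eq: "\<bar>c x i - x i\<bar> = x i * (\<sigma> - 1) / \<sigma>"
      using False x(1) by (auto simp: hilbert_cube_def)
    have "x i * (\<sigma> - 1) / \<sigma> \<le> (1 * (\<sigma> - 1)) / 1"
      using False x(1) by (intro frac_le mult_right_mono mult_nonneg_nonneg) (auto simp: hilbert_cube_def)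
    then show ?thesis using \<sigma> False eq by simp
  qed
  then have "\<bar>c x i - \<mu> i z\<bar> \<le> (n + 1) * \<delta>" if "i < n" for i
    using x(2)[OF that] that unfolding z_def[symmetric] by (fastforce simp: algebra_simps)
  then have "norm (\<Sum>i<n. (c x i - \<mu> i z) *\<^sub>R y i) \<le> (\<Sum>i<n. (n + 1) * \<delta> * Y)"
    using Y \<delta> by (intro sum_norm_le) (auto intro!: mult_mono)
  also have "\<dots> = real n * (real n + 1) * Y * \<delta>" by (simp add: algebra_simps)
  also have "\<dots> \<le> real n * (real n + 1) * (Y + 1) * \<delta>"
    using Y \<delta> by (intro mult_right_mono mult_left_mono) auto
  also have "\<dots> = e/2" using n Y by (simp add: \<delta>_def)
  finally have "norm (g x - (\<Sum>i<n. \<mu> i z *\<^sub>R y i)) \<le> e/2"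
    by (simp add: g_def scaleR_diff_left sum_subtractf)
  with \<mu>e[OF z] have "norm (g x - z) \<le> e/2 + e/2"
    using norm_diff_triangle_le by blast
  then show thesis using gC[OF x(1)] by (intro that[of "g x"]) (auto simp: z_def norm_minus_commute)
qed

text \<open>
  As \<open>K\<close> is compact, the images of better and better approximate fixed points have a limit point, which is fixed.
\<close>

theorem schauder:
  fixes T :: "'a::real_normed_vector \<Rightarrow> 'a"
  assumes C: "convex C" "C \<noteq> {}" and T: "continuous_on C T" "T ` C \<subseteq> K" "compact K" "K \<subseteq> C"
  obtains x where "x \<in> C" "T x = x"
proof -
  have "\<exists>x\<in>C. norm (T x - x) \<le> inverse (Suc k)" for k
    using schauder_approximate[OF C T, of "inverse (Suc k)"] by (metis inverse_positive_iff_positive of_nat_0_less_iff zero_less_Suc)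
  then obtain x where x: "\<And>k. x k \<in> C" "\<And>k. norm (T (x k) - x k) \<le> inverse (Suc k)" by metis
  obtain l r where l: "l \<in> K" "strict_mono r" "((\<lambda>k. T (x k)) \<circ> r) \<longlonglongrightarrow> l"
    using compact_imp_seq_compact[OF T(3)] T(2) x(1) unfolding seq_compact_def by (metis image_subset_iff)
  have "(\<lambda>k. T (x k) - x k) \<longlonglongrightarrow> 0"
    by (rule Lim_null_comparison[OF _ LIMSEQ_inverse_real_of_nat]) (use x(2) in auto)
  then have "((\<lambda>k. T (x k) - x k) \<circ> r) \<longlonglongrightarrow> 0" using l(2) by (rule LIMSEQ_subseq_LIMSEQ)
  from tendsto_diff[OF l(3) this] have xl: "(\<lambda>k. x (r k)) \<longlonglongrightarrow> l" by (simp add: o_def)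
  have "(\<lambda>k. T (x (r k))) \<longlonglongrightarrow> T l"
    using T l xl x(1) by (intro continuous_on_tendsto_compose[OF T(1) xl]) auto
  then have "T l = l" using l(3) LIMSEQ_unique by (auto simp: o_def)
  then show thesis using l T(4) by (intro that[of l]) auto
qed


section \<open>Continua of fixed points\<close>

text \<open>
  Schauder's theorem for \<open>(l, u) \<mapsto> (\<theta> (l, u), \<rho> (T l u))\<close>, where \<open>\<rho>\<close> is the radial retraction
  onto the ball of radius \<open>R\<close>. A fixed point satisfies \<open>u = s *\<^sub>R T l u\<close> with some \<open>s \<in> {0..1}\<close>, and for
  \<open>s < 1\<close> the norm of \<open>u\<close> would be \<open>R\<close>, against the a priori bound.
\<close>

lemma schauder_graph:
  fixes T :: "real \<Rightarrow> 'a::real_normed_vector \<Rightarrow> 'a" and \<theta> :: "real \<times> 'a \<Rightarrow> real"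
  assumes "0 \<le> M"
    and cont: "continuous_on ({0..M} \<times> UNIV) (\<lambda>(l, u). T l u)"
    and comp: "\<And>R. \<exists>K. compact K \<and> (\<forall>l\<in>{0..M}. \<forall>u. norm u \<le> R \<longrightarrow> T l u \<in> K)"
    and bound: "\<And>l s u. l \<in> {0..M} \<Longrightarrow> s \<in> {0..1} \<Longrightarrow> u = s *\<^sub>R T l u \<Longrightarrow> norm u < R"
    and \<theta>: "continuous_on UNIV \<theta>" "\<And>x. \<theta> x \<in> {0..M}"
  obtains l u where "l \<in> {0..M}" "T l u = u" "\<theta> (l, u) = l"
proof -
  have "R > 0" using bound[of 0 0 0] \<open>0 \<le> M\<close> by simp
  define \<rho> :: "'a \<Rightarrow> 'a" where "\<rho> v = (R / max R (norm v)) *\<^sub>R v" for v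
  have \<rho>c: "continuous_on S \<rho>" for S
    unfolding \<rho>_def using \<open>R > 0\<close> by (intro continuous_intros) auto
  have \<rho>R: "norm (\<rho> v) \<le> R" for v
    using \<open>R > 0\<close> by (simp add: \<rho>_def max_def field_simps)
  obtain K where K: "compact K" "\<And>l u. l \<in> {0..M} \<Longrightarrow> norm u \<le> R \<Longrightarrow> T l u \<in> K"
    using comp[of R] by blast
  define C where "C = {0..M} \<times> cball (0::'a) R"
  define F where "F x = (\<theta> x, \<rho> (T (fst x) (snd x)))" for x
  have "\<exists>x\<in>C. F x = x"
  proof (rule schauder)
    show "convex C" unfolding C_def by (intro convex_Times) auto
    show "C \<noteq> {}" using \<open>0 \<le> M\<close> \<open>R > 0\<close> by (auto simp: C_def)
    have "continuous_on C (\<lambda>x. T (fst x) (snd x))"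
      by (rule continuous_on_subset[OF cont[unfolded case_prod_unfold]]) (auto simp: C_def)
    then show "continuous_on C F"
      unfolding F_def
      by (intro continuous_on_Pair continuous_on_subset[OF \<theta>(1)] continuous_on_compose2[OF \<rho>c[of UNIV]]) auto
    show "F ` C \<subseteq> {0..M} \<times> \<rho> ` K"
      using \<theta>(2) K(2) by (auto simp: F_def C_def)
    show "compact ({0..M} \<times> \<rho> ` K)"
      by (intro compact_Times compact_continuous_image \<rho>c K) auto
    show "{0..M} \<times> \<rho> ` K \<subseteq> C" using \<rho>R by (auto simp: C_def)
  qed blast
  then obtain l u where lu: "l \<in> {0..M}" "\<theta> (l, u) = l" "\<rho> (T l u) = u"
    by (auto simp: F_def C_def)
  have "R / max R (norm (T l u)) \<in> {0..1}" using \<open>R > 0\<close> by (auto simp: divide_simps)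
  from bound[OF lu(1) this] have "norm u < R" using lu(3) by (simp add: \<rho>_def)
  have "norm (T l u) \<le> R"
  proof (rule ccontr)
    assume "\<not> norm (T l u) \<le> R"
    then have "norm (\<rho> (T l u)) = R" using \<open>R > 0\<close> by (auto simp: \<rho>_def max_def)
    with lu(3) \<open>norm u < R\<close> show False by simp
  qed
  then have "T l u = u" using lu(3) \<open>R > 0\<close> by (simp add: \<rho>_def max_def)
  with lu show thesis by (intro that)
qed

text \<open>
  Otherwise the component of \<open>(0, u0)\<close> and the solutions with parameter \<open>M\<close> could be separated by a
  closed and open subset \<open>A\<close> of the compact solution set. Let \<open>\<theta>\<close> be \<open>M\<close> on \<open>A\<close> and \<open>0\<close> on the rest. A
  solution with \<open>l = \<theta> (l, u)\<close> would have parameter \<open>M\<close> and lie in \<open>A\<close>, or have parameter \<open>0\<close> and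
  lie outside \<open>A\<close>; both are impossible, the latter because \<open>u0\<close> is the only solution at \<open>0\<close>.
\<close>

theorem leray_schauder_continuum:
  fixes T :: "real \<Rightarrow> 'a::real_normed_vector \<Rightarrow> 'a"
  assumes "0 \<le> M"
    and cont: "continuous_on ({0..M} \<times> UNIV) (\<lambda>(l, u). T l u)"
    and comp: "\<And>R. \<exists>K. compact K \<and> (\<forall>l\<in>{0..M}. \<forall>u. norm u \<le> R \<longrightarrow> T l u \<in> K)"
    and bound: "\<And>l s u. l \<in> {0..M} \<Longrightarrow> s \<in> {0..1} \<Longrightarrow> u = s *\<^sub>R T l u \<Longrightarrow> norm u < R"
    and uniq: "\<And>u. T 0 u = u \<Longrightarrow> u = u0" and "T 0 u0 = u0"
  shows "\<exists>u. connected_component {(l, u). l \<in> {0..M} \<and> T l u = u} (0, u0) (M, u)"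
proof (rule ccontr)
  define S where "S = {(l, u). l \<in> {0..M} \<and> T l u = u}"
  define C where "C = connected_component_set S (0, u0)"
  define E where "E = S \<inter> {M} \<times> UNIV"
  assume "\<not> ?thesis"
  then have disj: "C \<inter> E = {}" by (auto simp: C_def E_def S_def)
  have graph: "\<exists>x\<in>S. \<theta> x = fst x" if "continuous_on UNIV \<theta>" "\<And>x. \<theta> x \<in> {0..M}" for \<theta>
    using schauder_graph[OF \<open>0 \<le> M\<close> cont comp bound that] unfolding S_def by force
  have "compact S"
  proof -
    obtain K where K: "compact K" "\<And>l u. l \<in> {0..M} \<Longrightarrow> norm u \<le> R \<Longrightarrow> T l u \<in> K"
      using comp[of R] by blast
    have "S = ({0..M} \<times> UNIV) \<inter> (\<lambda>x. (case x of (l, u) \<Rightarrow> T l u) - snd x) -` {0}"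
      by (auto simp: S_def)
    moreover have "closed \<dots>"
      by (intro continuous_closed_preimage continuous_on_diff cont continuous_intros closed_Times)
    ultimately have "closed S" by simp
    moreover have "S \<subseteq> {0..M} \<times> K"
    proof clarify
      fix l u assume "(l, u) \<in> S"
      then have "l \<in> {0..M}" "T l u = u" by (auto simp: S_def)
      moreover from this have "norm u < R" using bound[of l 1 u] by simp
      ultimately show "l \<in> {0..M} \<and> u \<in> K" using K(2)[of l u] by simp
    qed
    ultimately show ?thesis
      using K(1) compact_Times[of "{0..M}" K] by (metis compact_Icc compact_Int_closed inf.absorb_iff2)
  qed
  have p: "(0, u0) \<in> S" using \<open>0 \<le> M\<close> \<open>T 0 u0 = u0\<close> by (simp add: S_def)
  have "separated_between (top_of_set S) C E"
  proof (rule separated_between_compact_connected_component)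
    have "compact_space (top_of_set S)" using \<open>compact S\<close> by (simp add: compact_space_subtopology)
    then show "locally_compact_space (top_of_set S)"
      by (intro compact_imp_locally_compact_space) 
    show "Hausdorff_space (top_of_set S)" by (intro Hausdorff_space_subtopology Hausdorff_space_euclidean)
    show "C \<in> connected_components_of (top_of_set S)"
    proof -
      have "C = connected_component_of_set (top_of_set S) (0, u0)"
        unfolding C_def connected_component_of_def connected_component_def connectedin_subtopology
        by auto
      then show ?thesis
        using connected_component_in_connected_components_of[of "top_of_set S" "(0, u0)"] p by simp
    qed
    have "closedin (top_of_set S) C" unfolding C_def by (rule closedin_connected_component)
    then show "compactin (top_of_set S) C"
      using \<open>compact S\<close> by (intro closedin_compact_space \<open>compact_space _\<close>)
    show "closedin (top_of_set S) E"
      unfolding E_def by (intro closedin_closed_Int closed_Times) auto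
    show "disjnt C E" using disj by (simp add: disjnt_def)
  qed
  then obtain A where A: "closedin (top_of_set S) A" "openin (top_of_set S) A" "C \<subseteq> A" "E \<subseteq> S - A"
    by (auto simp: separated_between)
  define B where "B = S - A"
  have "closedin (top_of_set S) B" unfolding B_def using A(2) by (simp add: closedin_diff)
  then have "closed A" "closed B"
    using A(1) \<open>compact S\<close> closedin_closed_trans compact_imp_closed by blast+
  have "(0, u0) \<in> A" using A(3) p by (auto simp: C_def)
  have "E \<noteq> {}" using graph[of "\<lambda>_. M"] \<open>0 \<le> M\<close> by (force simp: E_def)
  then have "B \<noteq> {}" using A(4) by (auto simp: B_def)
  have "A \<subseteq> S" using A(1) closedin_imp_subset by blast
  have pos: "infdist x A + infdist x B > 0" for x
  proof -
    have "x \<notin> A \<or> x \<notin> B" by (auto simp: B_def)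
    then have "infdist x A > 0 \<or> infdist x B > 0"
      using \<open>closed A\<close> \<open>closed B\<close> \<open>(0, u0) \<in> A\<close> \<open>B \<noteq> {}\<close> infdist_pos_not_in_closed by blast
    then show ?thesis using infdist_nonneg[of x A] infdist_nonneg[of x B] by linarith
  qed
  define \<theta> where "\<theta> x = M * (infdist x B / (infdist x A + infdist x B))" for x
  have "\<exists>x\<in>S. \<theta> x = fst x"
  proof (rule graph)
    show "continuous_on UNIV \<theta>"
      unfolding \<theta>_def using pos by (intro continuous_intros) (metis less_irrefl)
    have "infdist x B / (infdist x A + infdist x B) \<in> {0..1}" for x
      using pos[of x] by (auto simp: infdist_nonneg)
    then show "\<theta> x \<in> {0..M}" for x
      using \<open>0 \<le> M\<close> unfolding \<theta>_def atLeastAtMost_iff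
      by (meson mult_left_le mult_nonneg_nonneg)
  qed
  then obtain l u where lu: "(l, u) \<in> S" "\<theta> (l, u) = l" by force
  show False
  proof (cases "(l, u) \<in> A")
    case True
    then have "\<theta> (l, u) = M" using pos[of "(l, u)"] by (simp add: \<theta>_def)
    then have "(l, u) \<in> E" using lu by (simp add: E_def)
    with True A(4) show False by blast
  next
    case False
    then have "(l, u) \<in> B" using lu by (simp add: B_def)
    then have "l = 0" using lu by (simp add: \<theta>_def)
    then have "u = u0" using lu uniq by (simp add: S_def)
    with \<open>l = 0\<close> False \<open>(0, u0) \<in> A\<close> show False by simp
  qed
qed

section \<open>Primitives of locally integrable functions\<close>

text \<open>
  Absolute continuity with a prescribed almost everywhere derivative. This form survives the
  change of \<open>f\<close> on a null set, and it suits weak derivatives.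
\<close>

definition primitive :: "(real \<Rightarrow> 'a::euclidean_space) \<Rightarrow> (real \<Rightarrow> 'a) \<Rightarrow> bool" where
  "primitive F f \<longleftrightarrow>
     (\<forall>a b. a \<le> b \<longrightarrow> f absolutely_integrable_on {a..b} \<and> integral {a..b} f = F b - F a)"

lemma primitiveD:
  assumes "primitive F f" "a \<le> b"
  shows "f absolutely_integrable_on {a..b}" "integral {a..b} f = F b - F a"
  using assms by (auto simp: primitive_def)

lemma primitiveD':
  assumes "primitive F f"
  shows "f absolutely_integrable_on {a..b}"
  using assms by (cases "a \<le> b") (auto simp: primitive_def)

lemma sigma_finite_lebesgue: "sigma_finite_measure (lebesgue :: real measure)"
proof
  show "\<exists>A. countable A \<and> A \<subseteq> sets lebesgue \<and> \<Union>A = space (lebesgue :: real measure) \<and>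
      (\<forall>a\<in>A. emeasure lebesgue a \<noteq> \<infinity>)"
  proof (intro exI conjI)
    let ?A = "range (\<lambda>n::nat. {- real n..real n})"
    have "x \<in> \<Union>?A" for x
    proof -
      obtain n :: nat where "\<bar>x\<bar> < real n" using reals_Archimedean2 by blast
      then show ?thesis by (auto simp: abs_less_iff intro!: exI[of _ n])
    qed
    then show "\<Union>?A = space (lebesgue :: real measure)" by auto
  qed auto
qed

lemma AE_lebesgue_neq: "AE x in lebesgue. x \<noteq> (y::real)"
  by (intro AE_completion AE_lborel_singleton)

text \<open>
  Fubini's theorem for \<open>f x * g y\<close> on the square, split along the diagonal.
\<close>

lemma lebesgue_integral_by_parts:
  fixes f g :: "real \<Rightarrow> 'a::{euclidean_space, real_normed_field}"
  assumes f: "f absolutely_integrable_on {a..b}" and g: "g absolutely_integrable_on {a..b}"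
  shows "(\<lambda>x. f x * integral {a..x} g) absolutely_integrable_on {a..b}" (is ?i1)
    and "(\<lambda>y. integral {a..y} f * g y) absolutely_integrable_on {a..b}" (is ?i2)
    and "integral {a..b} (\<lambda>x. f x * integral {a..x} g) + integral {a..b} (\<lambda>y. integral {a..y} f * g y) =
      integral {a..b} f * integral {a..b} g" (is ?eq)
proof -
  interpret sigma_finite_measure "lebesgue :: real measure" by (rule sigma_finite_lebesgue)
  interpret pair_sigma_finite "lebesgue :: real measure" "lebesgue :: real measure" ..
  define \<alpha> where "\<alpha> = (\<lambda>x. indicat_real {a..b} x *\<^sub>R f x)"
  define \<beta> where "\<beta> = (\<lambda>x. indicat_real {a..b} x *\<^sub>R g x)"
  have \<alpha>: "integrable lebesgue \<alpha>" and \<beta>: "integrable lebesgue \<beta>"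
    using f g by (simp_all add: set_integrable_def \<alpha>_def \<beta>_def)
  note [measurable] = borel_measurable_integrable[OF \<alpha>] borel_measurable_integrable[OF \<beta>]
  let ?M = "(lebesgue :: real measure) \<Otimes>\<^sub>M (lebesgue :: real measure)"
  define P where "P = (\<lambda>z. \<alpha> (fst z) * \<beta> (snd z))"
  have P: "integrable ?M P"
  proof (rule Fubini_integrable)
    show "P \<in> borel_measurable ?M" unfolding P_def by measurable
    show "integrable lebesgue (\<lambda>x. LINT y|lebesgue. norm (P (x, y)))"
      using \<alpha> \<beta> by (simp add: P_def norm_mult)
    show "AE x in lebesgue. integrable lebesgue (\<lambda>y. P (x, y))"
      using \<beta> by (simp add: P_def)
  qed
  have id: "(\<lambda>x::real. x) \<in> borel_measurable lebesgue" by (simp add: measurable_completion)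
  have [measurable]: "(\<lambda>z. fst z) \<in> borel_measurable ?M" "(\<lambda>z. snd z) \<in> borel_measurable ?M"
    by (rule measurable_compose[OF measurable_fst id], rule measurable_compose[OF measurable_snd id])
  have sets: "{z. snd z \<le> fst z} \<in> sets ?M" "{z. fst z < snd z} \<in> sets ?M"
  proof -
    have "{z \<in> space ?M. snd z \<le> fst z} \<in> sets ?M" "{z \<in> space ?M. fst z < snd z} \<in> sets ?M"
      by measurable
    then show "{z. snd z \<le> fst z} \<in> sets ?M" "{z. fst z < snd z} \<in> sets ?M"
      by (simp_all add: space_pair_measure)
  qed
  define H where "H = (\<lambda>z. indicat_real {z. snd z \<le> fst z} z *\<^sub>R P z)"
  define H' where "H' = (\<lambda>z. indicat_real {z. fst z < snd z} z *\<^sub>R P z)"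
  have H: "integrable ?M H" and H': "integrable ?M H'"
    unfolding H_def H'_def by (intro integrable_mult_indicator sets P)+
  have seg: "(LINT x|lebesgue. indicat_real {a..y} x *\<^sub>R h x) = integral {a..y} h"
    if "h absolutely_integrable_on {a..b}" "y \<in> {a..b}" for h :: "real \<Rightarrow> 'a" and y
  proof -
    have "h absolutely_integrable_on {a..y}" by (rule set_integrable_subset[OF that(1)]) (use that in auto)
    from set_lebesgue_integral_eq_integral(2)[OF this] show ?thesis by (simp add: set_lebesgue_integral_def)
  qed
  have inner: "(LINT y|lebesgue. H (x, y)) = indicat_real {a..b} x *\<^sub>R (f x * integral {a..x} g)" for x
  proof -
    have "(LINT y|lebesgue. H (x, y)) = (LINT y|lebesgue. \<alpha> x * (indicat_real {a..x} y *\<^sub>R g y))"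
      by (intro Bochner_Integration.integral_cong) (auto simp: H_def P_def \<alpha>_def \<beta>_def indicator_def)
    also have "\<dots> = \<alpha> x * (LINT y|lebesgue. indicat_real {a..x} y *\<^sub>R g y)"
      by (rule integral_mult_right_zero)
    also have "\<dots> = indicat_real {a..b} x *\<^sub>R (f x * integral {a..x} g)"
      using seg[OF g, of x] by (auto simp: \<alpha>_def indicator_def)
    finally show ?thesis .
  qed
  have inner': "(LINT x|lebesgue. H' (x, y)) = indicat_real {a..b} y *\<^sub>R (integral {a..y} f * g y)" for y
  proof -
    have "(LINT x|lebesgue. H' (x, y)) = (LINT x|lebesgue. (indicat_real {a..y} x *\<^sub>R f x) * \<beta> y)"
    proof (rule integral_cong_AE)
      show "AE x in lebesgue. H' (x, y) = (indicat_real {a..y} x *\<^sub>R f x) * \<beta> y"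
        using AE_lebesgue_neq[of y]
        by eventually_elim (auto simp: H'_def P_def \<alpha>_def \<beta>_def indicator_def)
      have \<alpha>\<beta>: "(\<lambda>x. \<alpha> x * \<beta> y) \<in> borel_measurable lebesgue"
        by (intro borel_measurable_times borel_measurable_integrable \<alpha> borel_measurable_const)
      have "(\<lambda>x. indicat_real {z. fst z < snd z} (x, y) *\<^sub>R (\<alpha> x * \<beta> y)) \<in> borel_measurable lebesgue"
      proof (rule borel_measurable_scaleR)
        have "(\<lambda>x. indicat_real {z. fst z < snd z} (x, y)) = indicat_real {..<y}"
          by (auto simp: indicator_def)
        then show "(\<lambda>x. indicat_real {z. fst z < snd z} (x, y)) \<in> borel_measurable lebesgue"
          by (simp add: borel_measurable_indicator)
      qed (rule \<alpha>\<beta>)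
      then show "(\<lambda>x. H' (x, y)) \<in> borel_measurable lebesgue" by (simp add: H'_def P_def)
      have "(\<lambda>x. indicat_real {a..y} x *\<^sub>R (\<alpha> x * \<beta> y)) \<in> borel_measurable lebesgue"
        by (intro borel_measurable_scaleR \<alpha>\<beta> borel_measurable_indicator) simp
      also have "(\<lambda>x. indicat_real {a..y} x *\<^sub>R (\<alpha> x * \<beta> y)) = (\<lambda>x. (indicat_real {a..y} x *\<^sub>R f x) * \<beta> y)"
        by (auto simp: \<alpha>_def \<beta>_def indicator_def)
      finally show "\<dots> \<in> borel_measurable lebesgue" .
    qed
    also have "\<dots> = (LINT x|lebesgue. indicat_real {a..y} x *\<^sub>R f x) * \<beta> y"
      by (rule integral_mult_left_zero)
    also have "\<dots> = indicat_real {a..b} y *\<^sub>R (integral {a..y} f * g y)"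
      using seg[OF f, of y] by (auto simp: \<beta>_def indicator_def)
    finally show ?thesis .
  qed
  show ?i1 using integrable_fst'[OF H] unfolding set_integrable_def inner .
  show ?i2 using integrable_snd[of "curry H'"] H' unfolding set_integrable_def by (simp add: inner')
  have "integral {a..b} f * integral {a..b} g = (LINT x|lebesgue. \<alpha> x) * (LINT y|lebesgue. \<beta> y)"
    using set_lebesgue_integral_eq_integral(2)[OF f] set_lebesgue_integral_eq_integral(2)[OF g]
    by (simp add: set_lebesgue_integral_def \<alpha>_def \<beta>_def)
  also have "\<dots> = (LINT x|lebesgue. LINT y|lebesgue. P (x, y))" by (simp add: P_def)
  also have "\<dots> = (LINT z|?M. P z)" by (rule integral_fst'[OF P])
  also have "\<dots> = (LINT z|?M. H z + H' z)"
    by (intro Bochner_Integration.integral_cong) (auto simp: H_def H'_def indicator_def)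
  also have "\<dots> = (LINT z|?M. H z) + (LINT z|?M. H' z)"
    by (rule Bochner_Integration.integral_add[OF H H'])
  also have "(LINT z|?M. H z) = (LINT x|lebesgue. LINT y|lebesgue. H (x, y))"
    by (rule integral_fst'[OF H, symmetric])
  also have "\<dots> = integral {a..b} (\<lambda>x. f x * integral {a..x} g)"
    unfolding inner using set_lebesgue_integral_eq_integral(2)[OF \<open>?i1\<close>]
    by (simp add: set_lebesgue_integral_def)
  also have "(LINT z|?M. H' z) = (LINT y|lebesgue. LINT x|lebesgue. H' (x, y))"
    using integral_snd[of "curry H'"] H' by simp
  also have "\<dots> = integral {a..b} (\<lambda>y. integral {a..y} f * g y)"
    unfolding inner' using set_lebesgue_integral_eq_integral(2)[OF \<open>?i2\<close>]
    by (simp add: set_lebesgue_integral_def)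
  finally show ?eq by simp
qed

lemma primitive_mult:
  fixes f g :: "real \<Rightarrow> 'a::{euclidean_space, real_normed_field}"
  assumes F: "primitive F f" and G: "primitive G g"
  shows "primitive (\<lambda>x. F x * G x) (\<lambda>x. f x * G x + F x * g x)"
  unfolding primitive_def
proof (intro allI impI)
  fix a b :: real assume "a \<le> b"
  note f = primitiveD[OF F \<open>a \<le> b\<close>] and g = primitiveD[OF G \<open>a \<le> b\<close>]
  note parts = lebesgue_integral_by_parts[OF f(1) g(1)]
  let ?h = "\<lambda>x. (f x * integral {a..x} g + f x * G a) + (integral {a..x} f * g x + F a * g x)"
  have fG: "(\<lambda>x. f x * G a) absolutely_integrable_on {a..b}"
    using f(1) by (simp add: set_integrable_mult_left)
  have Fg: "(\<lambda>x. F a * g x) absolutely_integrable_on {a..b}"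
    using g(1) by (simp add: set_integrable_mult_right)
  have h: "?h absolutely_integrable_on {a..b}"
    by (intro set_integral_add parts fG Fg)
  have "integral {a..b} ?h = (integral {a..b} f * integral {a..b} g) +
      integral {a..b} f * G a + F a * integral {a..b} g"
    unfolding parts(3)[symmetric]
    using parts(1,2) fG Fg f(1) g(1)
    by (simp add: integral_add integrable_add set_lebesgue_integral_eq_integral(1) set_integral_add)
  then have 2: "integral {a..b} ?h = F b * G b - F a * G a"
    unfolding f(2) g(2) by (simp add: algebra_simps)
  have eq: "?h x = f x * G x + F x * g x" if "x \<in> {a..b}" for x
  proof -
    have "F x = F a + integral {a..x} f" "G x = G a + integral {a..x} g"
      using that primitiveD(2)[OF F, of a x] primitiveD(2)[OF G, of a x] by auto
    then show ?thesis by (simp only:) (simp add: algebra_simps)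
  qed
  show "(\<lambda>x. f x * G x + F x * g x) absolutely_integrable_on {a..b} \<and>
      integral {a..b} (\<lambda>x. f x * G x + F x * g x) = F b * G b - F a * G a"
    using h 2 eq set_integrable_cong[OF refl refl, of "{a..b}" ?h "\<lambda>x. f x * G x + F x * g x"]
      Henstock_Kurzweil_Integration.integral_cong[of "{a..b}" ?h "\<lambda>x. f x * G x + F x * g x"]
    by simp
qed

lemma primitive_linear:
  assumes "primitive F f" "bounded_linear h"
  shows "primitive (\<lambda>x. h (F x)) (\<lambda>x. h (f x))"
  unfolding primitive_def
proof (intro allI impI)
  fix a b :: real assume "a \<le> b"
  note f = primitiveD[OF assms(1) this]
  from absolutely_integrable_linear[OF f(1) assms(2)]
  have "(\<lambda>x. h (f x)) absolutely_integrable_on {a..b}" by (simp add: o_def)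
  moreover have "integral {a..b} (\<lambda>x. h (f x)) = h (F b - F a)"
    using integral_linear[OF set_lebesgue_integral_eq_integral(1)[OF f(1)] assms(2)] f(2) by (simp add: o_def)
  ultimately show "(\<lambda>x. h (f x)) absolutely_integrable_on {a..b} \<and>
      integral {a..b} (\<lambda>x. h (f x)) = h (F b) - h (F a)"
    using assms(2) by (simp add: linear_simps)
qed

lemma primitive_add:
  assumes "primitive F f" "primitive G g"
  shows "primitive (\<lambda>x. F x + G x) (\<lambda>x. f x + g x)"
  using assms unfolding primitive_def
  by (auto simp: set_integral_add integral_add set_lebesgue_integral_eq_integral(1))

lemma primitive_const: "primitive (\<lambda>x. c) (\<lambda>x. 0)"
  by (simp add: primitive_def)

lemma AE_lebesgue_negligible:
  assumes "AE x in lebesgue. P x"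
  obtains N where "negligible N" "\<And>x. x \<notin> N \<Longrightarrow> P x"
  using assms by (auto elim!: AE_E3 simp: negligible_iff_null_sets)

lemma integral_AE_cong:
  fixes f g :: "real \<Rightarrow> 'a::euclidean_space"
  assumes "AE x in lebesgue. f x = g x"
  shows "integral S f = integral S g"
proof -
  obtain N where N: "negligible N" "\<And>x. x \<notin> N \<Longrightarrow> f x = g x"
    using AE_lebesgue_negligible[OF assms] by blast
  show ?thesis by (rule integral_spike[OF N(1)]) (simp add: N(2))
qed

lemma absolutely_integrable_AE_cong:
  fixes f g :: "real \<Rightarrow> 'a::euclidean_space"
  assumes "f absolutely_integrable_on S" "AE x in lebesgue. f x = g x"
  shows "g absolutely_integrable_on S"
proof -
  obtain N where N: "negligible N" "\<And>x. x \<notin> N \<Longrightarrow> f x = g x"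
    using AE_lebesgue_negligible[OF assms(2)] by blast
  show ?thesis by (rule absolutely_integrable_spike[OF assms(1) N(1)]) (simp add: N(2))
qed

lemma primitive_AE_cong:
  assumes "primitive F f" "AE x in lebesgue. f x = g x"
  shows "primitive F g"
  using assms absolutely_integrable_AE_cong[OF _ assms(2)] integral_AE_cong[OF assms(2)]
  by (simp add: primitive_def)

lemma primitive_continuous:
  assumes "primitive F f"
  shows "continuous_on S F"
proof -
  have "continuous_on {-r..r} F" for r
  proof (cases "0 \<le> r")
    case True
    have "continuous_on {-r..r} (\<lambda>x. F (-r) + integral {-r..x} f)"
      using primitiveD(1)[OF assms, of "-r" r] True
      by (intro continuous_intros indefinite_integral_continuous_1)
        (auto simp: set_lebesgue_integral_eq_integral(1))
    then show ?thesis
      by (rule continuous_on_eq) (use primitiveD(2)[OF assms] in auto)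
  qed simp
  then have "isCont F x" for x
    by (rule continuous_on_interior[of "{-(\<bar>x\<bar>+1)..\<bar>x\<bar>+1}"]) (auto simp: abs_le_iff)
  then show ?thesis by (simp add: continuous_at_imp_continuous_on)
qed

lemma primitive_of_deriv:
  assumes "\<And>x. (F has_vector_derivative f x) (at x)" "continuous_on UNIV f"
  shows "primitive F f"
  unfolding primitive_def
proof (intro allI impI conjI)
  fix a b :: real assume "a \<le> b"
  show "f absolutely_integrable_on {a..b}"
    by (intro absolutely_integrable_continuous_real continuous_on_subset[OF assms(2)]) auto
  show "integral {a..b} f = F b - F a"
    by (intro integral_unique fundamental_theorem_of_calculus \<open>a \<le> b\<close>)
      (rule has_vector_derivative_at_within[OF assms(1)])
qed

lemma primitive_exists:
  assumes "\<And>a b. f absolutely_integrable_on {a..b}"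
  obtains F where "primitive F f" "F (0::real) = c"
proof -
  have i: "f integrable_on {a..b}" for a b by (rule set_lebesgue_integral_eq_integral(1)[OF assms])
  define F where "F x = c + (integral {0..x} f - integral {x..0} f)" for x
  have Fpos: "F x = c + integral {0..x} f" if "0 \<le> x" for x
    using that by (cases "x = 0") (simp_all add: F_def)
  have Fneg: "F x = c - integral {x..0} f" if "x \<le> 0" for x
    using that by (cases "x = 0") (simp_all add: F_def)
  have "integral {a..b} f = F b - F a" if "a \<le> b" for a b
  proof -
    note combine = Henstock_Kurzweil_Integration.integral_combine[OF _ _ i]
    consider "0 \<le> a" | "a < 0" "0 \<le> b" | "b < 0" by linarith
    then show ?thesis
    proof cases
      case 1
      then show ?thesis using that combine[of 0 a b] Fpos[of a] Fpos[of b]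
        by (simp add: eq_diff_eq add.commute)
    next
      case 2
      then show ?thesis using that combine[of a 0 b] Fneg[of a] Fpos[of b]
        by (simp add: add.commute)
    next
      case 3
      then show ?thesis using that Fneg[of a] Fneg[of b]
        by (simp add: combine[of a b 0, symmetric])
    qed
  qed
  then show ?thesis using assms by (intro that[of F]) (auto simp: primitive_def F_def)
qed

lemma primitive_deriv:
  assumes "primitive F f" "continuous_on UNIV f"
  shows "(F has_vector_derivative f x) (at x)"
proof -
  have "((\<lambda>u. integral {x-1..u} f) has_vector_derivative f x) (at x within {x-1..x+1})"
    by (intro integral_has_vector_derivative continuous_on_subset[OF assms(2)]) auto
  then have "((\<lambda>u. F (x-1) + integral {x-1..u} f) has_vector_derivative 0 + f x) (at x within {x-1..x+1})"
    by (intro has_vector_derivative_add has_vector_derivative_const)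
  then have D: "((\<lambda>u. F (x-1) + integral {x-1..u} f) has_vector_derivative f x) (at x within {x-1..x+1})"
    by simp
  have "(F has_vector_derivative f x) (at x within {x-1..x+1})"
  proof (rule has_vector_derivative_transform[OF _ _ D])
    show "F y = F (x-1) + integral {x-1..y} f" if "y \<in> {x-1..x+1}" for y
      using that primitiveD(2)[OF assms(1), of "x-1" y] by simp
  qed simp
  then show ?thesis
    by (simp add: at_within_Icc_at)
qed

lemma primitive_norm_le:
  fixes f :: "real \<Rightarrow> 'a::euclidean_space"
  assumes "primitive F f" "a \<le> x" "x \<le> y" "y \<le> b"
  shows "norm (F y - F x) \<le> integral {a..b} (\<lambda>s. norm (f s))"
proof -
  have n: "(\<lambda>s. norm (f s)) integrable_on {c..d}" "f integrable_on {c..d}" for c d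
    using primitiveD'[OF assms(1), of c d] by (auto simp: absolutely_integrable_on_def)
  have "norm (F y - F x) = norm (integral {x..y} f)" using primitiveD(2)[OF assms(1), of x y] assms by simp
  also have "\<dots> \<le> integral {x..y} (\<lambda>s. norm (f s))" by (intro integral_norm_bound_integral n) auto
  also have "\<dots> \<le> integral {a..b} (\<lambda>s. norm (f s))"
    by (intro integral_subset_le n) (use assms in auto)
  finally show ?thesis .
qed

section \<open>Du Bois-Reymond's lemma\<close>

lemma test_function_deriv:
  assumes "test_function UNIV \<phi>"
  shows "test_function UNIV (deriv \<phi>)"
proof -
  obtain a b where ab: "\<And>k x. x \<notin> {a..b} \<Longrightarrow> (deriv ^^ k) \<phi> x = 0"
    and D: "\<And>k x. ((deriv ^^ k) \<phi> has_field_derivative (deriv ^^ Suc k) \<phi> x) (at x)"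
    using test_function_derivs[OF assms] by metis
  have "(deriv ^^ n) (deriv \<phi>) field_differentiable (at x)" for n x
    using D[of "Suc n" x] by (auto simp: funpow_swap1 field_differentiable_def)
  moreover have "deriv \<phi> x = 0" if "x \<notin> {a..b}" for x using ab[OF that, of 1] by simp
  ultimately show ?thesis unfolding test_function_def by (auto intro!: exI[of _ "{a..b}"])
qed

lemma test_function_lincomb:
  assumes "test_function UNIV \<phi>" "test_function UNIV \<psi>"
  shows "test_function UNIV (\<lambda>x. \<phi> x + c * \<psi> x)"
proof -
  obtain a b where ab: "\<And>k x. x \<notin> {a..b} \<Longrightarrow> (deriv ^^ k) \<phi> x = 0"
    and D: "\<And>k x. ((deriv ^^ k) \<phi> has_field_derivative (deriv ^^ Suc k) \<phi> x) (at x)"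
    using test_function_derivs[OF assms(1)] by metis
  obtain a' b' where ab': "\<And>k x. x \<notin> {a'..b'} \<Longrightarrow> (deriv ^^ k) \<psi> x = 0"
    and D': "\<And>k x. ((deriv ^^ k) \<psi> has_field_derivative (deriv ^^ Suc k) \<psi> x) (at x)"
    using test_function_derivs[OF assms(2)] by metis
  have "(deriv ^^ n) (\<lambda>x. \<phi> x + c * \<psi> x) field_differentiable (at x)" for n x
  proof (rule deriv_closed_imp_smooth)
    let ?A = "range (\<lambda>k x. (deriv ^^ k) \<phi> x + c * (deriv ^^ k) \<psi> x)"
    show "(\<lambda>x. \<phi> x + c * \<psi> x) \<in> ?A" by (rule image_eqI[of _ _ 0]) auto
    fix f assume "f \<in> ?A"
    then obtain k where "f = (\<lambda>x. (deriv ^^ k) \<phi> x + c * (deriv ^^ k) \<psi> x)" by blast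
    then show "\<exists>f'\<in>?A. \<forall>x. (f has_field_derivative f' x) (at x)"
      using DERIV_add[OF D[of k] DERIV_cmult[OF D'[of k]]]
      by (intro bexI[of _ "\<lambda>x. (deriv ^^ Suc k) \<phi> x + c * (deriv ^^ Suc k) \<psi> x"]
          allI rangeI) blast
  qed
  moreover have "\<phi> x + c * \<psi> x = 0" if "x \<notin> {a..b} \<union> {a'..b'}" for x
    using ab[of x 0] ab'[of x 0] that by simp
  ultimately show ?thesis
    unfolding test_function_def by (metis compact_Icc compact_Un subset_UNIV)
qed

lemma lebesgue_integral_eq_integral_Icc:
  fixes g :: "real \<Rightarrow> 'a::euclidean_space"
  assumes "g absolutely_integrable_on {a..b}" "\<And>x. x \<notin> {a..b} \<Longrightarrow> g x = 0"
  shows "(LINT x|lebesgue. g x) = integral {a..b} g"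
proof -
  have "(\<lambda>x. indicat_real {a..b} x *\<^sub>R g x) = g" using assms(2) by (auto simp: indicator_def)
  then show ?thesis using set_lebesgue_integral_eq_integral(2)[OF assms(1)]
    by (simp add: set_lebesgue_integral_def)
qed

lemma test_function_continuous:
  assumes "test_function UNIV \<phi>"
  shows "continuous_on S \<phi>"
proof -
  obtain a b where "\<And>k. continuous_on UNIV ((deriv ^^ k) \<phi>)"
    using test_function_derivs[OF assms] by metis
  from this[of 0] show ?thesis using continuous_on_subset by fastforce
qed

lemma test_function_primitive:
  assumes "test_function UNIV \<phi>"
  shows "primitive \<phi> (deriv \<phi>)"
proof (rule primitive_of_deriv)
  obtain a b where D: "\<And>k x. ((deriv ^^ k) \<phi> has_field_derivative (deriv ^^ Suc k) \<phi> x) (at x)"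
    using test_function_derivs[OF assms] by metis
  show "(\<phi> has_vector_derivative deriv \<phi> x) (at x)" for x
    using D[of 0 x] by (simp add: has_real_derivative_iff_has_vector_derivative)
qed (intro test_function_continuous test_function_deriv assms)

lemma test_function_support:
  assumes "test_function UNIV \<phi>"
  obtains a b where "a \<le> b" "\<And>x. x \<le> a \<or> b \<le> x \<Longrightarrow> \<phi> x = 0"
    "\<And>x. x \<le> a \<or> b \<le> x \<Longrightarrow> deriv \<phi> x = 0"
proof -
  obtain a b where ab: "\<And>k x. x \<notin> {a..b} \<Longrightarrow> (deriv ^^ k) \<phi> x = 0" "a \<le> b"
    using test_function_derivs[OF assms] by metis
  show thesis
    by (rule that[of "a-1" "b+1"]) (use ab(2) ab(1)[of _ 0] ab(1)[of _ 1] in auto)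
qed

lemma test_function_antiderivative:
  assumes t: "test_function UNIV \<theta>" and 0: "(LINT x|lebesgue. \<theta> x) = 0"
  obtains \<phi> where "test_function UNIV \<phi>" "deriv \<phi> = \<theta>"
proof -
  obtain a b where ab: "a \<le> b" "\<And>x. x \<le> a \<or> b \<le> x \<Longrightarrow> \<theta> x = 0"
    using test_function_support[OF t] by metis
  have i: "\<theta> absolutely_integrable_on {c..d}" for c d
    by (intro absolutely_integrable_continuous_real test_function_continuous t)
  obtain F where F: "primitive F \<theta>" by (rule primitive_exists[OF i])
  define \<phi> where "\<phi> x = F x - F a" for x
  have D: "(\<phi> has_field_derivative \<theta> x) (at x)" for x
    using primitive_deriv[OF F test_function_continuous[OF t], of x]
    unfolding \<phi>_def has_real_derivative_iff_has_vector_derivative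
    by (auto intro!: derivative_eq_intros)
  then have \<phi>': "deriv \<phi> = \<theta>" by (auto intro: DERIV_imp_deriv)
  have z: "integral {c..d} \<theta> = 0" if "d \<le> a \<or> b \<le> c" for c d
    using Henstock_Kurzweil_Integration.integral_cong[of "{c..d}" \<theta> "\<lambda>_. 0"] that ab(2) by force
  have "\<phi> x = 0" if "x \<notin> {a..b}" for x
  proof (cases "x < a")
    case True
    then show ?thesis using primitiveD(2)[OF F, of x a] z[of a x] by (simp add: \<phi>_def)
  next
    case False
    then have "x > b" using that by auto
    have "integral {a..b} \<theta> = 0"
      using lebesgue_integral_eq_integral_Icc[OF i, of a b] ab(2) 0 by force
    then show ?thesis
      using primitiveD(2)[OF F, of b x] primitiveD(2)[OF F, of a b] z[of x b] \<open>x > b\<close> ab(1) by (simp add: \<phi>_def)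
  qed
  moreover have "(deriv ^^ n) \<phi> field_differentiable (at x)" for n x
  proof (cases n)
    case 0
    then show ?thesis using D by (auto simp: field_differentiable_def)
  next
    case (Suc m)
    then have "(deriv ^^ n) \<phi> = (deriv ^^ m) \<theta>" by (simp add: funpow_swap1 \<phi>')
    then show ?thesis using t by (simp add: test_function_def)
  qed
  ultimately have "test_function UNIV \<phi>"
    unfolding test_function_def by (auto intro!: exI[of _ "{a..b}"])
  with \<phi>' show thesis by (intro that)
qed

text \<open>
  If all test functions had mean zero, the constant \<open>1\<close> would vanish almost everywhere.
\<close>

lemma test_function_integral_nonzero:
  obtains \<eta> where "test_function UNIV \<eta>" "(LINT x|lebesgue. \<eta> x) \<noteq> 0"
proof -
  have "\<exists>\<eta>. test_function UNIV \<eta> \<and> (LINT x|lebesgue. \<eta> x) \<noteq> 0"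
  proof (rule ccontr)
    assume "\<not> ?thesis"
    then have "(LINT x|lebesgue. \<phi> x *\<^sub>R (1::complex)) = 0" if "test_function UNIV \<phi>" for \<phi>
      using that integrable_test_scaleR_0[OF that locally_integrable_const, of 1]
      by (auto simp: scaleR_conv_of_real)
    from test_integral_0_imp_AE_0[OF locally_integrable_const this]
    have "AE x in (lebesgue :: real measure). False" by simp
    then obtain N where "negligible N" "\<And>x::real. x \<notin> N \<Longrightarrow> False"
      using AE_lebesgue_negligible by blast
    then have "negligible (UNIV :: real set)" by (elim negligible_subset) blast
    then show False by simp
  qed
  then show thesis using that by blast
qed

text \<open>
  The functional \<open>\<psi> \<mapsto> \<integral> \<psi> h\<close> vanishes on derivatives of test functions, that is on test functions
  of mean zero. Correcting an arbitrary \<open>\<psi>\<close> by a multiple of a fixed \<open>\<eta>\<close> to mean zero shows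
  that it is a multiple of the mean.
\<close>

lemma du_bois_reymond:
  assumes h: "locally_integrable UNIV h"
    and 0: "\<And>\<phi>. test_function UNIV \<phi> \<Longrightarrow> (LINT x|lebesgue. deriv \<phi> x *\<^sub>R h x) = 0"
  obtains c where "AE x in lebesgue. h x = c"
proof -
  obtain \<eta> where \<eta>: "test_function UNIV \<eta>" "(LINT x|lebesgue. \<eta> x) \<noteq> 0"
    by (rule test_function_integral_nonzero)
  define c where "c = (LINT x|lebesgue. \<eta> x *\<^sub>R h x) /\<^sub>R (LINT x|lebesgue. \<eta> x)"
  have int: "integrable lebesgue \<psi>" if "test_function UNIV \<psi>" for \<psi>
  proof -
    have "integrable lebesgue (\<lambda>x. Re (\<psi> x *\<^sub>R 1))"
      by (intro integrable_Re integrable_test_scaleR_0[OF that] locally_integrable_const)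
    then show ?thesis by simp
  qed
  have ih: "integrable lebesgue (\<lambda>x. \<psi> x *\<^sub>R h x)" if "test_function UNIV \<psi>" for \<psi>
    by (rule integrable_test_scaleR_0[OF that h])
  have "AE x in lebesgue. h x + (-1::real) *\<^sub>R c = 0"
  proof (rule test_integral_0_imp_AE_0)
    show "locally_integrable UNIV (\<lambda>x. h x + (-1::real) *\<^sub>R c)"
      by (intro locally_integrable_add h locally_integrable_const)
    fix \<psi> assume \<psi>: "test_function UNIV \<psi>"
    define k where "k = (LINT x|lebesgue. \<psi> x) / (LINT x|lebesgue. \<eta> x)"
    have t: "test_function UNIV (\<lambda>x. \<psi> x + (-k) * \<eta> x)" by (rule test_function_lincomb[OF \<psi> \<eta>(1)])
    have "(LINT x|lebesgue. \<psi> x + (-k) * \<eta> x) = 0"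
      using \<eta>(2) by (simp add: int[OF \<psi>] int[OF \<eta>(1)] k_def)
    then obtain \<phi> where \<phi>: "test_function UNIV \<phi>" "deriv \<phi> = (\<lambda>x. \<psi> x + (-k) * \<eta> x)"
      by (rule test_function_antiderivative[OF t])
    have "(LINT x|lebesgue. \<psi> x *\<^sub>R h x + (-k) *\<^sub>R (\<eta> x *\<^sub>R h x)) = 0"
      using 0[OF \<phi>(1)] by (simp add: \<phi>(2) scaleR_add_left scaleR_diff_left)
    moreover have "(LINT x|lebesgue. \<psi> x *\<^sub>R h x + (-k) *\<^sub>R (\<eta> x *\<^sub>R h x)) =
        (LINT x|lebesgue. \<psi> x *\<^sub>R h x) + (LINT x|lebesgue. (-k) *\<^sub>R (\<eta> x *\<^sub>R h x))"
      by (intro Bochner_Integration.integral_add integrable_scaleR_right ih \<psi> \<eta>(1))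
    ultimately have "(LINT x|lebesgue. \<psi> x *\<^sub>R h x) = k *\<^sub>R (LINT x|lebesgue. \<eta> x *\<^sub>R h x)"
      by (simp del: scaleR_scaleR)
    also have "\<dots> = (LINT x|lebesgue. \<psi> x) *\<^sub>R c"
      using \<eta>(2) by (simp add: k_def c_def field_simps)
    also have "\<dots> = (LINT x|lebesgue. \<psi> x *\<^sub>R c)"
      using int[OF \<psi>] by simp
    finally show "(LINT x|lebesgue. \<psi> x *\<^sub>R (h x + (-1::real) *\<^sub>R c)) = 0"
      using ih[OF \<psi>] int[OF \<psi>] by (simp add: scaleR_diff_right)
  qed
  then show thesis by (intro that[of c]) simp
qed

lemma locally_integrableI:
  assumes "\<And>a b. f absolutely_integrable_on {a..b}"
  shows "locally_integrable UNIV f"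
  unfolding locally_integrable_def
proof (intro allI impI)
  fix K :: "real set" assume K: "compact K"
  then obtain r where "\<And>x. x \<in> K \<Longrightarrow> \<bar>x\<bar> \<le> r" using compact_imp_bounded[of K] by (auto simp: bounded_iff)
  then have "K \<subseteq> {-r..r}" by (force simp: abs_le_iff)
  then show "set_integrable lebesgue K f"
    by (intro set_integrable_subset[OF assms[of "-r" r]] fmeasurableD lmeasurable_compact K)
qed

lemma has_weak_deriv_primitive:
  fixes F f :: "real \<Rightarrow> complex"
  assumes F: "primitive F f" and t: "test_function UNIV \<phi>"
  shows "(LINT x|lebesgue. deriv \<phi> x *\<^sub>R F x) = - (LINT x|lebesgue. \<phi> x *\<^sub>R f x)"
proof -
  obtain a b where ab: "a \<le> b" "\<And>x. x \<le> a \<or> b \<le> x \<Longrightarrow> \<phi> x = 0"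
    "\<And>x. x \<le> a \<or> b \<le> x \<Longrightarrow> deriv \<phi> x = 0"
    using test_function_support[OF t] by metis
  have "primitive (\<lambda>x. of_real (\<phi> x) * F x) (\<lambda>x. of_real (deriv \<phi> x) * F x + of_real (\<phi> x) * f x)"
    by (intro primitive_mult F primitive_linear[OF test_function_primitive[OF t]] bounded_linear_of_real)
  from primitiveD[OF this ab(1)]
  have 1: "(\<lambda>x. of_real (deriv \<phi> x) * F x + of_real (\<phi> x) * f x) absolutely_integrable_on {a..b}"
    and 2: "integral {a..b} (\<lambda>x. of_real (deriv \<phi> x) * F x + of_real (\<phi> x) * f x) = 0"
    using ab(1,2) by auto
  have "(LINT x|lebesgue. deriv \<phi> x *\<^sub>R F x + \<phi> x *\<^sub>R f x) = 0"
    using lebesgue_integral_eq_integral_Icc[OF 1] 2 ab(2,3) by (force simp: scaleR_conv_of_real)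
  moreover have "integrable lebesgue (\<lambda>x. deriv \<phi> x *\<^sub>R F x)"
    by (intro integrable_test_scaleR_0 test_function_deriv t locally_integrableI
        absolutely_integrable_continuous_real primitive_continuous[OF F])
  moreover have "integrable lebesgue (\<lambda>x. \<phi> x *\<^sub>R f x)"
    by (intro integrable_test_scaleR_0 t locally_integrableI primitiveD'[OF F])
  ultimately show ?thesis by (simp add: add_eq_0_iff)
qed

text \<open>
  A primitive of the weak derivative differs from the function by something with weak
  derivative zero.
\<close>

lemma weak_deriv_primitive:
  assumes f: "locally_integrable UNIV f" and g: "locally_integrable UNIV g"
    and w: "\<And>\<phi>. test_function UNIV \<phi> \<Longrightarrow> (LINT x|lebesgue. deriv \<phi> x *\<^sub>R f x) = - (LINT x|lebesgue. \<phi> x *\<^sub>R g x)"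
  obtains F where "primitive F g" "AE x in lebesgue. f x = F x"
proof -
  obtain G where G: "primitive G g" by (rule primitive_exists[OF locally_integrable_cinterval[OF g]])
  have lG: "locally_integrable UNIV G"
    by (intro locally_integrableI absolutely_integrable_continuous_real primitive_continuous[OF G])
  obtain c where c: "AE x in lebesgue. f x + (-1::real) *\<^sub>R G x = c"
  proof (rule du_bois_reymond)
    show "locally_integrable UNIV (\<lambda>x. f x + (-1::real) *\<^sub>R G x)"
      by (intro locally_integrable_add f locally_integrable_scaleR lG)
    fix \<phi> assume t: "test_function UNIV \<phi>"
    note i = integrable_test_scaleR_0[OF test_function_deriv[OF t]]
    show "(LINT x|lebesgue. deriv \<phi> x *\<^sub>R (f x + (-1::real) *\<^sub>R G x)) = 0"
      using w[OF t] has_weak_deriv_primitive[OF G t] i[OF f] i[OF lG]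
      by (simp add: scaleR_diff_right)
  qed
  show thesis
  proof (rule that)
    show "primitive (\<lambda>x. c + G x) g"
      using primitive_add[OF primitive_const G, of c] by simp
    show "AE x in lebesgue. f x = c + G x" using c by eventually_elim (simp add: algebra_simps)
  qed
qed

lemma continuous_AE_eq:
  fixes F G :: "real \<Rightarrow> 'a::real_normed_vector"
  assumes "continuous_on UNIV F" "continuous_on UNIV G" "AE x in lebesgue. F x = G x"
  shows "F = G"
proof -
  have "open {x. F x \<noteq> G x}" by (intro open_Collect_neq assms)
  moreover obtain N where "negligible N" "\<And>x. x \<notin> N \<Longrightarrow> F x = G x"
    using AE_lebesgue_negligible[OF assms(3)] by blast
  then have "negligible {x. F x \<noteq> G x}" by (elim negligible_subset) auto
  ultimately have "{x. F x \<noteq> G x} = {}" using open_not_negligible by blast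
  then show ?thesis by auto
qed

section \<open>Periodic Sobolev functions as primitives\<close>

lemma h2per_loc_int: "k \<le> 2 \<Longrightarrow> locally_integrable UNIV (h2per_deriv k u)"
  and rep_h2per_loc_int: "locally_integrable UNIV (rep_h2per u)"
  using h2per_deriv(1)[of k u] h2per_deriv(1)[of 0 u] by (simp_all add: has_weak_deriv_def)

lemma rep_h2per_periodic: "rep_h2per u (x + 2 * pi) = rep_h2per u x"
  using rep_h2per_in[of u] by (simp add: H2per_funs_def)

text \<open>
  The first weak derivative has the second one as its weak derivative, because derivatives of test functions
  are test functions. So both levels have absolutely continuous representatives; these are
  periodic because continuous functions that agree almost everywhere agree everywhere.
\<close>

lemma h2per_primitives_exist:
  "\<exists>F0 F1. primitive F0 F1 \<and> primitive F1 (h2per_deriv 2 u) \<and>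
     (AE x in lebesgue. rep_h2per u x = F0 x) \<and> (AE x in lebesgue. h2per_deriv 1 u x = F1 x) \<and>
     (\<forall>x. F0 (x + 2 * pi) = F0 x) \<and> (\<forall>x. F1 (x + 2 * pi) = F1 x)"
proof -
  have w1: "(LINT x|lebesgue. deriv \<phi> x *\<^sub>R rep_h2per u x) = - (LINT x|lebesgue. \<phi> x *\<^sub>R h2per_deriv 1 u x)"
    if "test_function UNIV \<phi>" for \<phi>
    using h2per_deriv(1)[of 1 u] that by (simp add: has_weak_deriv_UNIV_iff)
  have w2: "(LINT x|lebesgue. deriv (deriv \<phi>) x *\<^sub>R rep_h2per u x) = (LINT x|lebesgue. \<phi> x *\<^sub>R h2per_deriv 2 u x)"
    if "test_function UNIV \<phi>" for \<phi>
    using h2per_deriv(1)[of 2 u] that by (simp add: has_weak_deriv_UNIV_iff eval_nat_numeral)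
  obtain F0 where F0: "primitive F0 (h2per_deriv 1 u)" "AE x in lebesgue. rep_h2per u x = F0 x"
    using weak_deriv_primitive[OF rep_h2per_loc_int h2per_loc_int[of 1] w1] by auto
  have w3: "(LINT x|lebesgue. deriv \<phi> x *\<^sub>R h2per_deriv 1 u x) = - (LINT x|lebesgue. \<phi> x *\<^sub>R h2per_deriv 2 u x)"
    if "test_function UNIV \<phi>" for \<phi>
    using w1[OF test_function_deriv[OF that]] w2[OF that] by simp
  obtain F1 where F1: "primitive F1 (h2per_deriv 2 u)" "AE x in lebesgue. h2per_deriv 1 u x = F1 x"
    using weak_deriv_primitive[OF h2per_loc_int[of 1 u] h2per_loc_int[of 2 u] w3]
    by (metis one_le_numeral order_refl)
  have F01: "primitive F0 F1" by (rule primitive_AE_cong[OF F0(1) F1(2)])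
  have c0: "continuous_on S F0" and c1: "continuous_on S F1" for S
    by (rule primitive_continuous, fact)+
  obtain N where N: "negligible N" "\<And>x. x \<notin> N \<Longrightarrow> rep_h2per u x = F0 x"
    using AE_lebesgue_negligible[OF F0(2)] by blast
  have "negligible (N \<union> (+) (- (2 * pi)) ` N)" by (intro negligible_Un negligible_translation N)
  moreover have "F0 (x + 2 * pi) = F0 x" if "x \<notin> N \<union> (+) (- (2 * pi)) ` N" for x
  proof -
    have "x + 2 * pi \<notin> N"
    proof
      assume "x + 2 * pi \<in> N"
      then have "x \<in> (+) (- (2 * pi)) ` N" by (intro image_eqI[of _ _ "x + 2 * pi"]) auto
      with that show False by blast
    qed
    then show ?thesis using N(2)[of x] N(2)[of "x + 2 * pi"] that rep_h2per_periodic[of u x] by simp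
  qed
  ultimately have "AE x in lebesgue. F0 (x + 2 * pi) = F0 x"
    by (intro AE_I'[of "N \<union> (+) (- (2 * pi)) ` N"]) (auto simp: negligible_iff_null_sets[symmetric])
  then have "(\<lambda>x. F0 (x + 2 * pi)) = F0"
    by (intro continuous_AE_eq c0 continuous_on_compose2[OF c0[of UNIV]] continuous_intros) auto
  then have p0: "F0 (x + 2 * pi) = F0 x" for x by metis
  have "F1 (x + 2 * pi) = F1 x" for x
  proof -
    have "((F0 \<circ> (\<lambda>x. x + 2 * pi)) has_vector_derivative (1 *\<^sub>R F1 (x + 2 * pi))) (at x)"
      by (intro vector_diff_chain_at primitive_deriv[OF F01 c1]) (auto intro!: derivative_eq_intros)
    moreover have "F0 \<circ> (\<lambda>x. x + 2 * pi) = F0" by (auto simp: p0)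
    ultimately show ?thesis
      using primitive_deriv[OF F01 c1, of x] vector_derivative_unique_at by fastforce
  qed
  with F01 F0 F1 p0 show ?thesis by blast
qed

text \<open>
  Continuous functions that agree almost everywhere are equal, so this choice and the next one are
  unique: they are the continuous representatives of an element and of its derivative.
\<close>

definition h2per_fun :: "h2per \<Rightarrow> real \<Rightarrow> complex" where
  "h2per_fun u = (SOME F. continuous_on UNIV F \<and> (AE x in lebesgue. rep_h2per u x = F x))"

definition h2per_fun' :: "h2per \<Rightarrow> real \<Rightarrow> complex" where
  "h2per_fun' u = (SOME F. continuous_on UNIV F \<and> (AE x in lebesgue. h2per_deriv 1 u x = F x))"

lemma h2per_fun:
  shows h2per_primitive: "primitive (h2per_fun u) (h2per_fun' u)"
    and h2per_primitive': "primitive (h2per_fun' u) (h2per_deriv 2 u)"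
    and rep_h2per_fun: "AE x in lebesgue. rep_h2per u x = h2per_fun u x"
    and h2per_deriv_fun': "AE x in lebesgue. h2per_deriv 1 u x = h2per_fun' u x"
    and h2per_fun_periodic: "h2per_fun u (x + 2 * pi) = h2per_fun u x"
    and h2per_fun'_periodic: "h2per_fun' u (x + 2 * pi) = h2per_fun' u x"
proof -
  obtain F0 F1 where F: "primitive F0 F1" "primitive F1 (h2per_deriv 2 u)"
    "AE x in lebesgue. rep_h2per u x = F0 x" "AE x in lebesgue. h2per_deriv 1 u x = F1 x"
    "\<And>x. F0 (x + 2 * pi) = F0 x" "\<And>x. F1 (x + 2 * pi) = F1 x"
    using h2per_primitives_exist[of u] by blast
  have "\<exists>F. continuous_on UNIV F \<and> (AE x in lebesgue. rep_h2per u x = F x)"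
    using F primitive_continuous by blast
  from someI_ex[OF this] have s0: "continuous_on UNIV (h2per_fun u)" "AE x in lebesgue. rep_h2per u x = h2per_fun u x"
    by (simp_all add: h2per_fun_def)
  have "\<exists>F. continuous_on UNIV F \<and> (AE x in lebesgue. h2per_deriv 1 u x = F x)"
    using F primitive_continuous by blast
  from someI_ex[OF this] have s1: "continuous_on UNIV (h2per_fun' u)" "AE x in lebesgue. h2per_deriv 1 u x = h2per_fun' u x"
    by (simp_all add: h2per_fun'_def)
  have "AE x in lebesgue. h2per_fun u x = F0 x" using s0(2) F(3) by eventually_elim simp
  then have 0: "h2per_fun u = F0" by (rule continuous_AE_eq[OF s0(1) primitive_continuous[OF F(1)]])
  have "AE x in lebesgue. h2per_fun' u x = F1 x" using s1(2) F(4) by eventually_elim simp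
  then have 1: "h2per_fun' u = F1" by (rule continuous_AE_eq[OF s1(1) primitive_continuous[OF F(2)]])
  show "primitive (h2per_fun u) (h2per_fun' u)" "primitive (h2per_fun' u) (h2per_deriv 2 u)"
    "AE x in lebesgue. rep_h2per u x = h2per_fun u x" "AE x in lebesgue. h2per_deriv 1 u x = h2per_fun' u x"
    "h2per_fun u (x + 2 * pi) = h2per_fun u x" "h2per_fun' u (x + 2 * pi) = h2per_fun' u x"
    unfolding 0 1 by (fact F)+
qed

lemma h2per_fun_continuous: "continuous_on S (h2per_fun u)" "continuous_on S (h2per_fun' u)"
  by (rule primitive_continuous, rule h2per_fun)+

lemma square_integrable_continuous:
  assumes "continuous_on UNIV f"
  shows "locally_square_integrable f"
  unfolding locally_square_integrable_def
proof (intro allI impI)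
  fix K :: "real set" assume K: "compact K"
  have i: "set_integrable lebesgue K g" if "continuous_on UNIV g" for g :: "real \<Rightarrow> 'a::euclidean_space"
  proof -
    obtain r where "\<And>x. x \<in> K \<Longrightarrow> \<bar>x\<bar> \<le> r" using compact_imp_bounded[OF K] by (auto simp: bounded_iff)
    then have "K \<subseteq> {-r..r}" by (force simp: abs_le_iff)
    have "g absolutely_integrable_on {-r..r}"
      by (rule absolutely_integrable_continuous_real[OF continuous_on_subset[OF that]]) auto
    then show ?thesis
      by (rule set_integrable_subset[OF _ fmeasurableD[OF lmeasurable_compact[OF K]] \<open>K \<subseteq> {-r..r}\<close>])
  qed
  have "continuous_on UNIV (\<lambda>x. (cmod (f x))\<^sup>2)" by (intro continuous_intros assms)
  from i[OF this] i[OF assms] show "square_integrable K f"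
    by (simp add: square_integrable_def set_borel_measurable_def set_integrable_def borel_measurable_integrable)
qed

text \<open>
  The converse of \<open>h2per_primitives_exist\<close>: classical periodic solutions of differential
  equations yield elements of the Sobolev space.
\<close>

lemma h2per_of_primitives:
  assumes F: "primitive F0 F1" "primitive F1 F2" and sq: "locally_square_integrable F2"
    and per: "\<And>x. F0 (x + 2 * pi) = F0 x"
  obtains u where "AE x in lebesgue. rep_h2per u x = F0 x" "AE x in lebesgue. h2per_deriv 1 u x = F1 x"
    "AE x in lebesgue. h2per_deriv 2 u x = F2 x"
proof -
  note c = primitive_continuous[OF F(1)] primitive_continuous[OF F(2)]
  have l: "locally_integrable UNIV F0" "locally_integrable UNIV F1" "locally_integrable UNIV F2"
    by (intro locally_integrableI absolutely_integrable_continuous_real c primitiveD'[OF F(2)])+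
  have w1: "has_weak_deriv 1 UNIV F0 F1"
    using l has_weak_deriv_primitive[OF F(1)] by (simp add: has_weak_deriv_UNIV_iff)
  have w2: "has_weak_deriv 2 UNIV F0 F2"
    using l has_weak_deriv_primitive[OF F(1) test_function_deriv] has_weak_deriv_primitive[OF F(2)]
    by (simp add: has_weak_deriv_UNIV_iff eval_nat_numeral)
  have "F0 \<in> H2per_funs"
    unfolding H2per_funs_def
    using per w1 w2 sq square_integrable_continuous[OF c(1)] square_integrable_continuous[OF c(2)] by auto
  then have r: "AE x in lebesgue. rep_h2per (abs_h2per F0) x = F0 x" by (rule rep_abs_h2per)
  then have r': "AE x in lebesgue. F0 x = rep_h2per (abs_h2per F0) x" by eventually_elim simp
  show thesis
  proof (rule that[OF r])
    show "AE x in lebesgue. h2per_deriv 1 (abs_h2per F0) x = F1 x"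
      by (rule has_weak_deriv_unique[OF h2per_deriv(1) has_weak_deriv_AE_cong[OF w1 r']]) simp
    show "AE x in lebesgue. h2per_deriv 2 (abs_h2per F0) x = F2 x"
      by (rule has_weak_deriv_unique[OF h2per_deriv(1) has_weak_deriv_AE_cong[OF w2 r']]) simp
  qed
qed

lemma rep_h2per_lincomb: "AE x in lebesgue. rep_h2per (u + c *\<^sub>R v) x = rep_h2per u x + c *\<^sub>R rep_h2per v x"
proof -
  have "AE x in lebesgue. rep_h2per (u + c *\<^sub>R v) x = rep_h2per u x + rep_h2per (c *\<^sub>R v) x"
    by (simp add: plus_h2per_def rep_abs_h2per H2per_funs_add rep_h2per_in)
  moreover have "AE x in lebesgue. rep_h2per (c *\<^sub>R v) x = c *\<^sub>R rep_h2per v x"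
    using rep_abs_h2per[OF H2per_funs_scaleR[OF rep_h2per_in]] by (simp add: scaleR_h2per_def)
  ultimately show ?thesis by eventually_elim simp
qed

lemma h2per_deriv_lincomb:
  assumes k: "k \<le> 2"
  shows "AE x in lebesgue. h2per_deriv k (u + c *\<^sub>R v) x = h2per_deriv k u x + c *\<^sub>R h2per_deriv k v x"
proof (rule has_weak_deriv_unique[OF h2per_deriv(1)[OF k]])
  have "AE x in lebesgue. rep_h2per u x + c *\<^sub>R rep_h2per v x = rep_h2per (u + c *\<^sub>R v) x"
    using rep_h2per_lincomb[of u c v] by eventually_elim simp
  then show "has_weak_deriv k UNIV (rep_h2per (u + c *\<^sub>R v)) (\<lambda>x. h2per_deriv k u x + c *\<^sub>R h2per_deriv k v x)"
    by (rule has_weak_deriv_AE_cong[rotated]) (intro has_weak_deriv_add has_weak_deriv_scaleR h2per_deriv(1) k)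
qed

lemma h2per_fun_lincomb: "h2per_fun (u + c *\<^sub>R v) x = h2per_fun u x + c *\<^sub>R h2per_fun v x"
proof -
  have "AE x in lebesgue. h2per_fun (u + c *\<^sub>R v) x = h2per_fun u x + c *\<^sub>R h2per_fun v x"
    using rep_h2per_lincomb[of u c v] rep_h2per_fun[of u] rep_h2per_fun[of v] rep_h2per_fun[of "u + c *\<^sub>R v"]
    by eventually_elim simp
  then have "h2per_fun (u + c *\<^sub>R v) = (\<lambda>x. h2per_fun u x + c *\<^sub>R h2per_fun v x)"
    by (intro continuous_AE_eq continuous_intros h2per_fun_continuous)
  then show ?thesis by metis
qed

lemma h2per_fun_inject: "h2per_fun u = h2per_fun v \<Longrightarrow> u = v"
proof (rule h2per_eqI)
  assume *: "h2per_fun u = h2per_fun v"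
  show "AE x in lebesgue. rep_h2per u x = rep_h2per v x"
    using rep_h2per_fun[of u] rep_h2per_fun[of v] by eventually_elim (simp add: *)
qed

lemma h2per_fun_0: "h2per_fun 0 x = 0"
  using h2per_fun_lincomb[of 0 "-1" 0 x] by simp

lemma h2per_deriv_abs_int:
  assumes "k \<le> 2"
  shows "(\<lambda>x. (cmod (h2per_deriv k u x))\<^sup>2) absolutely_integrable_on {a..b}"
  using h2per_deriv(2)[OF assms, of u]
  by (simp add: locally_square_integrable_def square_integrable_def)

lemma norm_h2per_sq:
  "(norm u)\<^sup>2 = integral {0..2*pi} (\<lambda>x. (cmod (h2per_fun u x))\<^sup>2) +
     integral {0..2*pi} (\<lambda>x. (cmod (h2per_fun' u x))\<^sup>2) + integral {0..2*pi} (\<lambda>x. (cmod (h2per_deriv 2 u x))\<^sup>2)"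
proof -
  have I: "(LINT x:{0..2*pi}|lebesgue. (cmod (h2per_deriv k u x))\<^sup>2) = integral {0..2*pi} (\<lambda>x. (cmod (h2per_deriv k u x))\<^sup>2)"
    if "k \<le> 2" for k
    by (rule set_lebesgue_integral_eq_integral(2)[OF h2per_deriv_abs_int[OF that]])
  have "(norm u)\<^sup>2 = (\<Sum>k\<le>2. integral {0..2*pi} (\<lambda>x. (cmod (h2per_deriv k u x))\<^sup>2))"
    unfolding norm_h2per_def using I
    by (subst real_sqrt_pow2) (auto intro!: sum_nonneg integral_nonneg sum.cong
        simp: set_lebesgue_integral_eq_integral(1)[OF h2per_deriv_abs_int])
  also have "\<dots> = integral {0..2*pi} (\<lambda>x. (cmod (h2per_deriv 0 u x))\<^sup>2) +
     integral {0..2*pi} (\<lambda>x. (cmod (h2per_deriv 1 u x))\<^sup>2) + integral {0..2*pi} (\<lambda>x. (cmod (h2per_deriv 2 u x))\<^sup>2)"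
    by (simp add: eval_nat_numeral)
  also have "integral {0..2*pi} (\<lambda>x. (cmod (h2per_deriv 0 u x))\<^sup>2) = integral {0..2*pi} (\<lambda>x. (cmod (h2per_fun u x))\<^sup>2)"
    by (rule integral_AE_cong) (use h2per_deriv_0[of u] rep_h2per_fun[of u] in \<open>eventually_elim, simp\<close>)
  also have "integral {0..2*pi} (\<lambda>x. (cmod (h2per_deriv 1 u x))\<^sup>2) = integral {0..2*pi} (\<lambda>x. (cmod (h2per_fun' u x))\<^sup>2)"
    by (rule integral_AE_cong) (use h2per_deriv_fun'[of u] in \<open>eventually_elim, simp\<close>)
  finally show ?thesis .
qed

section \<open>The linear operator and its energy identities\<close>

abbreviation period :: "real set" where "period \<equiv> {0..2 * pi}"

abbreviation L2sq :: "(real \<Rightarrow> complex) \<Rightarrow> real" where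
  "L2sq f \<equiv> integral period (\<lambda>s. (cmod (f s))\<^sup>2)"

text \<open>
  The quantity that the term \<open>\<i> \<omega> u'\<close> contributes to the energy, apart from the factor \<open>- \<omega>\<close>.
\<close>

abbreviation momentum :: "h2per \<Rightarrow> real" where
  "momentum u \<equiv> integral period (\<lambda>s. Im (h2per_fun' u s * cnj (h2per_fun u s)))"

definition LLop :: "real \<Rightarrow> real \<Rightarrow> real \<Rightarrow> h2per \<Rightarrow> real \<Rightarrow> complex" where
  "LLop d \<zeta> \<omega> u s = - of_real d * h2per_deriv 2 u s + \<i> * of_real \<omega> * h2per_fun' u s
     + (of_real \<zeta> - \<i>) * h2per_fun u s"

lemma h2per_fun'_lincomb: "h2per_fun' (u + c *\<^sub>R v) x = h2per_fun' u x + c *\<^sub>R h2per_fun' v x"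
proof -
  have "AE x in lebesgue. h2per_fun' (u + c *\<^sub>R v) x = h2per_fun' u x + c *\<^sub>R h2per_fun' v x"
    using h2per_deriv_lincomb[of 1 u c v, simplified] h2per_deriv_fun'[of u] h2per_deriv_fun'[of v]
      h2per_deriv_fun'[of "u + c *\<^sub>R v"]
    by eventually_elim simp
  then have "h2per_fun' (u + c *\<^sub>R v) = (\<lambda>x. h2per_fun' u x + c *\<^sub>R h2per_fun' v x)"
    by (intro continuous_AE_eq continuous_intros h2per_fun_continuous)
  then show ?thesis by metis
qed

lemma LLop_lincomb:
  "AE x in lebesgue. LLop d \<zeta> \<omega> (u + c *\<^sub>R v) x = LLop d \<zeta> \<omega> u x + c *\<^sub>R LLop d \<zeta> \<omega> v x"
  using h2per_deriv_lincomb[of 2 u c v, simplified]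
  by eventually_elim (simp add: LLop_def h2per_fun_lincomb h2per_fun'_lincomb scaleR_conv_of_real algebra_simps)

lemma LLop_diff:
  "AE x in lebesgue. LLop d \<zeta> \<omega> (u - v) x = LLop d \<zeta> \<omega> u x - LLop d \<zeta> \<omega> v x"
  using LLop_lincomb[of d \<zeta> \<omega> u "-1" v] by simp

lemma h2per_fun_diff: "h2per_fun (u - v) x = h2per_fun u x - h2per_fun v x"
  using h2per_fun_lincomb[of u "-1" v x] by simp

lemma LLop_scaleR:
  "AE x in lebesgue. LLop d \<zeta> \<omega> (c *\<^sub>R v) x = c *\<^sub>R LLop d \<zeta> \<omega> v x"
  using LLop_lincomb[of d \<zeta> \<omega> 0 c v] LLop_lincomb[of d \<zeta> \<omega> 0 "-1" 0] by eventually_elim simp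

lemma locally_square_integrable_add:
  "locally_square_integrable f \<Longrightarrow> locally_square_integrable g \<Longrightarrow> locally_square_integrable (\<lambda>x. f x + g x)"
  by (simp add: locally_square_integrable_def square_integrable_add)

lemma locally_square_integrable_scaleR:
  "locally_square_integrable f \<Longrightarrow> locally_square_integrable (\<lambda>x. (c::real) *\<^sub>R f x)"
  by (simp add: locally_square_integrable_def square_integrable_scaleR)

lemma square_integrable_LLop: "locally_square_integrable (LLop d \<zeta> \<omega> u)"
proof -
  have "locally_square_integrable (\<lambda>s. (-d) *\<^sub>R h2per_deriv 2 u s +
      (\<i> * of_real \<omega> * h2per_fun' u s + (of_real \<zeta> - \<i>) * h2per_fun u s))"
    by (intro locally_square_integrable_add locally_square_integrable_scaleR h2per_deriv(2)
        square_integrable_continuous continuous_intros h2per_fun_continuous) simp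
  also have "(\<lambda>s. (-d) *\<^sub>R h2per_deriv 2 u s +
      (\<i> * of_real \<omega> * h2per_fun' u s + (of_real \<zeta> - \<i>) * h2per_fun u s)) = LLop d \<zeta> \<omega> u"
    by (rule ext) (simp add: LLop_def scaleR_conv_of_real)
  finally show ?thesis .
qed

lemma locally_square_integrable_sq:
  "locally_square_integrable f \<Longrightarrow> (\<lambda>x. (cmod (f x))\<^sup>2) integrable_on {a..b}"
  by (auto simp: locally_square_integrable_def square_integrable_def
      intro: set_lebesgue_integral_eq_integral(1))

lemma locally_square_integrable_abs_int:
  assumes "locally_square_integrable f"
  shows "f absolutely_integrable_on {a..b}"
proof -
  have "square_integrable {a..b} f" using assms by (simp add: locally_square_integrable_def)
  then have m: "(\<lambda>x. indicat_real {a..b} x *\<^sub>R f x) \<in> borel_measurable lebesgue"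
    and sq: "integrable lebesgue (\<lambda>x. (cmod (indicat_real {a..b} x *\<^sub>R f x))\<^sup>2)"
    by (auto simp: square_integrable_iff)
  have i1: "integrable lebesgue (\<lambda>x. indicat_real {a..b} x *\<^sub>R (1::real))"
    by (rule integrable_indicator_compact) simp
  show ?thesis
    unfolding set_integrable_def
  proof (rule Bochner_Integration.integrable_bound[OF Bochner_Integration.integrable_add[OF i1 sq] m], intro AE_I2)
    fix x
    have "t \<le> 1 + t\<^sup>2" for t :: real using zero_le_power2[of "t - 1/2"] by (simp add: power2_eq_square algebra_simps)
    from this[of "cmod (f x)"]
    show "cmod (indicat_real {a..b} x *\<^sub>R f x)
        \<le> norm (indicat_real {a..b} x *\<^sub>R 1 + (cmod (indicat_real {a..b} x *\<^sub>R f x))\<^sup>2)"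
      by (auto simp: indicator_def)
  qed
qed

text \<open>
  Integration by parts over a period, where the boundary terms cancel: with \<open>F = u\<close>, \<open>G = u'\<close> and
  \<open>H = u''\<close>, the functions \<open>P\<close> and \<open>Q\<close> below are the derivatives of the periodic functions
  \<open>G * cnj F\<close> and \<open>F * cnj F\<close>. What remains of \<open>L u * cnj u\<close> is
  \<open>d * (cmod G)\<^sup>2 + \<i> * \<omega> * (G * cnj F) + (\<zeta> - \<i>) * (cmod F)\<^sup>2\<close>.
\<close>

lemma h2per_energy:
  shows h2per_energy_int: "(\<lambda>s. LLop d \<zeta> \<omega> u s * cnj (h2per_fun u s)) integrable_on period"
    and h2per_energy_Im: "integral period (\<lambda>s. Im (LLop d \<zeta> \<omega> u s * cnj (h2per_fun u s))) =
      - L2sq (h2per_fun u)"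
    and h2per_energy_Re: "integral period (\<lambda>s. Re (LLop d \<zeta> \<omega> u s * cnj (h2per_fun u s))) =
      d * L2sq (h2per_fun' u)
      - \<omega> * momentum u
      + \<zeta> * L2sq (h2per_fun u)"
proof -
  let ?F = "h2per_fun u" and ?G = "h2per_fun' u" and ?H = "h2per_deriv 2 u" and ?L = "LLop d \<zeta> \<omega> u"
  note per = h2per_fun_periodic[of u 0, simplified] h2per_fun'_periodic[of u 0, simplified]
  have cF: "primitive (\<lambda>s. cnj (?F s)) (\<lambda>s. cnj (?G s))"
    by (rule primitive_linear[OF h2per_primitive bounded_linear_cnj])
  define P where "P s = ?H s * cnj (?F s) + ?G s * cnj (?G s)" for s
  define Q where "Q s = ?G s * cnj (?F s) + ?F s * cnj (?G s)" for s
  have P: "(P has_integral 0) period"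
    using primitiveD[OF primitive_mult[OF h2per_primitive' cF], of 0 "2*pi"] per
    by (auto simp: P_def[abs_def] has_integral_iff set_lebesgue_integral_eq_integral(1))
  have Q: "(Q has_integral 0) period"
    using primitiveD[OF primitive_mult[OF h2per_primitive cF], of 0 "2*pi"] per
    by (auto simp: Q_def[abs_def] has_integral_iff set_lebesgue_integral_eq_integral(1))
  have cont: "(\<lambda>s. (cmod (?G s))\<^sup>2) integrable_on period" "(\<lambda>s. (cmod (?F s))\<^sup>2) integrable_on period"
    "(\<lambda>s. Im (?G s * cnj (?F s))) integrable_on period"
    by (intro integrable_continuous_real continuous_intros h2per_fun_continuous)+
  have Fcnj: "?F s * cnj (?F s) = of_real ((cmod (?F s))\<^sup>2)" "?G s * cnj (?G s) = of_real ((cmod (?G s))\<^sup>2)" for s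
    by (simp_all only: complex_norm_square)
  have L: "?L s * cnj (?F s) = - of_real d * P s + of_real (d * (cmod (?G s))\<^sup>2) + \<i> * of_real \<omega> * (?G s * cnj (?F s))
       + (of_real \<zeta> - \<i>) * of_real ((cmod (?F s))\<^sup>2)" for s
    unfolding P_def LLop_def of_real_mult[of d] Fcnj[symmetric] by (simp add: algebra_simps)
  have QRe: "Re (Q s) = 2 * Re (?G s * cnj (?F s))" for s by (simp add: Q_def)
  have I1: "((\<lambda>s. Im (?L s * cnj (?F s))) has_integral - d * 0 + \<omega> / 2 * 0 - L2sq ?F) period"
  proof -
    have "((\<lambda>s. - d * Im (P s) + \<omega> / 2 * Re (Q s) - (cmod (?F s))\<^sup>2) has_integral
        - d * 0 + \<omega> / 2 * 0 - L2sq ?F) period"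
      using has_integral_linear[OF P bounded_linear_Im] has_integral_linear[OF Q bounded_linear_Re]
      by (intro has_integral_diff has_integral_add has_integral_mult_right integrable_integral cont)
        (simp_all add: o_def)
    moreover have "Im (?L s * cnj (?F s)) = - d * Im (P s) + \<omega> / 2 * Re (Q s) - (cmod (?F s))\<^sup>2" for s
      unfolding L QRe by simp
    ultimately show ?thesis by (simp only:)
  qed
  then show "integral period (\<lambda>s. Im (?L s * cnj (?F s))) = - L2sq ?F"
    by (simp add: integral_unique)
  have I2: "((\<lambda>s. Re (?L s * cnj (?F s))) has_integral - d * 0 + d * L2sq ?G
      - \<omega> * momentum u + \<zeta> * L2sq ?F) period"
  proof -
    have "((\<lambda>s. - d * Re (P s) + d * (cmod (?G s))\<^sup>2 - \<omega> * Im (?G s * cnj (?F s)) + \<zeta> * (cmod (?F s))\<^sup>2) has_integral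
        - d * 0 + d * L2sq ?G
      - \<omega> * momentum u + \<zeta> * L2sq ?F) period"
      using has_integral_linear[OF P bounded_linear_Re]
      by (intro has_integral_diff has_integral_add has_integral_mult_right integrable_integral cont)
        (simp_all add: o_def)
    moreover have "Re (?L s * cnj (?F s)) = - d * Re (P s) + d * (cmod (?G s))\<^sup>2 - \<omega> * Im (?G s * cnj (?F s)) + \<zeta> * (cmod (?F s))\<^sup>2" for s
      unfolding L by simp
    ultimately show ?thesis by (simp only:)
  qed
  then show "integral period (\<lambda>s. Re (?L s * cnj (?F s))) =
      d * L2sq ?G - \<omega> * momentum u
      + \<zeta> * L2sq ?F"
    by (simp add: integral_unique)
  have "(\<lambda>s. complex_of_real (Re (?L s * cnj (?F s))) + \<i> * complex_of_real (Im (?L s * cnj (?F s)))) integrable_on period"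
    using I1 I2
    by (intro integrable_add integrable_on_mult_right integrable_linear[OF _ bounded_linear_of_real, unfolded o_def])
      (auto simp only: integrable_on_def)
  then show "(\<lambda>s. ?L s * cnj (?F s)) integrable_on period" by (simp only: complex_eq[symmetric])
qed

lemma h2per_energy_Im_int: "(\<lambda>s. Im (LLop d \<zeta> \<omega> u s * cnj (h2per_fun u s))) integrable_on period"
  and h2per_energy_Re_int: "(\<lambda>s. Re (LLop d \<zeta> \<omega> u s * cnj (h2per_fun u s))) integrable_on period"
  using integrable_linear[OF h2per_energy_int bounded_linear_Im] integrable_linear[OF h2per_energy_int bounded_linear_Re]
  by (simp_all add: o_def)

lemma h2per_fun_int:
  "(\<lambda>s. (cmod (h2per_fun u s))\<^sup>2) integrable_on {a..b}" "(\<lambda>s. (cmod (h2per_fun' u s))\<^sup>2) integrable_on {a..b}"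
  "(\<lambda>s. Im (h2per_fun' u s * cnj (h2per_fun u s))) integrable_on {a..b}"
  by (intro integrable_continuous_real continuous_intros h2per_fun_continuous)+

lemma integral_sq_nonneg: "0 \<le> integral S (\<lambda>s. (cmod (f s))\<^sup>2)"
  by (cases "(\<lambda>s. (cmod (f s))\<^sup>2) integrable_on S") (auto intro: integral_nonneg simp: not_integrable_integral)

lemma young: "a * b \<le> a\<^sup>2 / 2 + b\<^sup>2 / (2::real)"
  using zero_le_power2[of "a - b"] by (simp add: power2_diff)

lemma young_weighted: "0 < (k::real) \<Longrightarrow> a * b \<le> k * a\<^sup>2 / 2 + b\<^sup>2 / (2 * k)"
  using zero_le_power2[of "k * a - b"] by (simp add: power2_diff field_simps power2_eq_square)

text \<open>
  By \<open>h2per_energy_Im\<close> the damping alone makes up the imaginary part of the energy, and that part is at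
  most the integral of \<open>\<bar>L u\<bar> * \<bar>u\<bar>\<close>.
\<close>

lemma elliptic_L2:
  "L2sq (h2per_fun u) \<le> L2sq (LLop d \<zeta> \<omega> u)"
proof -
  let ?F = "h2per_fun u" and ?L = "LLop d \<zeta> \<omega> u"
  note sq = locally_square_integrable_sq[OF square_integrable_LLop]
  have "integral period (\<lambda>s. - Im (?L s * cnj (?F s))) \<le> integral period (\<lambda>s. (cmod (?L s))\<^sup>2 / 2 + (cmod (?F s))\<^sup>2 / 2)"
  proof (rule integral_le)
    fix s
    have "- Im (?L s * cnj (?F s)) \<le> cmod (?L s) * cmod (?F s)"
      using abs_Im_le_cmod[of "?L s * cnj (?F s)"] by (simp add: norm_mult)
    then show "- Im (?L s * cnj (?F s)) \<le> (cmod (?L s))\<^sup>2 / 2 + (cmod (?F s))\<^sup>2 / 2"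
      using young[of "cmod (?L s)" "cmod (?F s)"] by linarith
  qed (intro integrable_neg h2per_energy_Im_int integrable_add integrable_on_divide sq h2per_fun_int)+
  also have "\<dots> = L2sq ?L / 2 + L2sq ?F / 2"
    by (simp add: integral_add integrable_on_divide sq h2per_fun_int)
  finally show ?thesis unfolding integral_neg h2per_energy_Im by simp
qed

lemma energy_cross_term:
  assumes "0 < k"
  shows "\<bar>\<omega> * momentum u\<bar> \<le>
    k * L2sq (h2per_fun' u) + \<omega>\<^sup>2 / (4 * k) * L2sq (h2per_fun u)"
proof -
  let ?F = "h2per_fun u" and ?G = "h2per_fun' u"
  have "\<bar>\<omega> * momentum u\<bar> = norm (integral period (\<lambda>s. \<omega> * Im (?G s * cnj (?F s))))" by simp
  also have "\<dots> \<le> integral period (\<lambda>s. k * (cmod (?G s))\<^sup>2 + \<omega>\<^sup>2 / (4 * k) * (cmod (?F s))\<^sup>2)"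
  proof (rule integral_norm_bound_integral)
    fix s
    have "norm (\<omega> * Im (?G s * cnj (?F s))) \<le> cmod (?G s) * (\<bar>\<omega>\<bar> * cmod (?F s))"
      using abs_Im_le_cmod[of "?G s * cnj (?F s)"] by (simp add: norm_mult abs_mult mult_left_mono mult.left_commute)
    also have "\<dots> \<le> 2 * k * (cmod (?G s))\<^sup>2 / 2 + (\<bar>\<omega>\<bar> * cmod (?F s))\<^sup>2 / (2 * (2 * k))"
      using assms by (intro young_weighted) simp
    finally show "norm (\<omega> * Im (?G s * cnj (?F s))) \<le> k * (cmod (?G s))\<^sup>2 + \<omega>\<^sup>2 / (4 * k) * (cmod (?F s))\<^sup>2"
      by (simp add: power_mult_distrib)
  qed (intro integrable_on_mult_right integrable_add h2per_fun_int)+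
  also have "\<dots> = k * L2sq ?G + \<omega>\<^sup>2 / (4 * k) * L2sq ?F"
    using integrable_on_mult_right[OF h2per_fun_int(2), of k]
      integrable_on_mult_right[OF h2per_fun_int(1), of "\<omega>\<^sup>2 / (4 * k)"]
    by (simp add: integral_add)
  finally show ?thesis .
qed

lemma elliptic_L2':
  assumes "d \<noteq> 0"
  shows "\<bar>d\<bar> * L2sq (h2per_fun' u) \<le>
    2 * (1 + \<omega>\<^sup>2 / (2 * \<bar>d\<bar>) + \<bar>\<zeta>\<bar>) * L2sq (LLop d \<zeta> \<omega> u)"
proof -
  let ?F = "h2per_fun u" and ?G = "h2per_fun' u" and ?L = "LLop d \<zeta> \<omega> u"
  define n0 n1 N where "n0 = L2sq ?F" "n1 = L2sq ?G"
    "N = L2sq ?L"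
  note sq = locally_square_integrable_sq[OF square_integrable_LLop]
  have "n0 \<le> N" unfolding n0_n1_N_def by (rule elliptic_L2)
  have "0 \<le> n0" by (simp add: n0_n1_N_def integral_sq_nonneg)
  have "\<bar>integral period (\<lambda>s. Re (?L s * cnj (?F s)))\<bar> \<le> integral period (\<lambda>s. (cmod (?L s))\<^sup>2 / 2 + (cmod (?F s))\<^sup>2 / 2)"
    unfolding real_norm_def[symmetric]
  proof (rule integral_norm_bound_integral)
    fix s
    have "norm (Re (?L s * cnj (?F s))) \<le> cmod (?L s) * cmod (?F s)"
      using abs_Re_le_cmod[of "?L s * cnj (?F s)"] by (simp add: norm_mult)
    then show "norm (Re (?L s * cnj (?F s))) \<le> (cmod (?L s))\<^sup>2 / 2 + (cmod (?F s))\<^sup>2 / 2"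
      using young[of "cmod (?L s)" "cmod (?F s)"] by linarith
  qed (intro h2per_energy_Re_int integrable_add integrable_on_divide sq h2per_fun_int)+
  also have "\<dots> = N / 2 + n0 / 2"
    by (simp add: n0_n1_N_def integral_add integrable_on_divide sq h2per_fun_int)
  finally have 1: "\<bar>d * n1 - \<omega> * momentum u + \<zeta> * n0\<bar> \<le> N / 2 + n0 / 2"
    by (simp only: h2per_energy_Re n0_n1_N_def)
  have 2: "\<bar>\<omega> * momentum u\<bar> \<le> \<bar>d\<bar> / 2 * n1 + \<omega>\<^sup>2 / (2 * \<bar>d\<bar>) * n0"
    using energy_cross_term[of "\<bar>d\<bar> / 2" \<omega> u] assms by (simp add: n0_n1_N_def)
  have "0 \<le> n1" by (simp add: n0_n1_N_def integral_sq_nonneg)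
  then have "\<bar>d\<bar> * n1 = \<bar>d * n1\<bar>" by (simp add: abs_mult)
  also have "\<dots> \<le> N / 2 + n0 / 2 + (\<bar>d\<bar> / 2 * n1 + \<omega>\<^sup>2 / (2 * \<bar>d\<bar>) * n0) + \<bar>\<zeta> * n0\<bar>" using 1 2 by linarith
  also have "\<bar>\<zeta> * n0\<bar> = \<bar>\<zeta>\<bar> * n0" using \<open>0 \<le> n0\<close> by (simp add: abs_mult)
  finally have "\<bar>d\<bar> * n1 \<le> N + n0 + 2 * (\<omega>\<^sup>2 / (2 * \<bar>d\<bar>) * n0) + 2 * (\<bar>\<zeta>\<bar> * n0)" by linarith
  also have "\<dots> \<le> N + N + 2 * (\<omega>\<^sup>2 / (2 * \<bar>d\<bar>) * N) + 2 * (\<bar>\<zeta>\<bar> * N)"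
    using \<open>n0 \<le> N\<close> by (intro add_mono mult_left_mono) auto
  finally show ?thesis unfolding n0_n1_N_def[symmetric] by (simp add: algebra_simps)
qed

text \<open>
  The imaginary part of the energy controls \<open>u\<close>, then the real part controls \<open>u'\<close>, and finally
  the equation itself controls \<open>u''\<close>.
\<close>

lemma elliptic_estimate:
  assumes "d \<noteq> 0"
  shows "\<exists>K\<ge>0. \<forall>u. (norm u)\<^sup>2 \<le> K * L2sq (LLop d \<zeta> \<omega> u)"
proof -
  define k where "k = 2 * (1 + \<omega>\<^sup>2 / (2 * \<bar>d\<bar>) + \<bar>\<zeta>\<bar>) / \<bar>d\<bar>"
  have k: "k \<ge> 0" by (simp add: k_def)
  define K where "K = 1 + k + 3 * (1 + \<omega>\<^sup>2 * k + (\<zeta>\<^sup>2 + 1)) / d\<^sup>2"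
  have "(norm u)\<^sup>2 \<le> K * L2sq (LLop d \<zeta> \<omega> u)" for u
  proof -
    let ?F = "h2per_fun u" and ?G = "h2per_fun' u" and ?H = "h2per_deriv 2 u" and ?L = "LLop d \<zeta> \<omega> u"
    define n0 n1 n2 N where "n0 = L2sq ?F" "n1 = L2sq ?G"
      "n2 = L2sq ?H" "N = L2sq ?L"
    note defs = n0_n1_n2_N_def
    note sq = locally_square_integrable_sq[OF square_integrable_LLop] locally_square_integrable_sq[OF h2per_deriv(2)[of 2, simplified]]
    have 0: "n0 \<le> N" unfolding defs by (rule elliptic_L2)
    have 1: "n1 \<le> k * N"
      using elliptic_L2'[OF assms, of u \<omega> \<zeta>] assms unfolding defs k_def by (simp add: field_simps)
    have "d\<^sup>2 * n2 = integral period (\<lambda>s. d\<^sup>2 * (cmod (?H s))\<^sup>2)" by (simp add: defs)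
    also have "\<dots> \<le> integral period (\<lambda>s. 3 * ((cmod (?L s))\<^sup>2 + \<omega>\<^sup>2 * (cmod (?G s))\<^sup>2 + (\<zeta>\<^sup>2 + 1) * (cmod (?F s))\<^sup>2))"
    proof (rule integral_le)
      fix s
      define x y z where "x = cmod (?L s)" "y = \<bar>\<omega>\<bar> * cmod (?G s)" "z = cmod (of_real \<zeta> - \<i>) * cmod (?F s)"
      have "of_real d * ?H s = \<i> * of_real \<omega> * ?G s + (of_real \<zeta> - \<i>) * ?F s - ?L s" by (simp add: LLop_def)
      then have "cmod (of_real d * ?H s) \<le> x + y + z"
        using norm_triangle_ineq4[of "\<i> * of_real \<omega> * ?G s + (of_real \<zeta> - \<i>) * ?F s" "?L s"]
          norm_triangle_ineq[of "\<i> * of_real \<omega> * ?G s" "(of_real \<zeta> - \<i>) * ?F s"]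
        by (simp add: norm_mult x_y_z_def)
      then have "(cmod (of_real d * ?H s))\<^sup>2 \<le> (x + y + z)\<^sup>2" by (intro power_mono) auto
      also have "\<dots> \<le> 3 * (x\<^sup>2 + y\<^sup>2 + z\<^sup>2)"
        using zero_le_power2[of "x - y"] zero_le_power2[of "x - z"] zero_le_power2[of "y - z"]
        by (simp add: power2_eq_square algebra_simps)
      also have "z\<^sup>2 = (\<zeta>\<^sup>2 + 1) * (cmod (?F s))\<^sup>2" by (simp add: x_y_z_def power_mult_distrib cmod_power2)
      finally show "d\<^sup>2 * (cmod (?H s))\<^sup>2 \<le> 3 * ((cmod (?L s))\<^sup>2 + \<omega>\<^sup>2 * (cmod (?G s))\<^sup>2 + (\<zeta>\<^sup>2 + 1) * (cmod (?F s))\<^sup>2)"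
        by (simp add: x_y_z_def power_mult_distrib norm_mult)
    qed (intro integrable_on_mult_right integrable_add sq h2per_fun_int)+
    also have "\<dots> = 3 * (N + \<omega>\<^sup>2 * n1 + (\<zeta>\<^sup>2 + 1) * n0)"
      using integrable_on_mult_right[OF h2per_fun_int(2), of "\<omega>\<^sup>2"]
        integrable_on_mult_right[OF h2per_fun_int(1), of "\<zeta>\<^sup>2 + 1"] sq
      by (simp add: defs integral_add integrable_add)
    also have "\<dots> \<le> 3 * (N + \<omega>\<^sup>2 * (k * N) + (\<zeta>\<^sup>2 + 1) * N)"
      using 0 1 by (intro mult_left_mono add_mono) auto
    finally have 2: "n2 \<le> 3 * (1 + \<omega>\<^sup>2 * k + (\<zeta>\<^sup>2 + 1)) / d\<^sup>2 * N"
      using assms by (simp add: field_simps)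
    have "(norm u)\<^sup>2 = n0 + n1 + n2" by (simp add: norm_h2per_sq defs)
    also have "\<dots> \<le> N + k * N + 3 * (1 + \<omega>\<^sup>2 * k + (\<zeta>\<^sup>2 + 1)) / d\<^sup>2 * N"
      by (intro add_mono 0 1 2)
    also have "\<dots> = K * N" by (simp add: K_def algebra_simps add_divide_distrib)
    finally show ?thesis by (simp add: defs)
  qed
  moreover have "K \<ge> 0" using k by (simp add: K_def)
  ultimately show ?thesis by blast
qed

section \<open>Pointwise bounds\<close>

lemma periodic_reduce:
  assumes "\<And>x::real. f (x + 2 * pi) = f x"
  shows "f (x - 2 * pi * of_int \<lfloor>x / (2 * pi)\<rfloor>) = f x" "x - 2 * pi * of_int \<lfloor>x / (2 * pi)\<rfloor> \<in> period"
proof -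
  interpret periodic_fun_simple f "2 * pi" by unfold_locales (rule assms)
  show "f (x - 2 * pi * of_int \<lfloor>x / (2 * pi)\<rfloor>) = f x"
    using minus_of_int[of x "\<lfloor>x / (2 * pi)\<rfloor>"] by (simp add: mult.commute)
  define n :: real where "n = of_int \<lfloor>x / (2 * pi)\<rfloor>"
  have "n \<le> x / (2 * pi)" "x / (2 * pi) \<le> n + 1" unfolding n_def by linarith+
  then have "n * (2 * pi) \<le> x" "x \<le> (n + 1) * (2 * pi)"
    by (simp_all add: pos_le_divide_eq pos_divide_le_eq)
  then show "x - 2 * pi * of_int \<lfloor>x / (2 * pi)\<rfloor> \<in> period"
    by (simp add: n_def algebra_simps)
qed

text \<open>
  The Cauchy--Schwarz inequality, in the form in which root mean squares enter below.
\<close>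

lemma integral_norm_le_of_sq:
  fixes f :: "real \<Rightarrow> complex"
  assumes f: "(\<lambda>s. cmod (f s)) integrable_on period" "(\<lambda>s. (cmod (f s))\<^sup>2) integrable_on period"
    and B: "0 \<le> B" "L2sq f \<le> 2 * pi * B\<^sup>2"
  shows "integral period (\<lambda>s. cmod (f s)) \<le> 2 * pi * B"
proof (rule field_le_epsilon)
  fix e :: real assume "0 < e"
  define k where "k = B + e / (2 * pi)"
  have k: "0 < k" "B \<le> k" "2 * pi * k = 2 * pi * B + e"
    using B(1) \<open>0 < e\<close> by (auto simp: k_def add_nonneg_pos distrib_left)
  have "integral period (\<lambda>s. cmod (f s)) \<le> integral period (\<lambda>s. k / 2 + (cmod (f s))\<^sup>2 / (2 * k))"
  proof (rule integral_le)
    show "cmod (f s) \<le> k / 2 + (cmod (f s))\<^sup>2 / (2 * k)" for s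
      using young_weighted[of k 1 "cmod (f s)"] k(1) by simp
  qed (intro f integrable_add integrable_const_ivl integrable_on_divide)+
  also have "\<dots> = pi * k + L2sq f / (2 * k)"
    using f(2) by (subst integral_add) (auto intro!: integrable_on_divide)
  also have "\<dots> \<le> pi * k + 2 * pi * k\<^sup>2 / (2 * k)"
  proof (intro add_left_mono divide_right_mono)
    have "2 * pi * B\<^sup>2 \<le> 2 * pi * k\<^sup>2" using k B(1) by (intro mult_left_mono power_mono) auto
    with B(2) show "L2sq f \<le> 2 * pi * k\<^sup>2" by linarith
  qed (use k in auto)
  also have "\<dots> = 2 * pi * B + e" using k by (simp add: power2_eq_square)
  finally show "integral period (\<lambda>s. cmod (f s)) \<le> 2 * pi * B + e" .
qed

lemma norm_le_rms_somewhere: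
  fixes F :: "real \<Rightarrow> complex"
  assumes c: "\<And>S. continuous_on S F" and m: "0 \<le> m" "L2sq F \<le> 2 * pi * m\<^sup>2"
  shows "\<exists>y\<in>period. cmod (F y) \<le> m"
proof (rule ccontr)
    assume "\<not> ?thesis"
    then have gt: "\<And>y. y \<in> period \<Longrightarrow> m < cmod (F y)" by force
    have "continuous_on period (\<lambda>y. cmod (F y))" by (intro continuous_intros c)
    moreover have "period \<noteq> {}" "compact period" by auto
    ultimately obtain z where z: "z \<in> period" "\<And>y. y \<in> period \<Longrightarrow> cmod (F z) \<le> cmod (F y)"
      using continuous_attains_inf[of period "\<lambda>y. cmod (F y)"] by metis
    have "2 * pi * m\<^sup>2 < 2 * pi * (cmod (F z))\<^sup>2"
      using gt[OF z(1)] m(1) by (intro mult_strict_left_mono power_strict_mono) auto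
    also have "\<dots> = integral period (\<lambda>s. (cmod (F z))\<^sup>2)" by simp
    also have "\<dots> \<le> L2sq F"
      by (intro integral_le integrable_continuous_real continuous_intros c power_mono z(2)) auto
    finally show False using m(2) by simp
  qed

text \<open>
  Somewhere the function is at most its root mean square, and from there it varies by at most the
  integral of its derivative.
\<close>

lemma norm_le_rms_plus_variation:
  fixes F :: "real \<Rightarrow> complex"
  assumes F: "primitive F f" and m: "0 \<le> m" "L2sq F \<le> 2 * pi * m\<^sup>2"
    and x: "x \<in> period"
  shows "cmod (F x) \<le> m + integral period (\<lambda>s. cmod (f s))"
proof -
  obtain y where y: "y \<in> period" "cmod (F y) \<le> m"
    using norm_le_rms_somewhere[OF primitive_continuous[OF F] m] by blast
  have "cmod (F x - F y) \<le> integral period (\<lambda>s. cmod (f s))"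
    using primitive_norm_le[OF F, of 0 x y "2*pi"] primitive_norm_le[OF F, of 0 y x "2*pi"] x y(1)
    by (cases "x \<le> y") (auto simp: norm_minus_commute)
  then show ?thesis using y(2) norm_triangle_ineq2[of "F x" "F y"] by linarith
qed

lemma h2per_deriv2_int:
  "(\<lambda>s. (cmod (h2per_deriv 2 u s))\<^sup>2) integrable_on {a..b}" "(\<lambda>s. cmod (h2per_deriv 2 u s)) integrable_on {a..b}"
  using locally_square_integrable_sq[OF h2per_deriv(2)[of 2 u]]
    locally_square_integrable_abs_int[OF h2per_deriv(2)[of 2 u]]
  by (auto simp: absolutely_integrable_on_def)

lemma norm_fun_le_h2per_norm:
  shows "cmod (h2per_fun u x) \<le> (1 + 2 * pi) * norm u" "cmod (h2per_fun' u x) \<le> (1 + 2 * pi) * norm u"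
proof -
  have "1 * (norm u)\<^sup>2 \<le> (2 * pi) * (norm u)\<^sup>2" using pi_gt3 by (intro mult_right_mono) auto
  then have le: "L2sq (h2per_fun u) \<le> 2 * pi * (norm u)\<^sup>2"
    "L2sq (h2per_fun' u) \<le> 2 * pi * (norm u)\<^sup>2"
    "L2sq (h2per_deriv 2 u) \<le> 2 * pi * (norm u)\<^sup>2"
    using norm_h2per_sq[of u] integral_sq_nonneg[of period "h2per_fun u"]
      integral_sq_nonneg[of period "h2per_fun' u"] integral_sq_nonneg[of period "h2per_deriv 2 u"] by linarith+
  have v: "integral period (\<lambda>s. cmod (h2per_fun' u s)) \<le> 2 * pi * norm u"
    "integral period (\<lambda>s. cmod (h2per_deriv 2 u s)) \<le> 2 * pi * norm u"
    by (intro integral_norm_le_of_sq le h2per_fun_int h2per_deriv2_int norm_ge_zero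
        integrable_continuous_real continuous_intros h2per_fun_continuous)+
  note red = periodic_reduce[of "h2per_fun u" x, OF h2per_fun_periodic] periodic_reduce[of "h2per_fun' u" x, OF h2per_fun'_periodic]
  show "cmod (h2per_fun u x) \<le> (1 + 2 * pi) * norm u"
    using norm_le_rms_plus_variation[OF h2per_primitive norm_ge_zero le(1) red(2)] red(1) v(1)
    by (simp add: algebra_simps)
  show "cmod (h2per_fun' u x) \<le> (1 + 2 * pi) * norm u"
    using norm_le_rms_plus_variation[OF h2per_primitive' norm_ge_zero le(2) red(4)] red(3) v(2)
    by (simp add: algebra_simps)
qed

lemma h2per_fun_lipschitz: "cmod (h2per_fun u x - h2per_fun u y) \<le> (1 + 2 * pi) * norm u * \<bar>x - y\<bar>"
proof -
  have "cmod (h2per_fun u b - h2per_fun u a) \<le> (1 + 2 * pi) * norm u * (b - a)" if "a \<le> b" for a b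
    using integral_bound[OF that h2per_fun_continuous(2) norm_fun_le_h2per_norm(2)]
      primitiveD(2)[OF h2per_primitive that] by metis
  from this[of x y] this[of y x] show ?thesis
    by (cases "x \<le> y") (auto simp: norm_minus_commute)
qed

section \<open>Solving the linear equation\<close>

lemma primitive_shift:
  assumes "primitive F f"
  shows "primitive (\<lambda>x. F (x + t)) (\<lambda>x. f (x + t))"
proof -
  have "(\<lambda>x. f (x + t)) absolutely_integrable_on {a..b} \<and> integral {a..b} (\<lambda>x. f (x + t)) = F (b + t) - F (a + t)"
    if "a \<le> b" for a b
  proof -
    have "a + t \<le> b + t" using that by simp
    note f = primitiveD[OF assms this]
    have "(f has_integral (F (b + t) - F (a + t))) {a + t..b + t}"
      using f by (simp add: has_integral_iff set_lebesgue_integral_eq_integral(1))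
    then have "((f \<circ> (+) t) has_integral (F (b + t) - F (a + t))) {a..b}"
      by (simp add: has_integral_shift_Icc_real)
    moreover have "((\<lambda>x. norm (f x)) \<circ> (+) t) integrable_on {a..b}"
      using f(1) by (simp add: integrable_on_shift_Icc_real absolutely_integrable_on_def)
    ultimately show ?thesis
      by (auto simp: absolutely_integrable_on_def has_integral_iff o_def add.commute)
  qed
  then show ?thesis by (simp add: primitive_def)
qed

lemma absolutely_integrable_continuous_mult:
  fixes c g :: "real \<Rightarrow> complex"
  assumes "continuous_on {a..b} c" "g absolutely_integrable_on {a..b}"
  shows "(\<lambda>x. c x * g x) absolutely_integrable_on {a..b}"
  using absolutely_integrable_bounded_measurable_product[OF bilinear_times _ _ _ assms(2), of c]
    continuous_imp_measurable_on_sets_lebesgue[OF assms(1)]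
    compact_imp_bounded[OF compact_continuous_image[OF assms(1)]]
  by simp

lemma primitive_exp: "primitive (\<lambda>s. exp (r * complex_of_real s)) (\<lambda>s. r * exp (r * complex_of_real s))"
proof (rule primitive_of_deriv)
  show "((\<lambda>s. exp (r * of_real s)) has_vector_derivative r * exp (r * complex_of_real s)) (at s)" for s
  proof -
    have "((\<lambda>z. exp (r * z)) has_field_derivative r * exp (r * of_real s)) (at (of_real s))"
      by (auto intro!: derivative_eq_intros)
    then show ?thesis by (rule has_vector_derivative_real_field)
  qed
qed (intro continuous_intros)

lemma primitive_0_const:
  assumes "primitive F (\<lambda>x. 0)"
  shows "F x = F (0::real)"
  using primitiveD(2)[OF assms, of 0 x] primitiveD(2)[OF assms, of x 0] by (cases "0 \<le> x") auto

text \<open>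
  Variation of constants. The initial value \<open>a\<close> is chosen such that \<open>v (2 * pi) = v 0\<close>, which is
  possible because \<open>exp (2 * pi * r) \<noteq> 1\<close>; then \<open>\<delta> s = v (s + 2 * pi) - v s\<close> solves the
  homogeneous equation with initial value zero.
\<close>

lemma periodic_first_order_solution:
  fixes g :: "real \<Rightarrow> complex" and r :: complex
  assumes r: "exp (2 * pi * r) \<noteq> 1" and g: "\<And>a b. g absolutely_integrable_on {a..b}"
    and per: "\<And>x. g (x + 2 * pi) = g x"
  obtains v where "primitive v (\<lambda>s. r * v s + g s)" "\<And>s. v (s + 2 * pi) = v s"
proof -
  have "(\<lambda>s. exp (- r * of_real s) * g s) absolutely_integrable_on {a..b}" for a b
    by (intro absolutely_integrable_continuous_mult g continuous_intros)
  then obtain G where G: "primitive G (\<lambda>s. exp (- r * of_real s) * g s)" "G 0 = 0"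
    by (rule primitive_exists)
  define a where "a = exp (2 * pi * r) * G (2 * pi) / (1 - exp (2 * pi * r))"
  define v where "v s = exp (r * of_real s) * (a + G s)" for s
  have ee: "exp (r * of_real s) * exp (- r * of_real s) = 1" for s
    by (simp add: exp_minus)
  have "primitive v (\<lambda>s. r * exp (r * of_real s) * (a + G s) + exp (r * of_real s) * (0 + exp (- r * of_real s) * g s))"
    unfolding v_def by (intro primitive_mult primitive_exp primitive_add primitive_const G)
  moreover have "r * exp (r * of_real s) * (a + G s) + exp (r * of_real s) * (0 + exp (- r * of_real s) * g s) = r * v s + g s" for s
    using ee[of s] by (simp add: v_def mult.assoc[symmetric])
  ultimately have v: "primitive v (\<lambda>s. r * v s + g s)" by simp
  define \<delta> where "\<delta> s = v (s + 2 * pi) + (-1) * v s" for s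
  have "primitive \<delta> (\<lambda>s. (r * v (s + 2 * pi) + g (s + 2 * pi)) + (0 * v s + (-1) * (r * v s + g s)))"
    unfolding \<delta>_def by (intro primitive_add primitive_mult primitive_const v primitive_shift[OF v])
  moreover have "(r * v (s + 2 * pi) + g (s + 2 * pi)) + (0 * v s + (-1) * (r * v s + g s)) = r * \<delta> s" for s
    unfolding \<delta>_def per by (simp add: algebra_simps)
  ultimately have \<delta>: "primitive \<delta> (\<lambda>s. r * \<delta> s)" by (simp only:)
  have "primitive (\<lambda>s. exp (- r * of_real s) * \<delta> s)
      (\<lambda>s. (- r) * exp (- r * of_real s) * \<delta> s + exp (- r * of_real s) * (r * \<delta> s))"
    by (intro primitive_mult primitive_exp \<delta>)
  then have "primitive (\<lambda>s. exp (- r * of_real s) * \<delta> s) (\<lambda>s. 0)" by (simp add: mult_ac)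
  from primitive_0_const[OF this] have "exp (- r * of_real s) * \<delta> s = \<delta> 0" for s by simp
  moreover have "\<delta> 0 = 0"
    using r by (simp add: \<delta>_def v_def G(2) a_def field_simps)
  ultimately have "v (s + 2 * pi) = v s" for s by (simp add: \<delta>_def)
  with v show thesis by (rule that)
qed

text \<open>
  The operator factors as \<open>- d (D - r1) (D - r2)\<close>, where \<open>D\<close> is differentiation and \<open>r1\<close>, \<open>r2\<close> are the
  roots of the characteristic polynomial. No root is purely imaginary: for \<open>r = \<i> y\<close> the
  polynomial has imaginary part \<open>- 1\<close>, coming from the damping. So two first order equations can be
  solved one after the other.
\<close>

lemma LLop_solution_exists:
  assumes d: "d \<noteq> 0" and g: "locally_square_integrable g" and per: "\<And>x. g (x + 2 * pi) = g x"
  shows "\<exists>u. AE s in lebesgue. LLop d \<zeta> \<omega> u s = g s"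
proof -
  \<comment> \<open>The characteristic equation is \<open>r\<^sup>2 - b * r + c = 0\<close>.\<close>
  define b c where "b = \<i> * of_real \<omega> / of_real d" "c = - (of_real \<zeta> - \<i>) / complex_of_real d"
  note bc = b_c_def
  have db: "\<i> * of_real \<omega> = of_real d * b" and dc: "of_real \<zeta> - \<i> = - (of_real d * c)"
    using d by (simp_all add: bc)
  define q where "q = csqrt (b\<^sup>2 - 4 * c)"
  define r1 r2 where "r1 = (b + q) / 2" "r2 = (b - q) / 2"
  have q2: "q * q = b\<^sup>2 - 4 * c" using power2_csqrt[of "b\<^sup>2 - 4 * c"] by (simp add: q_def power2_eq_square)
  have sum: "r1 + r2 = b" by (simp add: r1_r2_def field_simps)
  have prod: "r1 * r2 = c"
    using q2 by (simp add: r1_r2_def field_simps power2_eq_square)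
  have exp: "exp (2 * pi * r) \<noteq> 1" if r: "r = r1 \<or> r = r2" for r :: complex
  proof
    assume "exp (2 * pi * r) = 1"
    then have "Re r = 0" by (simp add: exp_eq_1)
    have "r * r - (r1 + r2) * r + r1 * r2 = 0" using r by (auto simp: algebra_simps)
    then have "r * r - b * r + c = 0" by (simp only: sum prod)
    moreover have "of_real d * r * r - \<i> * of_real \<omega> * r - (of_real \<zeta> - \<i>) = of_real d * (r * r - b * r + c)"
      unfolding db dc by (simp add: algebra_simps)
    ultimately have "of_real d * r * r - \<i> * of_real \<omega> * r - (of_real \<zeta> - \<i>) = 0" by simp
    then have "Im (of_real d * r * r - \<i> * of_real \<omega> * r - (of_real \<zeta> - \<i>)) = 0" by simp
    then show False using \<open>Re r = 0\<close> by simp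
  qed
  define h where "h = (\<lambda>s. (- 1 / d) *\<^sub>R g s)"
  have h: "locally_square_integrable h" unfolding h_def by (intro locally_square_integrable_scaleR g)
  obtain v where v: "primitive v (\<lambda>s. r2 * v s + h s)" "\<And>s. v (s + 2 * pi) = v s"
  proof (rule periodic_first_order_solution[of r2 h, OF exp])
    show "h absolutely_integrable_on {a..b}" for a b by (rule locally_square_integrable_abs_int[OF h])
    show "h (x + 2 * pi) = h x" for x by (simp add: h_def per)
  qed auto
  have cv: "continuous_on S v" for S by (rule primitive_continuous[OF v(1)])
  obtain w where w: "primitive w (\<lambda>s. r1 * w s + v s)" "\<And>s. w (s + 2 * pi) = w s"
    by (rule periodic_first_order_solution[of r1 v, OF exp])
      (auto intro!: absolutely_integrable_continuous_real cv simp: v)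
  have cw: "continuous_on S w" for S by (rule primitive_continuous[OF w(1)])
  let ?F1 = "\<lambda>s. r1 * w s + v s"
  let ?F2 = "\<lambda>s. (0 * w s + r1 * (r1 * w s + v s)) + (r2 * v s + h s)"
  have p2: "primitive ?F1 ?F2"
    by (intro primitive_add primitive_mult primitive_const w v)
  have sq: "locally_square_integrable ?F2"
  proof -
    have "locally_square_integrable (\<lambda>s. (r1 * (r1 * w s + v s) + r2 * v s) + h s)"
      by (intro locally_square_integrable_add h square_integrable_continuous continuous_intros cv cw)
    then show ?thesis by (simp add: add.assoc)
  qed
  obtain u where u: "AE s in lebesgue. rep_h2per u s = w s" "AE s in lebesgue. h2per_deriv 1 u s = ?F1 s"
    "AE s in lebesgue. h2per_deriv 2 u s = ?F2 s"
    by (rule h2per_of_primitives[OF w(1) p2 sq w(2)])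
  have "?F2 s - b * ?F1 s + c * w s = h s" for s
    unfolding sum[symmetric] prod[symmetric] by (simp add: algebra_simps)
  then have alg: "- of_real d * ?F2 s + \<i> * of_real \<omega> * ?F1 s + (of_real \<zeta> - \<i>) * w s = g s" for s
  proof -
    assume *: "\<And>s. ?F2 s - b * ?F1 s + c * w s = h s"
    have "- of_real d * ?F2 s + \<i> * of_real \<omega> * ?F1 s + (of_real \<zeta> - \<i>) * w s = - of_real d * (?F2 s - b * ?F1 s + c * w s)"
      unfolding db dc by (simp add: algebra_simps)
    also have "\<dots> = g s" unfolding * using d by (simp add: h_def scaleR_conv_of_real)
    finally show ?thesis .
  qed
  have "AE s in lebesgue. LLop d \<zeta> \<omega> u s = g s"
    using u rep_h2per_fun[of u] h2per_deriv_fun'[of u]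
  proof eventually_elim
    case (elim s)
    then have "h2per_fun u s = w s" "h2per_fun' u s = ?F1 s" "h2per_deriv 2 u s = ?F2 s" by auto
    then show ?case unfolding LLop_def using alg[of s] by (simp only:)
  qed
  then show ?thesis by blast
qed

lemma LLop_inject:
  assumes "d \<noteq> 0" "AE s in lebesgue. LLop d \<zeta> \<omega> u s = LLop d \<zeta> \<omega> v s"
  shows "u = v"
proof -
  obtain K where K: "\<And>u. (norm u)\<^sup>2 \<le> K * L2sq (LLop d \<zeta> \<omega> u)"
    using elliptic_estimate[OF assms(1), of \<zeta> \<omega>] by blast
  have "AE s in lebesgue. (cmod (LLop d \<zeta> \<omega> (u - v) s))\<^sup>2 = 0"
    using assms(2) LLop_diff[of d \<zeta> \<omega> u v] by eventually_elim simp
  from integral_AE_cong[OF this] K[of "u - v"] show ?thesis by simp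
qed

section \<open>The periodic extension of the pump\<close>

lemma periodic_ext_periodic: "periodic_ext f (x + 2 * pi) = periodic_ext f x"
proof -
  have "(x + 2 * pi) / (2 * pi) = x / (2 * pi) + 1" by (simp add: add_divide_distrib)
  then have "\<lfloor>(x + 2 * pi) / (2 * pi)\<rfloor> = \<lfloor>x / (2 * pi)\<rfloor> + 1" by simp
  then show ?thesis by (simp add: periodic_ext_def algebra_simps)
qed

lemma square_integrable_shift:
  assumes "square_integrable UNIV f"
  shows "square_integrable UNIV (\<lambda>x. f (x - t))"
proof -
  have "(\<lambda>x. - t + 1 * x) \<in> lebesgue \<rightarrow>\<^sub>M (lebesgue :: real measure)"
    using lebesgue_affine_measurable[where c = "\<lambda>x::real. 1" and t = "- t"] by simp
  moreover have "f \<in> borel_measurable lebesgue" using assms(1) by (simp add: square_integrable_iff)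
  ultimately have "(\<lambda>x. f (- t + 1 * x)) \<in> borel_measurable lebesgue" by (rule measurable_compose)
  moreover have "integrable lebesgue (\<lambda>x. (cmod (f (- t + 1 * x)))\<^sup>2)"
    using lebesgue_integrable_real_affine_iff[of 1 "\<lambda>x. (cmod (f x))\<^sup>2" "- t"] assms
    by (simp add: square_integrable_iff)
  ultimately show ?thesis by (simp add: square_integrable_iff)
qed

lemma square_integrable_sum:
  assumes "finite A" "\<And>k. k \<in> A \<Longrightarrow> square_integrable S (f k)"
  shows "square_integrable S (\<lambda>x. \<Sum>k\<in>A. f k x)"
  using assms
proof (induction A)
  case empty
  then show ?case by (simp add: square_integrable_iff)
next
  case (insert k A)
  then show ?case by (simp add: square_integrable_add)
qed

lemma square_integrable_subset:
  assumes "square_integrable UNIV f" "K \<in> sets lebesgue"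
  shows "square_integrable K f"
proof -
  have "(\<lambda>x. indicat_real K x *\<^sub>R f x) \<in> borel_measurable lebesgue"
    using assms by (intro borel_measurable_scaleR borel_measurable_indicator) (auto simp: square_integrable_iff)
  moreover have "integrable lebesgue (\<lambda>x. indicat_real K x *\<^sub>R (cmod (f x))\<^sup>2)"
    using assms by (intro integrable_mult_indicator) (auto simp: square_integrable_iff)
  ultimately show ?thesis
    by (simp add: square_integrable_def set_borel_measurable_def set_integrable_def)
qed

lemma square_integrable_indicator:
  "square_integrable K (\<lambda>x. indicat_real K x *\<^sub>R f x) \<longleftrightarrow> square_integrable K f"
proof -
  have "(\<lambda>x. indicat_real K x *\<^sub>R (indicat_real K x *\<^sub>R f x)) = (\<lambda>x. indicat_real K x *\<^sub>R f x)"
    by (auto simp: indicator_def)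
  then show ?thesis by (simp only: square_integrable_iff fun_eq_iff)
qed

text \<open>
  Off the multiples of the period, the extension is locally a finite sum of translates of \<open>e\<close>.
\<close>

lemma square_integrable_periodic_ext:
  assumes e: "square_integrable {0<..<2 * pi} e"
  shows "locally_square_integrable (periodic_ext e)"
  unfolding locally_square_integrable_def
proof (intro allI impI)
  fix K :: "real set" assume K: "compact K"
  \<comment> \<open>The values of \<open>e\<close> outside the open interval are arbitrary and must be cut off before translating.\<close>
  define h where "h x = indicat_real {0<..<2 * pi} x *\<^sub>R e x" for x
  have h: "square_integrable UNIV h"
    using e by (simp add: square_integrable_iff h_def[abs_def])
  define Z where "Z = range (\<lambda>k::int. 2 * pi * of_int k)"
  have Z: "Z \<in> null_sets lebesgue"
    unfolding Z_def by (intro null_sets_completionI countable_imp_null_set_lborel) simp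
  have hk: "h (x - 2 * pi * of_int k) = (if k = \<lfloor>x / (2 * pi)\<rfloor> then periodic_ext e x else 0)"
    if "x \<notin> Z" for x k
  proof (cases "k = \<lfloor>x / (2 * pi)\<rfloor>")
    case True
    have "x - 2 * pi * of_int \<lfloor>x / (2 * pi)\<rfloor> \<noteq> 0" using that by (auto simp: Z_def)
    moreover have "x - 2 * pi * of_int \<lfloor>x / (2 * pi)\<rfloor> \<in> {0..<2 * pi}"
    proof -
      define n :: real where "n = of_int \<lfloor>x / (2 * pi)\<rfloor>"
      have "n \<le> x / (2 * pi)" "x / (2 * pi) < n + 1" unfolding n_def by linarith+
      then have "n * (2 * pi) \<le> x" "x < (n + 1) * (2 * pi)"
        by (simp_all add: pos_le_divide_eq pos_divide_less_eq)
      then show ?thesis unfolding n_def[symmetric] by (simp add: algebra_simps)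
    qed
    ultimately show ?thesis using True by (simp add: h_def periodic_ext_def indicator_def)
  next
    case False
    have "x - 2 * pi * of_int k \<notin> {0<..<2 * pi}"
    proof
      assume "x - 2 * pi * of_int k \<in> {0<..<2 * pi}"
      then have "of_int k \<le> x / (2 * pi)" "x / (2 * pi) < of_int k + 1"
        by (simp_all add: pos_le_divide_eq pos_divide_less_eq algebra_simps)
      then have "\<lfloor>x / (2 * pi)\<rfloor> = k" by (rule floor_unique)
      with False show False by simp
    qed
    then show ?thesis using False by (simp add: h_def)
  qed
  obtain n :: nat where n: "\<And>x. x \<in> K \<Longrightarrow> \<bar>x / (2 * pi)\<bar> \<le> real n"
  proof -
    obtain r where "\<And>x. x \<in> K \<Longrightarrow> \<bar>x\<bar> \<le> r" using compact_imp_bounded[OF K] by (auto simp: bounded_iff)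
    then have r: "\<bar>x / (2 * pi)\<bar> \<le> r / (2 * pi)" if "x \<in> K" for x
      using that by (simp add: divide_right_mono)
    obtain n :: nat where "r / (2 * pi) \<le> real n" using real_arch_simple by blast
    with r show ?thesis by (intro that[of n]) (meson order_trans)
  qed
  define A where "A = {- int n..int n}"
  have "square_integrable UNIV (\<lambda>x. \<Sum>k\<in>A. h (x - 2 * pi * of_int k))"
    by (intro square_integrable_sum square_integrable_shift h) (auto simp: A_def)
  then have "square_integrable K (\<lambda>x. \<Sum>k\<in>A. h (x - 2 * pi * of_int k))"
    by (rule square_integrable_subset) (intro fmeasurableD lmeasurable_compact K)
  then have "square_integrable K (\<lambda>x. indicat_real K x *\<^sub>R (\<Sum>k\<in>A. h (x - 2 * pi * of_int k)))"
    by (simp only: square_integrable_indicator)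
  moreover have "AE x in lebesgue. indicat_real K x *\<^sub>R (\<Sum>k\<in>A. h (x - 2 * pi * of_int k)) =
      indicat_real K x *\<^sub>R periodic_ext e x"
  proof (rule AE_I')
    show "Z \<in> null_sets lebesgue" by (rule Z)
    have "indicat_real K x *\<^sub>R (\<Sum>k\<in>A. h (x - 2 * pi * of_int k)) = indicat_real K x *\<^sub>R periodic_ext e x"
      if "x \<notin> Z" for x
    proof (cases "x \<in> K")
      case True
      define y where "y = x / (2 * pi)"
      have "- real n \<le> y" "y \<le> real n" using n[OF True] unfolding y_def by linarith+
      then have "\<lfloor>x / (2 * pi)\<rfloor> \<in> A" unfolding A_def y_def[symmetric] by (simp add: le_floor_iff floor_le_iff)
      moreover have "finite A" by (simp add: A_def)
      ultimately show ?thesis using hk[OF that] by (simp add: sum.delta')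
    qed simp
    then show "{x \<in> space lebesgue. indicat_real K x *\<^sub>R (\<Sum>k\<in>A. h (x - 2 * pi * of_int k)) \<noteq>
      indicat_real K x *\<^sub>R periodic_ext e x} \<subseteq> Z" by blast
  qed
  ultimately have "square_integrable K (\<lambda>x. indicat_real K x *\<^sub>R periodic_ext e x)"
    by (rule square_integrable_AE_cong)
  then show "square_integrable K (periodic_ext e)" by (simp only: square_integrable_indicator)
qed

lemma locally_square_integrable_mult:
  assumes "locally_square_integrable f"
  shows "locally_square_integrable (\<lambda>x. c * f x)"
  unfolding locally_square_integrable_def
proof (intro allI impI)
  fix K :: "real set" assume "compact K"
  then have sq: "square_integrable K f" using assms by (simp add: locally_square_integrable_def)
  then have "(\<lambda>x. c * (indicat_real K x *\<^sub>R f x)) \<in> borel_measurable lebesgue"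
    by (intro borel_measurable_times borel_measurable_const) (simp add: square_integrable_iff)
  moreover have "integrable lebesgue (\<lambda>x. (cmod c)\<^sup>2 * (cmod (indicat_real K x *\<^sub>R f x))\<^sup>2)"
    using sq by (intro integrable_mult_right) (simp only: square_integrable_iff)
  ultimately show "square_integrable K (\<lambda>x. c * f x)"
    by (simp add: square_integrable_iff norm_mult power_mult_distrib mult_ac)
qed

section \<open>The fixed point operator\<close>

text \<open>
  With \<open>\<bar>z\<bar>\<^sup>2 = z * cnj z\<close> the difference is
  \<open>z\<^sup>2 * cnj (z - w) + (z - w) * (z + w) * cnj w\<close>, whose coefficients are at most \<open>B\<^sup>2\<close> and \<open>2 * B\<^sup>2\<close>.
\<close>

lemma cubic_lipschitz:
  assumes "cmod z \<le> B" "cmod w \<le> B"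
  shows "cmod (of_real ((cmod z)\<^sup>2) * z - of_real ((cmod w)\<^sup>2) * w) \<le> 3 * B\<^sup>2 * cmod (z - w)"
proof -
  have "0 \<le> B" using assms(1) norm_ge_zero order_trans by blast
  have eq: "of_real ((cmod z)\<^sup>2) * z - of_real ((cmod w)\<^sup>2) * w = z * z * cnj (z - w) + (z - w) * (z + w) * cnj w"
    unfolding complex_norm_square by (simp add: algebra_simps)
  have "cmod (z * z * cnj (z - w)) = (cmod z * cmod z) * cmod (z - w)"
    by (simp only: norm_mult complex_mod_cnj)
  also have "\<dots> \<le> (B * B) * cmod (z - w)"
    using assms \<open>0 \<le> B\<close> by (intro mult_right_mono mult_mono) auto
  finally have 1: "cmod (z * z * cnj (z - w)) \<le> (B * B) * cmod (z - w)" .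
  have "cmod ((z - w) * (z + w) * cnj w) = (cmod (z + w) * cmod w) * cmod (z - w)"
    by (simp only: norm_mult complex_mod_cnj mult_ac)
  also have "\<dots> \<le> ((B + B) * B) * cmod (z - w)"
    using assms \<open>0 \<le> B\<close> by (intro mult_right_mono mult_mono norm_triangle_mono) auto
  finally have 2: "cmod ((z - w) * (z + w) * cnj w) \<le> ((B + B) * B) * cmod (z - w)" .
  show ?thesis
    unfolding eq using 1 2 norm_triangle_ineq[of "z * z * cnj (z - w)" "(z - w) * (z + w) * cnj w"]
    by (simp add: power2_eq_square algebra_simps)
qed

text \<open>
  The limits may lie outside \<open>S\<close>: this is the form in which a map is seen to be compact on bounded
  sets.
\<close>

lemma compact_closure_of_sequences:
  fixes S :: "'a::metric_space set"
  assumes "\<And>x::nat \<Rightarrow> 'a. (\<And>n. x n \<in> S) \<Longrightarrow> \<exists>l r. strict_mono r \<and> (\<lambda>n. x (r n)) \<longlonglongrightarrow> l"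
  shows "compact (closure S)"
  unfolding compact_eq_seq_compact_metric seq_compact_def
proof (intro allI impI)
  fix y :: "nat \<Rightarrow> 'a" assume y: "\<forall>n. y n \<in> closure S"
  have "\<exists>x\<in>S. dist x (y n) < inverse (Suc n)" for n
    using y by (simp add: closure_approachable)
  then obtain x where x: "\<And>n. x n \<in> S" "\<And>n. dist (x n) (y n) < inverse (Suc n)" by metis
  obtain l r where lr: "strict_mono (r :: nat \<Rightarrow> nat)" "(\<lambda>n. x (r n)) \<longlonglongrightarrow> l"
    using assms[of x, OF x(1)] by blast
  have D: "(\<lambda>n. dist (x n) (y n)) \<longlonglongrightarrow> 0"
    by (rule Lim_null_comparison[OF _ LIMSEQ_inverse_real_of_nat])
      (use x(2) in \<open>auto intro: less_imp_le always_eventually\<close>)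
  have "(\<lambda>n. dist (x (r n)) (y (r n)) + dist (x (r n)) l) \<longlonglongrightarrow> 0 + 0"
  proof (rule tendsto_add)
    show "(\<lambda>n. dist (x (r n)) (y (r n))) \<longlonglongrightarrow> 0"
      using LIMSEQ_subseq_LIMSEQ[OF D lr(1)] by (simp add: o_def)
    show "(\<lambda>n. dist (x (r n)) l) \<longlonglongrightarrow> 0" using lr(2) by (rule iffD1[OF tendsto_dist_iff])
  qed
  then have S: "(\<lambda>n. dist (x (r n)) (y (r n)) + dist (x (r n)) l) \<longlonglongrightarrow> 0" by simp
  have "(\<lambda>n. dist (y (r n)) l) \<longlonglongrightarrow> 0"
    by (rule Lim_null_comparison[OF _ S]) (simp add: dist_triangle3 always_eventually)
  then have yl: "(y \<circ> r) \<longlonglongrightarrow> l" unfolding o_def by (rule iffD2[OF tendsto_dist_iff])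
  then have "l \<in> closure S"
    using closed_sequentially[OF closed_closure, of "y \<circ> r" S l] y by simp
  then show "\<exists>l\<in>closure S. \<exists>r. strict_mono r \<and> (y \<circ> r) \<longlonglongrightarrow> l"
    using lr(1) yl by blast
qed

lemma tendsto_norm_sq_0:
  fixes f :: "nat \<Rightarrow> 'a::real_normed_vector"
  assumes "\<And>\<epsilon>. 0 < \<epsilon> \<Longrightarrow> eventually (\<lambda>n. (norm (f n))\<^sup>2 \<le> \<epsilon>) sequentially"
  shows "f \<longlonglongrightarrow> 0"
proof (rule tendstoI)
  fix r :: real assume "0 < r"
  then have "eventually (\<lambda>n. (norm (f n))\<^sup>2 \<le> (r/2)\<^sup>2) sequentially" by (intro assms) simp
  then show "eventually (\<lambda>n. dist (f n) 0 < r) sequentially"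
  proof eventually_elim
    case (elim n)
    then have "norm (f n) \<le> r/2" using \<open>0 < r\<close> by (simp add: power2_le_iff_abs_le)
    then show ?case using \<open>0 < r\<close> by simp
  qed
qed

locale pumped_LLE =
  fixes d \<zeta> \<omega> f0 :: real and e :: "real \<Rightarrow> complex"
  assumes d: "d \<noteq> 0" and e: "square_integrable {0<..<2 * pi} e"
begin

abbreviation L :: "h2per \<Rightarrow> real \<Rightarrow> complex" where "L \<equiv> LLop d \<zeta> \<omega>"

definition forcing :: "real \<Rightarrow> real \<Rightarrow> complex" where
  "forcing l s = of_real f0 + of_real l * periodic_ext e s"

definition rhs :: "real \<Rightarrow> (real \<Rightarrow> complex) \<Rightarrow> real \<Rightarrow> complex" where
  "rhs l F s = of_real ((cmod (F s))\<^sup>2) * F s - \<i> * forcing l s"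

text \<open>
  The nonlinearity is evaluated at a function instead of an element of the Sobolev space, so that \<open>\<Phi>\<close>
  also applies to uniform limits of such elements.
\<close>

definition \<Phi> :: "real \<Rightarrow> (real \<Rightarrow> complex) \<Rightarrow> h2per" where
  "\<Phi> l F = (SOME v. AE s in lebesgue. L v s = rhs l F s)"

definition T :: "real \<Rightarrow> h2per \<Rightarrow> h2per" where
  "T l u = \<Phi> l (h2per_fun u)"

lemma square_integrable_forcing: "locally_square_integrable (forcing l)"
proof -
  have "locally_square_integrable (\<lambda>s. of_real f0 + l *\<^sub>R periodic_ext e s)"
    by (intro locally_square_integrable_add locally_square_integrable_scaleR square_integrable_periodic_ext e
        square_integrable_continuous continuous_intros)
  then show ?thesis by (simp add: forcing_def[abs_def] scaleR_conv_of_real)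
qed

lemma \<Phi>:
  assumes F: "continuous_on UNIV F" "\<And>s. F (s + 2 * pi) = F s"
  shows "AE s in lebesgue. L (\<Phi> l F) s = rhs l F s"
proof -
  have "locally_square_integrable (\<lambda>s. of_real ((cmod (F s))\<^sup>2) * F s + (- \<i>) * forcing l s)"
    by (intro locally_square_integrable_add locally_square_integrable_mult square_integrable_forcing
        square_integrable_continuous continuous_intros F)
  also have "(\<lambda>s. of_real ((cmod (F s))\<^sup>2) * F s + (- \<i>) * forcing l s) = rhs l F"
    by (auto simp: rhs_def)
  finally have "locally_square_integrable (rhs l F)" .
  then have "\<exists>v. AE s in lebesgue. L v s = rhs l F s"
    by (rule LLop_solution_exists[OF d]) (simp add: rhs_def forcing_def F periodic_ext_periodic)
  then show ?thesis unfolding \<Phi>_def by (rule someI_ex)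
qed

lemma L_T: "AE s in lebesgue. L (T l u) s = rhs l (h2per_fun u) s"
  unfolding T_def by (intro \<Phi> h2per_fun_continuous h2per_fun_periodic)

lemma T_eq_iff: "T l u = v \<longleftrightarrow> (AE s in lebesgue. L v s = rhs l (h2per_fun u) s)"
proof
  assume "AE s in lebesgue. L v s = rhs l (h2per_fun u) s"
  with L_T[of l u] have "AE s in lebesgue. L (T l u) s = L v s" by eventually_elim simp
  then show "T l u = v" by (rule LLop_inject[OF d])
qed (use L_T in blast)

lemma LLE_solution_iff: "LLE_solution d \<zeta> \<omega> f0 e l u \<longleftrightarrow> T l u = u"
proof -
  have "AE s in lebesgue. (- complex_of_real d * h2per_deriv 2 u s + \<i> * complex_of_real \<omega> * h2per_deriv 1 u s
        + (complex_of_real \<zeta> - \<i>) * rep_h2per u s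
        - complex_of_real ((cmod (rep_h2per u s))\<^sup>2) * rep_h2per u s
        + \<i> * complex_of_real f0 + \<i> * complex_of_real l * periodic_ext e s = 0) \<longleftrightarrow> L u s = rhs l (h2per_fun u) s"
    using rep_h2per_fun[of u] h2per_deriv_fun'[of u]
  proof eventually_elim
    case (elim s)
    show ?case unfolding elim LLop_def rhs_def forcing_def by (auto simp: algebra_simps add_eq_0_iff2)
  qed
  then have "(AE s in lebesgue. (- complex_of_real d * h2per_deriv 2 u s + \<i> * complex_of_real \<omega> * h2per_deriv 1 u s
        + (complex_of_real \<zeta> - \<i>) * rep_h2per u s
        - complex_of_real ((cmod (rep_h2per u s))\<^sup>2) * rep_h2per u s
        + \<i> * complex_of_real f0 + \<i> * complex_of_real l * periodic_ext e s = 0)) \<longleftrightarrow> (AE s in lebesgue. L u s = rhs l (h2per_fun u) s)"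
    by (rule eventually_subst)
  then show ?thesis unfolding LLE_solution_def T_eq_iff .
qed

lemma periodic_ext_sq_int: "(\<lambda>s. (cmod (periodic_ext e s))\<^sup>2) integrable_on {a..b}"
  by (intro locally_square_integrable_sq square_integrable_periodic_ext e)

text \<open>
  Continuity of \<open>T\<close> in the topology of uniform convergence of the continuous representatives. It is stated for
  arbitrary periodic functions \<open>F n\<close>, \<open>G\<close>, as the limit function obtained from the Arzela--Ascoli theorem need not
  lie in \<open>H\<^sup>2\<close>.
\<close>

lemma \<Phi>_tendsto:
  assumes F: "\<And>n. continuous_on UNIV (F n)" "\<And>n s. F n (s + 2 * pi) = F n s" "\<And>n s. cmod (F n s) \<le> B"
    and G: "continuous_on UNIV G" "\<And>s. G (s + 2 * pi) = G s" "\<And>s. cmod (G s) \<le> B"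
    and lim: "uniform_limit period F G sequentially" "l \<longlonglongrightarrow> m"
  shows "(\<lambda>n. \<Phi> (l n) (F n)) \<longlonglongrightarrow> \<Phi> m G"
proof -
  define E where "E = L2sq (periodic_ext e)"
  obtain K where K: "K \<ge> 0" "\<And>u. (norm u)\<^sup>2 \<le> K * L2sq (L u)"
    using elliptic_estimate[OF d, of \<zeta> \<omega>] by blast
  have bound: "(norm (\<Phi> (l n) (F n) - \<Phi> m G))\<^sup>2 \<le> K * (4 * pi * (3 * B\<^sup>2 * \<delta>)\<^sup>2 + 2 * (l n - m)\<^sup>2 * E)"
    if \<delta>: "\<And>s. s \<in> period \<Longrightarrow> cmod (F n s - G s) \<le> \<delta>" for n \<delta>
  proof -
    have "AE s in lebesgue. (cmod (L (\<Phi> (l n) (F n) - \<Phi> m G) s))\<^sup>2 = (cmod (rhs (l n) (F n) s - rhs m G s))\<^sup>2"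
      using \<Phi>[OF F(1,2), of "l n" n] \<Phi>[OF G(1,2), of m] LLop_diff[of d \<zeta> \<omega> "\<Phi> (l n) (F n)" "\<Phi> m G"]
      by eventually_elim simp
    note eq = integral_AE_cong[OF this]
    have "integral period (\<lambda>s. (cmod (L (\<Phi> (l n) (F n) - \<Phi> m G) s))\<^sup>2) = integral period (\<lambda>s. (cmod (rhs (l n) (F n) s - rhs m G s))\<^sup>2)"
      by (rule eq)
    also have "\<dots> \<le> integral period (\<lambda>s. 2 * (3 * B\<^sup>2 * \<delta>)\<^sup>2 + 2 * (l n - m)\<^sup>2 * (cmod (periodic_ext e s))\<^sup>2)"
    proof (rule integral_le)
      have "(\<lambda>s. (cmod (L (\<Phi> (l n) (F n) - \<Phi> m G) s))\<^sup>2) absolutely_integrable_on period"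
        using square_integrable_LLop[of d \<zeta> \<omega> "\<Phi> (l n) (F n) - \<Phi> m G"]
        by (simp add: locally_square_integrable_def square_integrable_def)
      from absolutely_integrable_AE_cong[OF this \<open>AE s in lebesgue. _ = _\<close>]
      show "(\<lambda>s. (cmod (rhs (l n) (F n) s - rhs m G s))\<^sup>2) integrable_on period"
        by (rule set_lebesgue_integral_eq_integral(1))
      show "(\<lambda>s. 2 * (3 * B\<^sup>2 * \<delta>)\<^sup>2 + 2 * (l n - m)\<^sup>2 * (cmod (periodic_ext e s))\<^sup>2) integrable_on period"
        by (intro integrable_add integrable_const_ivl integrable_on_mult_right periodic_ext_sq_int)
      fix s assume s: "s \<in> period"
      define x y where "x = cmod (of_real ((cmod (F n s))\<^sup>2) * F n s - of_real ((cmod (G s))\<^sup>2) * G s)"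
        "y = \<bar>l n - m\<bar> * cmod (periodic_ext e s)"
      have "x \<le> 3 * B\<^sup>2 * cmod (F n s - G s)" unfolding x_y_def by (rule cubic_lipschitz) (rule F G)+
      also have "\<dots> \<le> 3 * B\<^sup>2 * \<delta>" by (intro mult_left_mono \<delta> s) simp
      finally have x: "x \<le> 3 * B\<^sup>2 * \<delta>" .
      have "rhs (l n) (F n) s - rhs m G s = (of_real ((cmod (F n s))\<^sup>2) * F n s - of_real ((cmod (G s))\<^sup>2) * G s) -
          \<i> * (of_real (l n - m) * periodic_ext e s)"
        by (simp add: rhs_def forcing_def algebra_simps)
      then have "cmod (rhs (l n) (F n) s - rhs m G s) \<le> x + y"
        using norm_triangle_ineq4[of "of_real ((cmod (F n s))\<^sup>2) * F n s - of_real ((cmod (G s))\<^sup>2) * G s"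
          "\<i> * (of_real (l n - m) * periodic_ext e s)"]
        by (simp only: norm_mult norm_of_real norm_ii x_y_def mult_1)
      then have "(cmod (rhs (l n) (F n) s - rhs m G s))\<^sup>2 \<le> (x + y)\<^sup>2" by (intro power_mono) auto
      also have "\<dots> \<le> 2 * x\<^sup>2 + 2 * y\<^sup>2" using zero_le_power2[of "x - y"] by (simp add: power2_eq_square algebra_simps)
      also have "\<dots> \<le> 2 * (3 * B\<^sup>2 * \<delta>)\<^sup>2 + 2 * y\<^sup>2"
        using x by (intro add_right_mono mult_left_mono power_mono) (auto simp: x_y_def)
      finally show "(cmod (rhs (l n) (F n) s - rhs m G s))\<^sup>2 \<le> 2 * (3 * B\<^sup>2 * \<delta>)\<^sup>2 + 2 * (l n - m)\<^sup>2 * (cmod (periodic_ext e s))\<^sup>2"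
        by (simp add: x_y_def power_mult_distrib)
    qed
    also have "\<dots> = 4 * pi * (3 * B\<^sup>2 * \<delta>)\<^sup>2 + 2 * (l n - m)\<^sup>2 * E"
      using periodic_ext_sq_int[of 0 "2*pi"]
      by (subst integral_add) (auto intro!: integrable_on_mult_right simp: E_def)
    finally show ?thesis using K(2)[of "\<Phi> (l n) (F n) - \<Phi> m G"] K(1) by (meson mult_left_mono order_trans)
  qed
  have "(\<lambda>n. \<Phi> (l n) (F n) - \<Phi> m G) \<longlonglongrightarrow> 0"
  proof (rule tendsto_norm_sq_0)
    fix \<epsilon> :: real assume "0 < \<epsilon>"
    have "((\<lambda>x. K * (4 * pi * (3 * B\<^sup>2 * x)\<^sup>2)) \<longlongrightarrow> K * (4 * pi * (3 * B\<^sup>2 * 0)\<^sup>2)) (at_right 0)"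
      by (intro tendsto_intros)
    then have "eventually (\<lambda>x. K * (4 * pi * (3 * B\<^sup>2 * x)\<^sup>2) < \<epsilon>/2) (at_right 0)"
      using \<open>0 < \<epsilon>\<close> by (auto dest!: order_tendstoD(2)[where a = "\<epsilon>/2"])
    moreover have "eventually (\<lambda>x::real. 0 < x) (at_right 0)" by (simp add: eventually_at_right_less)
    ultimately have "eventually (\<lambda>x. 0 < x \<and> K * (4 * pi * (3 * B\<^sup>2 * x)\<^sup>2) < \<epsilon>/2) (at_right 0)"
      by eventually_elim simp
    then obtain \<delta> where \<delta>: "0 < \<delta>" "K * (4 * pi * (3 * B\<^sup>2 * \<delta>)\<^sup>2) < \<epsilon>/2"
      using eventually_happens[of _ "at_right (0::real)"] by (auto simp: trivial_limit_at_right_real)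
    have "(\<lambda>n. K * (2 * (l n - m)\<^sup>2 * E)) \<longlonglongrightarrow> K * (2 * (m - m)\<^sup>2 * E)"
      by (intro tendsto_intros lim)
    then have "eventually (\<lambda>n. K * (2 * (l n - m)\<^sup>2 * E) < \<epsilon>/2) sequentially"
      using \<open>0 < \<epsilon>\<close> by (auto dest!: order_tendstoD(2)[where a = "\<epsilon>/2"])
    moreover have "eventually (\<lambda>n. \<forall>s\<in>period. dist (F n s) (G s) < \<delta>) sequentially"
      using uniform_limitD[OF lim(1) \<delta>(1)] .
    ultimately show "eventually (\<lambda>n. (norm (\<Phi> (l n) (F n) - \<Phi> m G))\<^sup>2 \<le> \<epsilon>) sequentially"
    proof eventually_elim
      case (elim n)
      have "(norm (\<Phi> (l n) (F n) - \<Phi> m G))\<^sup>2 \<le> K * (4 * pi * (3 * B\<^sup>2 * \<delta>)\<^sup>2 + 2 * (l n - m)\<^sup>2 * E)"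
        using elim(2) by (intro bound) (auto simp: dist_norm intro: less_imp_le)
      then show ?case using elim(1) \<delta>(2) by (simp add: distrib_left)
    qed
  qed
  then show ?thesis by (simp add: LIM_zero_iff)
qed

lemma T_continuous: "continuous_on S (\<lambda>(l, u). T l u)"
proof -
  have *: "(\<lambda>n. T (l n) (u n)) \<longlonglongrightarrow> T m v" if lim: "l \<longlonglongrightarrow> m" "u \<longlonglongrightarrow> v" for l u m v
  proof -
    obtain R where R: "\<And>n. norm (u n) \<le> R" "0 < R"
      using convergent_imp_Bseq[OF convergentI[OF lim(2)]] by (auto simp: Bseq_def)
    have "norm v \<le> R" by (rule LIMSEQ_le_const2[OF tendsto_norm[OF lim(2)]]) (use R in auto)
    have B: "cmod (h2per_fun w s) \<le> (1 + 2 * pi) * R" if "norm w \<le> R" for w s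
      using norm_fun_le_h2per_norm(1)[of w s] that
      by (meson add_nonneg_nonneg mult_left_mono order_trans pi_ge_zero zero_le_mult_iff zero_le_numeral zero_le_one)
    show ?thesis
      unfolding T_def
    proof (rule \<Phi>_tendsto[where B = "(1 + 2 * pi) * R"])
      show "uniform_limit period (\<lambda>n. h2per_fun (u n)) (h2per_fun v) sequentially"
      proof (rule uniform_limitI)
        fix \<epsilon> :: real assume "0 < \<epsilon>"
        have "(\<lambda>n. (1 + 2 * pi) * norm (u n - v)) \<longlonglongrightarrow> (1 + 2 * pi) * norm (v - v)"
          by (intro tendsto_intros lim)
        then have "eventually (\<lambda>n. (1 + 2 * pi) * norm (u n - v) < \<epsilon>) sequentially"
          using \<open>0 < \<epsilon>\<close> by (auto dest!: order_tendstoD(2)[where a = \<epsilon>])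
        then show "eventually (\<lambda>n. \<forall>s\<in>period. dist (h2per_fun (u n) s) (h2per_fun v s) < \<epsilon>) sequentially"
        proof eventually_elim
          case (elim n)
          then show ?case
            using norm_fun_le_h2per_norm(1)[of "u n - v"] by (auto simp: dist_norm h2per_fun_diff intro: le_less_trans)
        qed
      qed
    qed (use lim R \<open>norm v \<le> R\<close> in \<open>auto intro!: h2per_fun_continuous h2per_fun_periodic B\<close>)
  qed
  then show ?thesis
    unfolding continuous_on_sequentially
  proof (intro allI ballI impI)
    fix x :: "nat \<Rightarrow> real \<times> h2per" and a assume "(\<forall>n. x n \<in> S) \<and> x \<longlonglongrightarrow> a"
    then have "(\<lambda>n. fst (x n)) \<longlonglongrightarrow> fst a" "(\<lambda>n. snd (x n)) \<longlonglongrightarrow> snd a"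
      by (auto intro: tendsto_fst tendsto_snd)
    from * [OF this] show "((\<lambda>(l, u). T l u) \<circ> x) \<longlonglongrightarrow> (case a of (l, u) \<Rightarrow> T l u)"
      by (simp add: o_def case_prod_unfold)
  qed
qed

text \<open>
  A ball of \<open>H\<^sup>2\<close> is uniformly bounded and uniformly Lipschitz, so the Arzela--Ascoli theorem gives a
  uniformly convergent subsequence, first on one period and then, by periodicity, everywhere.
\<close>

lemma T_compact: "\<exists>K. compact K \<and> (\<forall>l\<in>{0..M}. \<forall>u. norm u \<le> R \<longrightarrow> T l u \<in> K)"
proof -
  define S where "S = {T l u | l u. l \<in> {0..M} \<and> norm u \<le> R}"
  have "compact (closure S)"
  proof (rule compact_closure_of_sequences)
    fix x :: "nat \<Rightarrow> h2per" assume "\<And>n. x n \<in> S"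
    then have "\<exists>l u. x n = T l u \<and> l \<in> {0..M} \<and> norm u \<le> R" for n by (auto simp: S_def)
    then obtain l u where x: "\<And>n. x n = T (l n) (u n)" "\<And>n. l n \<in> {0..M}" "\<And>n. norm (u n) \<le> R" by metis
    define B where "B = (1 + 2 * pi) * R"
    have B: "cmod (h2per_fun (u n) s) \<le> B" for n s
      using norm_fun_le_h2per_norm(1)[of "u n" s] x(3)[of n] unfolding B_def
      by (meson add_nonneg_nonneg mult_left_mono order_trans pi_ge_zero zero_le_mult_iff zero_le_numeral zero_le_one)
    have "0 \<le> B" using B[of 0 0] norm_ge_zero order_trans by blast
    have lip: "cmod (h2per_fun (u n) s - h2per_fun (u n) t) \<le> B * \<bar>s - t\<bar>" for n s t
      using h2per_fun_lipschitz[of "u n" s t] x(3)[of n] unfolding B_def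
      by (meson abs_ge_zero add_nonneg_nonneg mult_left_mono mult_right_mono order_trans pi_ge_zero zero_le_mult_iff zero_le_numeral zero_le_one)
    obtain g k where g: "continuous_on period g" "strict_mono (k :: nat \<Rightarrow> nat)"
      "\<And>\<epsilon>. 0 < \<epsilon> \<Longrightarrow> \<exists>N. \<forall>n x. n \<ge> N \<and> x \<in> period \<longrightarrow> norm (h2per_fun (u (k n)) x - g x) < \<epsilon>"
    proof (rule Arzela_Ascoli[of period "\<lambda>n. h2per_fun (u n)" B])
      fix s \<epsilon> :: real assume "0 < \<epsilon>"
      have "B * \<bar>s - t\<bar> < \<epsilon>" if "norm (s - t) < \<epsilon> / (B + 1)" for t
      proof -
        have "\<bar>s - t\<bar> * (B + 1) < \<epsilon>" using that \<open>0 \<le> B\<close> by (simp add: pos_less_divide_eq)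
        moreover have "B * \<bar>s - t\<bar> \<le> \<bar>s - t\<bar> * (B + 1)" by (simp add: algebra_simps)
        ultimately show ?thesis by linarith
      qed
      then show "\<exists>\<delta>>0. \<forall>n t. t \<in> period \<and> norm (s - t) < \<delta> \<longrightarrow> norm (h2per_fun (u n) s - h2per_fun (u n) t) < \<epsilon>"
        using \<open>0 < \<epsilon>\<close> \<open>0 \<le> B\<close> le_less_trans[OF lip]
        by (intro exI[of _ "\<epsilon> / (B + 1)"]) (metis add_nonneg_pos divide_pos_pos zero_less_one)
    qed (use B in auto)
    \<comment> \<open>The limit is only defined on one period and has to be continued periodically.\<close>
    define G where "G = periodic_ext g"
    have red: "h2per_fun (u n) s - G s = h2per_fun (u n) (s - 2 * pi * of_int \<lfloor>s / (2 * pi)\<rfloor>) - g (s - 2 * pi * of_int \<lfloor>s / (2 * pi)\<rfloor>)" for n s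
      using periodic_reduce(1)[of "h2per_fun (u n)", OF h2per_fun_periodic, of s] by (simp add: G_def periodic_ext_def)
    have ul: "uniform_limit UNIV (\<lambda>n. h2per_fun (u (k n))) G sequentially"
      unfolding uniform_limit_sequentially_iff dist_norm red
      using g(3) periodic_reduce(2)[of "h2per_fun (u 0)", OF h2per_fun_periodic] by meson
    have Gc: "continuous_on UNIV G"
      by (rule uniform_limit_theorem[OF _ ul]) (auto intro!: always_eventually h2per_fun_continuous)
    have Gb: "cmod (G s) \<le> B" for s
    proof -
      have "(\<lambda>n. h2per_fun (u (k n)) s) \<longlonglongrightarrow> G s" by (rule tendsto_uniform_limitI[OF ul]) simp
      from LIMSEQ_le_const2[OF tendsto_norm[OF this]] show ?thesis using B by auto
    qed
    have "\<forall>n. l (k n) \<in> {0..M}" using x(2) by blast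
    then obtain m r where r: "strict_mono r" "((\<lambda>n. l (k n)) \<circ> r) \<longlonglongrightarrow> m"
      using compact_imp_seq_compact[OF compact_Icc[of 0 M], unfolded seq_compact_def, rule_format, of "\<lambda>n. l (k n)"]
      by auto
    then have r2: "(\<lambda>n. l (k (r n))) \<longlonglongrightarrow> m" by (simp only: o_def)
    have "(\<lambda>n. \<Phi> (l (k (r n))) (h2per_fun (u (k (r n))))) \<longlonglongrightarrow> \<Phi> m G"
    proof (rule \<Phi>_tendsto[where B = B])
      show "uniform_limit period (\<lambda>n. h2per_fun (u (k (r n)))) G sequentially"
        by (rule filterlim_compose[OF uniform_limit_on_subset[OF ul subset_UNIV] filterlim_subseq[OF r(1)]])
      show "G (s + 2 * pi) = G s" for s by (simp add: G_def periodic_ext_periodic)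
    qed (use B Gc Gb r2 in \<open>auto intro!: h2per_fun_continuous h2per_fun_periodic\<close>)
    then show "\<exists>l r. strict_mono r \<and> (\<lambda>n. x (r n)) \<longlonglongrightarrow> l"
      using strict_mono_o[OF g(2) r(1)] unfolding x(1) T_def by (intro exI[of _ "\<Phi> m G"] exI[of _ "k \<circ> r"]) (simp add: o_def)
  qed
  moreover have "T l u \<in> closure S" if "l \<in> {0..M}" "norm u \<le> R" for l u
    using that closure_subset[of S] by (auto simp: S_def)
  ultimately show ?thesis by blast
qed

end

section \<open>A priori bounds\<close>

lemma integrable_AE_cong:
  fixes f g :: "real \<Rightarrow> 'a::euclidean_space"
  assumes "f integrable_on S" "AE x in lebesgue. f x = g x"
  shows "g integrable_on S"
proof -
  obtain N where N: "negligible N" "\<And>x. x \<notin> N \<Longrightarrow> f x = g x"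
    using AE_lebesgue_negligible[OF assms(2)] by blast
  show ?thesis by (rule integrable_spike[OF assms(1) N(1)]) (simp add: N(2))
qed

text \<open>
  The cubic term, tested with \<open>u\<close>, is the real function \<open>t * \<bar>u\<bar>^4\<close> and hence absent from the
  imaginary part.
\<close>

lemma nonlinear_energy:
  assumes eq: "AE s in lebesgue. LLop d \<zeta> \<omega> u s = of_real (t * (cmod (h2per_fun u s))\<^sup>2) * h2per_fun u s - \<i> * h s"
  shows nonlinear_energy_Im: "((\<lambda>s. Re (h s * cnj (h2per_fun u s))) has_integral
      L2sq (h2per_fun u)) period"
    and nonlinear_energy_Re: "((\<lambda>s. t * (cmod (h2per_fun u s)) ^ 4 + Im (h s * cnj (h2per_fun u s))) has_integral
      d * L2sq (h2per_fun' u)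
      - \<omega> * momentum u
      + \<zeta> * L2sq (h2per_fun u)) period"
proof -
  let ?F = "h2per_fun u"
  have *: "(of_real (t * (cmod z)\<^sup>2) * z - \<i> * w) * cnj z = of_real (t * cmod z ^ 4) - \<i> * (w * cnj z)" for z w
  proof -
    have "(of_real (t * (cmod z)\<^sup>2) * z - \<i> * w) * cnj z = of_real (t * (cmod z)\<^sup>2) * (z * cnj z) - \<i> * (w * cnj z)"
      by (simp add: algebra_simps)
    also have "z * cnj z = of_real ((cmod z)\<^sup>2)" by (simp only: complex_norm_square)
    finally show ?thesis by (simp add: power4_eq_xxxx power2_eq_square mult.assoc)
  qed
  have Im: "AE s in lebesgue. - Im (LLop d \<zeta> \<omega> u s * cnj (?F s)) = Re (h s * cnj (?F s))"
    using eq by eventually_elim (simp only: *, simp)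
  have Re: "AE s in lebesgue. Re (LLop d \<zeta> \<omega> u s * cnj (?F s)) = t * (cmod (?F s)) ^ 4 + Im (h s * cnj (?F s))"
    using eq by eventually_elim (simp only: *, simp)
  have "integral period (\<lambda>s. Re (h s * cnj (?F s))) = L2sq (h2per_fun u)"
    using integral_AE_cong[OF Im, of period] unfolding integral_neg h2per_energy_Im by simp
  moreover have "(\<lambda>s. Re (h s * cnj (?F s))) integrable_on period"
    by (rule integrable_AE_cong[OF integrable_neg[OF h2per_energy_Im_int] Im])
  ultimately show "((\<lambda>s. Re (h s * cnj (h2per_fun u s))) has_integral
      L2sq (h2per_fun u)) period"
    by (simp only: has_integral_iff)
  have "(\<lambda>s. t * (cmod (?F s)) ^ 4 + Im (h s * cnj (?F s))) integrable_on period"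
    by (rule integrable_AE_cong[OF h2per_energy_Re_int Re])
  then show "((\<lambda>s. t * (cmod (h2per_fun u s)) ^ 4 + Im (h s * cnj (h2per_fun u s))) has_integral
      d * L2sq (h2per_fun' u)
      - \<omega> * momentum u
      + \<zeta> * L2sq (h2per_fun u)) period"
    unfolding has_integral_iff h2per_energy_Re[of d \<zeta> \<omega> u, symmetric] integral_AE_cong[OF Re, of period] by simp
qed

text \<open>
  A Gagliardo--Nirenberg inequality. The function \<open>\<bar>u\<bar>\<^sup>2\<close> varies by at most the integral of
  \<open>2 * \<bar>u\<bar> * \<bar>u'\<bar>\<close>, in which the mean square of \<open>u'\<close> can be given an arbitrarily small factor \<open>k\<close>.
\<close>

lemma sup_sq_bound:
  assumes k: "0 < k" and A: "L2sq (h2per_fun u) \<le> A" and x: "x \<in> period"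
  shows "(cmod (h2per_fun u x))\<^sup>2 \<le> A / (2 * pi) + k * L2sq (h2per_fun' u) + A / k"
proof -
  let ?F = "h2per_fun u" and ?G = "h2per_fun' u"
  have "0 \<le> A" using integral_sq_nonneg[of period ?F] A by linarith
  obtain y where y: "y \<in> period" "cmod (?F y) \<le> sqrt (A / (2 * pi))"
    using norm_le_rms_somewhere[of ?F "sqrt (A / (2 * pi))"] h2per_fun_continuous A \<open>0 \<le> A\<close> by auto
  have "(cmod (?F y))\<^sup>2 \<le> (sqrt (A / (2 * pi)))\<^sup>2" using y(2) by (intro power_mono) auto
  then have y': "(cmod (?F y))\<^sup>2 \<le> A / (2 * pi)" using \<open>0 \<le> A\<close> by simp
  let ?g = "\<lambda>s. ?G s * cnj (?F s) + ?F s * cnj (?G s)"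
  have P: "primitive (\<lambda>s. ?F s * cnj (?F s)) ?g"
    by (intro primitive_mult h2per_primitive primitive_linear[OF h2per_primitive bounded_linear_cnj])
  have "cmod (?F x * cnj (?F x) - ?F y * cnj (?F y)) \<le> integral period (\<lambda>s. cmod (?g s))"
    using primitive_norm_le[OF P, of 0 x y "2*pi"] primitive_norm_le[OF P, of 0 y x "2*pi"] x y(1)
    by (cases "x \<le> y") (auto simp: norm_minus_commute)
  also have "\<dots> \<le> integral period (\<lambda>s. k * (cmod (?G s))\<^sup>2 + (cmod (?F s))\<^sup>2 / k)"
  proof (rule integral_le)
    show "(\<lambda>s. cmod (?g s)) integrable_on period"
      by (intro integrable_continuous_real continuous_intros h2per_fun_continuous)
    show "(\<lambda>s. k * (cmod (?G s))\<^sup>2 + (cmod (?F s))\<^sup>2 / k) integrable_on period"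
      by (intro integrable_add integrable_on_mult_right integrable_on_divide h2per_fun_int)
    fix s
    have "cmod (?g s) \<le> cmod (?G s * cnj (?F s)) + cmod (?F s * cnj (?G s))" by (rule norm_triangle_ineq)
    also have "\<dots> = 2 * (cmod (?G s) * cmod (?F s))" by (simp add: norm_mult)
    also have "\<dots> \<le> 2 * (k * (cmod (?G s))\<^sup>2 / 2 + (cmod (?F s))\<^sup>2 / (2 * k))"
      using k by (intro mult_left_mono young_weighted) auto
    finally show "cmod (?g s) \<le> k * (cmod (?G s))\<^sup>2 + (cmod (?F s))\<^sup>2 / k" by simp
  qed
  also have "\<dots> = k * L2sq ?G + L2sq ?F / k"
    by (subst integral_add) (auto intro!: integrable_on_mult_right integrable_on_divide h2per_fun_int)
  also have "L2sq ?F / k \<le> A / k"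
    using A k by (intro divide_right_mono) auto
  finally have "cmod (?F x * cnj (?F x) - ?F y * cnj (?F y)) \<le> k * L2sq ?G + A / k" by simp
  moreover have "(cmod (?F x))\<^sup>2 \<le> (cmod (?F y))\<^sup>2 + cmod (?F x * cnj (?F x) - ?F y * cnj (?F y))"
    using norm_triangle_ineq2[of "?F x * cnj (?F x)" "?F y * cnj (?F y)"] by (simp add: norm_mult power2_eq_square)
  ultimately show ?thesis using y' by linarith
qed

context pumped_LLE
begin

text \<open>
  The imaginary part of the energy gives \<open>n0 \<le> A\<close>. In the real part the quartic term is at most
  \<open>q * n0\<close> with \<open>q\<close> from \<open>sup_sq_bound\<close>; the choice of \<open>k\<close> makes its share of \<open>n1\<close> at most
  \<open>\<bar>d\<bar> / 4\<close>, the \<open>\<omega>\<close>-term takes another \<open>\<bar>d\<bar> / 4\<close>, and half of \<open>\<bar>d\<bar> * n1\<close> is left on the other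
  side. The supremum, and with it \<open>L u\<close>, is then bounded as well.
\<close>

lemma T_bound:
  assumes "0 \<le> M"
  shows "\<exists>R. \<forall>l\<in>{0..M}. \<forall>t\<in>{0..1}. \<forall>u. u = t *\<^sub>R T l u \<longrightarrow> norm u < R"
proof -
  obtain K where K: "K \<ge> 0" "\<And>u. (norm u)\<^sup>2 \<le> K * L2sq (L u)"
    using elliptic_estimate[OF d, of \<zeta> \<omega>] by blast
  let ?h = "\<lambda>s. 2 * f0\<^sup>2 + 2 * M\<^sup>2 * (cmod (periodic_ext e s))\<^sup>2"
  have hi: "?h integrable_on period"
    by (intro integrable_add integrable_const_ivl integrable_on_mult_right periodic_ext_sq_int)
  define A where "A = integral period ?h"
  have A: "0 \<le> A" unfolding A_def by (intro integral_nonneg hi) auto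
  define k where "k = \<bar>d\<bar> / (4 * (A + 1))"
  have k: "0 < k" using d A by (simp add: k_def)
  have kA: "k * A \<le> \<bar>d\<bar> / 4"
  proof -
    have "k * A \<le> k * (A + 1)" using k by simp
    also have "\<dots> = \<bar>d\<bar> / 4" using A by (simp add: k_def field_simps)
    finally show ?thesis .
  qed
  define D where "D = \<omega>\<^sup>2 / \<bar>d\<bar> * A + \<bar>\<zeta>\<bar> * A + (A / (2 * pi) + A / k) * A + A"
  define Q where "Q = A / (2 * pi) + k * (2 * D / \<bar>d\<bar>) + A / k"
  define R where "R = sqrt (K * (2 * pi * (2 * Q ^ 3) + 2 * A)) + 1"
  have "norm u < R" if l: "l \<in> {0..M}" and t: "t \<in> {0..1}" and u: "u = t *\<^sub>R T l u" for l t u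
  proof -
    let ?F = "h2per_fun u" and ?G = "h2per_fun' u"
    define n0 n1 where "n0 = L2sq ?F" "n1 = L2sq ?G"
    define h where "h s = of_real t * forcing l s" for s
    have nn: "0 \<le> n0" "0 \<le> n1" by (simp_all add: n0_n1_def integral_sq_nonneg)
    have h: "(cmod (h s))\<^sup>2 \<le> ?h s" for s
    proof -
      have "cmod (h s) \<le> 1 * cmod (forcing l s)"
        unfolding h_def norm_mult using t by (intro mult_right_mono) auto
      also have "\<dots> \<le> \<bar>f0\<bar> + l * cmod (periodic_ext e s)"
        unfolding forcing_def using norm_triangle_ineq[of "of_real f0" "of_real l * periodic_ext e s"] l by (simp add: norm_mult)
      also have "\<dots> \<le> \<bar>f0\<bar> + M * cmod (periodic_ext e s)"
        using l by (intro add_left_mono mult_right_mono) auto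
      finally have "(cmod (h s))\<^sup>2 \<le> (\<bar>f0\<bar> + M * cmod (periodic_ext e s))\<^sup>2" by (intro power_mono) auto
      also have "\<dots> \<le> 2 * \<bar>f0\<bar>\<^sup>2 + 2 * (M * cmod (periodic_ext e s))\<^sup>2"
        using zero_le_power2[of "\<bar>f0\<bar> - M * cmod (periodic_ext e s)"] unfolding power2_diff power2_sum by linarith
      finally show ?thesis by (simp add: power_mult_distrib)
    qed
    have eq: "AE s in lebesgue. L u s = of_real (t * (cmod (?F s))\<^sup>2) * ?F s - \<i> * h s"
      using LLop_scaleR[of d \<zeta> \<omega> t "T l u", folded u] L_T[of l u]
      by eventually_elim (simp add: rhs_def h_def scaleR_conv_of_real algebra_simps)
    have hF: "\<bar>Re (h s * cnj (?F s))\<bar> \<le> ?h s / 2 + (cmod (?F s))\<^sup>2 / 2" "\<bar>Im (h s * cnj (?F s))\<bar> \<le> ?h s / 2 + (cmod (?F s))\<^sup>2 / 2" for s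
    proof -
      have "cmod (h s * cnj (?F s)) \<le> (cmod (h s))\<^sup>2 / 2 + (cmod (?F s))\<^sup>2 / 2"
        using young[of "cmod (h s)" "cmod (?F s)"] unfolding norm_mult complex_mod_cnj .
      also have "\<dots> \<le> ?h s / 2 + (cmod (?F s))\<^sup>2 / 2"
        by (intro add_right_mono divide_right_mono h) simp
      finally have "cmod (h s * cnj (?F s)) \<le> ?h s / 2 + (cmod (?F s))\<^sup>2 / 2" .
      then show "\<bar>Re (h s * cnj (?F s))\<bar> \<le> ?h s / 2 + (cmod (?F s))\<^sup>2 / 2" "\<bar>Im (h s * cnj (?F s))\<bar> \<le> ?h s / 2 + (cmod (?F s))\<^sup>2 / 2"
        using abs_Re_le_cmod[of "h s * cnj (?F s)"] abs_Im_le_cmod[of "h s * cnj (?F s)"] by (meson order_trans)+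
    qed
    have rhs_int: "((\<lambda>s. ?h s / 2 + (cmod (?F s))\<^sup>2 / 2) has_integral A / 2 + n0 / 2) period"
      unfolding A_def n0_n1_def
      by (intro has_integral_add has_integral_divide integrable_integral hi h2per_fun_int)
    have "n0 \<le> A / 2 + n0 / 2"
      using has_integral_le[OF nonlinear_energy_Im[OF eq] rhs_int] hF(1) unfolding n0_n1_def by (meson abs_le_iff)
    then have n0: "n0 \<le> A" by linarith
    define q where "q = A / (2 * pi) + k * n1 + A / k"
    have sup: "(cmod (?F s))\<^sup>2 \<le> q" if "s \<in> period" for s
      using sup_sq_bound[OF k _ that, of u A] n0 by (simp add: n0_n1_def q_def)
    have "0 \<le> (cmod (?F 0))\<^sup>2" by simp
    also have "\<dots> \<le> q" by (rule sup) simp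
    finally have "0 \<le> q" .
    have nl: "\<bar>d * n1 - \<omega> * momentum u + \<zeta> * n0\<bar> \<le> q * n0 + (A / 2 + n0 / 2)"
    proof -
      have maj: "((\<lambda>s. q * (cmod (?F s))\<^sup>2 + (?h s / 2 + (cmod (?F s))\<^sup>2 / 2)) has_integral q * n0 + (A / 2 + n0 / 2)) period"
        unfolding n0_n1_def(1)
        by (intro has_integral_add has_integral_mult_right integrable_integral h2per_fun_int rhs_int[unfolded n0_n1_def(1)])
      have pt: "norm (t * cmod (?F s) ^ 4 + Im (h s * cnj (?F s))) \<le> q * (cmod (?F s))\<^sup>2 + (?h s / 2 + (cmod (?F s))\<^sup>2 / 2)"
        if "s \<in> period" for s
      proof -
        have "t * cmod (?F s) ^ 4 \<le> 1 * cmod (?F s) ^ 4" using t by (intro mult_right_mono) auto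
        also have "\<dots> = (cmod (?F s))\<^sup>2 * (cmod (?F s))\<^sup>2" by (simp add: power4_eq_xxxx power2_eq_square)
        also have "\<dots> \<le> q * (cmod (?F s))\<^sup>2" using sup[OF that] by (intro mult_right_mono) auto
        finally have "t * cmod (?F s) ^ 4 \<le> q * (cmod (?F s))\<^sup>2" .
        moreover have "0 \<le> t * cmod (?F s) ^ 4" using t by simp
        ultimately show ?thesis using hF(2)[of s] unfolding real_norm_def by linarith
      qed
      note en = nonlinear_energy_Re[OF eq]
      have "norm (integral period (\<lambda>s. t * cmod (?F s) ^ 4 + Im (h s * cnj (?F s)))) \<le>
         integral period (\<lambda>s. q * (cmod (?F s))\<^sup>2 + (?h s / 2 + (cmod (?F s))\<^sup>2 / 2))"
        using en maj pt by (intro integral_norm_bound_integral) (auto simp: has_integral_iff)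
      then show ?thesis
        unfolding integral_unique[OF en] integral_unique[OF maj] real_norm_def n0_n1_def .
    qed
    have cross: "\<bar>\<omega> * momentum u\<bar> \<le> \<bar>d\<bar> / 4 * n1 + \<omega>\<^sup>2 / \<bar>d\<bar> * n0"
      using energy_cross_term[of "\<bar>d\<bar> / 4" \<omega> u] d by (simp add: n0_n1_def)
    have "\<bar>d\<bar> * n1 = \<bar>d * n1\<bar>" using nn by (simp add: abs_mult)
    also have "\<dots> \<le> q * n0 + (A / 2 + n0 / 2) + (\<bar>d\<bar> / 4 * n1 + \<omega>\<^sup>2 / \<bar>d\<bar> * n0) + \<bar>\<zeta> * n0\<bar>"
      using nl cross by linarith
    also have "\<bar>\<zeta> * n0\<bar> = \<bar>\<zeta>\<bar> * n0" using nn by (simp add: abs_mult)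
    also have "q * n0 + (A / 2 + n0 / 2) + (\<bar>d\<bar> / 4 * n1 + \<omega>\<^sup>2 / \<bar>d\<bar> * n0) + \<bar>\<zeta>\<bar> * n0
        \<le> q * A + (A / 2 + A / 2) + (\<bar>d\<bar> / 4 * n1 + \<omega>\<^sup>2 / \<bar>d\<bar> * A) + \<bar>\<zeta>\<bar> * A"
      using n0 \<open>0 \<le> q\<close> by (intro add_mono mult_left_mono divide_right_mono) auto
    also have "q * A = (A / (2 * pi) + A / k) * A + (k * A) * n1" by (simp add: q_def algebra_simps)
    also have "(k * A) * n1 \<le> \<bar>d\<bar> / 4 * n1" using kA nn by (intro mult_right_mono) auto
    finally have "\<bar>d\<bar> * n1 \<le> D + \<bar>d\<bar> / 2 * n1" unfolding D_def by linarith
    then have n1: "n1 \<le> 2 * D / \<bar>d\<bar>" using d by (simp add: field_simps)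
    have "q \<le> Q" unfolding q_def Q_def using n1 k by (intro add_mono mult_left_mono) auto
    have "L2sq (L u) \<le> integral period (\<lambda>s. 2 * Q ^ 3 + 2 * ?h s)"
    proof -
      let ?r = "\<lambda>s. (cmod (of_real (t * (cmod (?F s))\<^sup>2) * ?F s - \<i> * h s))\<^sup>2"
      have ae: "AE s in lebesgue. (cmod (L u s))\<^sup>2 = ?r s" using eq by eventually_elim simp
      have "integral period ?r \<le> integral period (\<lambda>s. 2 * Q ^ 3 + 2 * ?h s)"
      proof (rule integral_le)
        show "?r integrable_on period"
          by (rule integrable_AE_cong[OF locally_square_integrable_sq[OF square_integrable_LLop] ae])
        show "(\<lambda>s. 2 * Q ^ 3 + 2 * ?h s) integrable_on period"
          by (intro integrable_add integrable_const_ivl integrable_on_mult_right hi)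
        fix s assume s: "s \<in> period"
        define x where "x = cmod (of_real (t * (cmod (?F s))\<^sup>2) * ?F s)"
        have "x \<le> 1 * (cmod (?F s))\<^sup>2 * cmod (?F s)"
          unfolding x_def norm_mult norm_of_real using t by (intro mult_right_mono) (auto simp: abs_mult mult_left_le_one_le)
        then have "x\<^sup>2 \<le> ((cmod (?F s))\<^sup>2 * cmod (?F s))\<^sup>2" by (intro power_mono) (auto simp: x_def)
        also have "\<dots> = ((cmod (?F s))\<^sup>2) ^ 3" by (simp add: power2_eq_square power3_eq_cube mult_ac)
        also have "\<dots> \<le> Q ^ 3" using sup[OF s] \<open>q \<le> Q\<close> by (intro power_mono) auto
        finally have x: "x\<^sup>2 \<le> Q ^ 3" .
        have "cmod (of_real (t * (cmod (?F s))\<^sup>2) * ?F s - \<i> * h s) \<le> x + cmod (h s)"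
          using norm_triangle_ineq4[of "of_real (t * (cmod (?F s))\<^sup>2) * ?F s" "\<i> * h s"] unfolding x_def by (simp only: norm_mult norm_ii mult_1)
        then have "?r s \<le> (x + cmod (h s))\<^sup>2" by (intro power_mono) auto
        also have "\<dots> \<le> 2 * x\<^sup>2 + 2 * (cmod (h s))\<^sup>2"
          using zero_le_power2[of "x - cmod (h s)"] unfolding power2_diff power2_sum by linarith
        also have "\<dots> \<le> 2 * Q ^ 3 + 2 * ?h s" using x h[of s] by (intro add_mono mult_left_mono) auto
        finally show "?r s \<le> 2 * Q ^ 3 + 2 * ?h s" .
      qed
      then show ?thesis by (simp only: integral_AE_cong[OF ae])
    qed
    also have "\<dots> = 2 * pi * (2 * Q ^ 3) + 2 * A"
    proof -
      have "((\<lambda>s. 2 * Q ^ 3 + 2 * ?h s) has_integral (2 * Q ^ 3 * (2 * pi - 0)) + 2 * A) period"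
        unfolding A_def using has_integral_const_real[of "2 * Q ^ 3" 0 "2*pi"]
        by (intro has_integral_add has_integral_mult_right integrable_integral hi) (simp add: mult.commute)
      then show ?thesis by (simp add: integral_unique)
    qed
    finally have "(norm u)\<^sup>2 \<le> K * (2 * pi * (2 * Q ^ 3) + 2 * A)"
      using K(2)[of u] K(1) by (meson mult_left_mono order_trans)
    then have "norm u \<le> sqrt (K * (2 * pi * (2 * Q ^ 3) + 2 * A))" by (rule real_le_rsqrt)
    then show ?thesis by (simp add: R_def)
  qed
  then show ?thesis by blast
qed

end

section \<open>Bounds for solutions with constant forcing\<close>

text \<open>
  A periodic function must undo on one part of the period what it does on the other.
\<close>

lemma half_variation:
  fixes F f :: "real \<Rightarrow> real"
  assumes F: "primitive F f" and per: "F (2 * pi) = F 0" and x: "x \<in> period"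
  shows "2 * \<bar>F x - F 0\<bar> \<le> integral period (\<lambda>s. \<bar>f s\<bar>)"
proof -
  have i: "(\<lambda>s. norm (f s)) integrable_on period"
    using primitiveD'[OF F, of 0 "2*pi"] by (simp add: absolutely_integrable_on_def)
  have "\<bar>F x - F 0\<bar> \<le> integral {0..x} (\<lambda>s. norm (f s))" "\<bar>F (2*pi) - F x\<bar> \<le> integral {x..2*pi} (\<lambda>s. norm (f s))"
    using primitive_norm_le[OF F, of 0 0 x x] primitive_norm_le[OF F, of x x "2*pi" "2*pi"] x by auto
  moreover have "integral {0..x} (\<lambda>s. norm (f s)) + integral {x..2*pi} (\<lambda>s. norm (f s)) = integral period (\<lambda>s. norm (f s))"
    using x by (intro Henstock_Kurzweil_Integration.integral_combine i) auto
  ultimately show ?thesis using per by (simp add: abs_minus_commute)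
qed

text \<open>
  The real form of \<open>L u = \<bar>u\<bar>\<^sup>2 u - \<i> f\<^sub>0\<close>, with \<open>u = a + \<i> b\<close>, \<open>u' = p + \<i> q\<close>, \<open>u'' = r + \<i> s\<close>. The
  imaginary part of the equation times \<open>cnj u\<close> reads \<open>J' = - (\<bar>u\<bar>\<^sup>2 - f\<^sub>0 a) / d\<close> for
  \<open>J = Im (u' * cnj u) - \<omega> / (2 * d) * \<bar>u\<bar>\<^sup>2\<close>. As \<open>J'\<close> has mean zero, this bounds
  the mean square of \<open>u\<close>, and then the oscillation of \<open>J\<close> by \<open>S = pi * f\<^sub>0\<^sup>2 / (2 * \<bar>d\<bar>)\<close> independently of \<open>\<omega>\<close> and \<open>\<zeta>\<close>. The imaginary part
  of the equation times \<open>cnj u''\<close> makes \<open>\<bar>u'\<bar>\<^sup>2 - (\<bar>u\<bar>\<^sup>2)' * (J - J 0)\<close> the derivative of a periodic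
  function \<open>W\<close>. So the mean square of \<open>u'\<close> is at most \<open>4 * S\<^sup>2\<close> times that of \<open>u\<close>.
\<close>

lemma real_system_estimate:
  fixes a b p q r s :: "real \<Rightarrow> real"
  assumes d: "d \<noteq> 0"
    and D: "\<And>x. (a has_field_derivative p x) (at x)" "\<And>x. (b has_field_derivative q x) (at x)"
      "\<And>x. (p has_field_derivative r x) (at x)" "\<And>x. (q has_field_derivative s x) (at x)"
    and cont: "continuous_on UNIV r" "continuous_on UNIV s"
    and per: "a (2 * pi) = a 0" "b (2 * pi) = b 0" "p (2 * pi) = p 0" "q (2 * pi) = q 0"
    and r: "\<And>x. d * r x = - \<omega> * q x + \<zeta> * a x + b x - ((a x)\<^sup>2 + (b x)\<^sup>2) * a x"
    and s: "\<And>x. d * s x = \<omega> * p x + \<zeta> * b x - a x - ((a x)\<^sup>2 + (b x)\<^sup>2) * b x + f0"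
  shows "integral period (\<lambda>x. (a x)\<^sup>2 + (b x)\<^sup>2) \<le> 2 * pi * f0\<^sup>2"
    and "integral period (\<lambda>x. (p x)\<^sup>2 + (q x)\<^sup>2) \<le> (pi * f0\<^sup>2 / \<bar>d\<bar>)\<^sup>2 * integral period (\<lambda>x. (a x)\<^sup>2 + (b x)\<^sup>2)"
proof -
  have c: "continuous_on S a" "continuous_on S b" "continuous_on S p" "continuous_on S q" for S
    using D by (meson DERIV_continuous_on has_field_derivative_at_within)+
  have prim: "primitive F f" if "\<And>x. (F has_field_derivative f x) (at x)" "continuous_on UNIV f" for F f :: "real \<Rightarrow> real"
    by (rule primitive_of_deriv) (use that in \<open>simp_all add: has_real_derivative_iff_has_vector_derivative\<close>)
  define J where "J x = q x * a x - p x * b x - \<omega> / (2 * d) * ((a x)\<^sup>2 + (b x)\<^sup>2)" for x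
  define g where "g x = (a x)\<^sup>2 + (b x)\<^sup>2 - f0 * a x" for x
  have gc: "continuous_on S g" and Jc: "continuous_on S J" for S
    unfolding g_def J_def by (intro continuous_intros c)+
  have J': "(J has_field_derivative - g x / d) (at x)" for x
  proof -
    have "(J has_field_derivative (s x * a x + q x * p x - (r x * b x + p x * q x)
        - \<omega> / (2 * d) * (2 * a x * p x + 2 * b x * q x))) (at x)"
      unfolding J_def by (auto intro!: derivative_eq_intros D simp: d)
    moreover have "d * (s x * a x + q x * p x - (r x * b x + p x * q x) - \<omega> / (2 * d) * (2 * a x * p x + 2 * b x * q x)) = - g x"
    proof -
      have "d * (s x * a x + q x * p x - (r x * b x + p x * q x) - \<omega> / (2 * d) * (2 * a x * p x + 2 * b x * q x)) =
        (d * s x) * a x - (d * r x) * b x - \<omega> * (a x * p x + b x * q x)"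
        using d by (simp add: field_simps)
      also have "\<dots> = - g x" unfolding r s g_def by (simp add: algebra_simps power2_eq_square)
      finally show ?thesis .
    qed
    ultimately show ?thesis using d by (metis nonzero_mult_div_cancel_left)
  qed
  have "primitive J (\<lambda>x. - g x / d)"
    by (intro prim J' continuous_intros gc d) (use d in auto)
  note Jprim = this
  have Jper: "J (2 * pi) = J 0" by (simp add: J_def per)
  define n0 where "n0 = integral period (\<lambda>x. (a x)\<^sup>2 + (b x)\<^sup>2)"
  have "integral period (\<lambda>x. - g x / d) = 0"
    using primitiveD(2)[OF Jprim, of 0 "2 * pi"] Jper by simp
  then have "integral period g = 0" using d by simp
  moreover have ii: "(\<lambda>x. (a x)\<^sup>2 + (b x)\<^sup>2) integrable_on period" "(\<lambda>x. f0 * a x) integrable_on period"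
    by (intro integrable_continuous_real continuous_intros c)+
  ultimately have n0: "n0 = integral period (\<lambda>x. f0 * a x)"
    using integral_diff[OF ii] by (simp add: n0_def g_def[abs_def])
  define S where "S = pi * f0\<^sup>2 / (2 * \<bar>d\<bar>)"
  have "2 * n0 \<le> integral period (\<lambda>x. f0\<^sup>2 + ((a x)\<^sup>2 + (b x)\<^sup>2))"
  proof -
    have "2 * n0 = integral period (\<lambda>x. 2 * (f0 * a x))" unfolding n0 by simp
    also have "\<dots> \<le> integral period (\<lambda>x. f0\<^sup>2 + ((a x)\<^sup>2 + (b x)\<^sup>2))"
    proof (rule integral_le)
      show "2 * (f0 * a x) \<le> f0\<^sup>2 + ((a x)\<^sup>2 + (b x)\<^sup>2)" for x
        using zero_le_power2[of "f0 - a x"] zero_le_power2[of "b x"] unfolding power2_diff by linarith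
    qed (intro integrable_continuous_real continuous_intros c)+
    finally show ?thesis .
  qed
  also have "\<dots> = 2 * pi * f0\<^sup>2 + n0"
    unfolding n0_def by (subst integral_add) (auto intro!: ii)
  finally show "integral period (\<lambda>x. (a x)\<^sup>2 + (b x)\<^sup>2) \<le> 2 * pi * f0\<^sup>2" by (simp add: n0_def)
  have JS: "\<bar>J x - J 0\<bar> \<le> S" if x: "x \<in> period" for x
  proof -
    have "2 * \<bar>J x - J 0\<bar> \<le> integral period (\<lambda>x. \<bar>- g x / d\<bar>)" by (rule half_variation[OF Jprim Jper x])
    also have "\<dots> \<le> integral period (\<lambda>x. ((a x)\<^sup>2 + (b x)\<^sup>2 - f0 * a x + f0\<^sup>2 / 2) / \<bar>d\<bar>)"
    proof (rule integral_le)
      fix x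
      have "\<bar>g x\<bar> \<le> (a x)\<^sup>2 + (b x)\<^sup>2 - f0 * a x + f0\<^sup>2 / 2"
      proof -
        have "f0 * a x \<le> (a x)\<^sup>2 + f0\<^sup>2 / 4"
          using zero_le_power2[of "a x - f0 / 2"] by (simp add: power2_eq_square algebra_simps)
        then have "- ((a x)\<^sup>2 + (b x)\<^sup>2 - f0 * a x) \<le> (a x)\<^sup>2 + (b x)\<^sup>2 - f0 * a x + f0\<^sup>2 / 2"
          using zero_le_power2[of "b x"] zero_le_power2[of f0] by linarith
        then show ?thesis unfolding g_def abs_le_iff by simp
      qed
      then show "\<bar>- g x / d\<bar> \<le> ((a x)\<^sup>2 + (b x)\<^sup>2 - f0 * a x + f0\<^sup>2 / 2) / \<bar>d\<bar>"
        by (simp add: abs_divide divide_right_mono)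
    qed (intro integrable_continuous_real continuous_intros c gc; use d in simp)+
    also have "\<dots> = (n0 - n0 + pi * f0\<^sup>2) / \<bar>d\<bar>"
    proof -
      have "((\<lambda>x. ((a x)\<^sup>2 + (b x)\<^sup>2 - f0 * a x + f0\<^sup>2 / 2) / \<bar>d\<bar>) has_integral (n0 - n0 + f0\<^sup>2 / 2 * (2 * pi - 0)) / \<bar>d\<bar>) period"
      proof (intro has_integral_divide has_integral_add has_integral_diff)
        show "((\<lambda>x. (a x)\<^sup>2 + (b x)\<^sup>2) has_integral n0) period" unfolding n0_def by (rule integrable_integral[OF ii(1)])
        show "((\<lambda>x. f0 * a x) has_integral n0) period" unfolding n0 by (rule integrable_integral[OF ii(2)])
        show "((\<lambda>x. f0\<^sup>2 / 2) has_integral f0\<^sup>2 / 2 * (2 * pi - 0)) period"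
          using has_integral_const_real[of "f0\<^sup>2 / 2" 0 "2 * pi"] by (simp add: mult.commute)
      qed
      from integral_unique[OF this] show ?thesis by (simp only:) simp
    qed
    finally show ?thesis by (simp add: S_def field_simps)
  qed
  define W where "W x = a x * p x + b x * q x - \<omega> / 2 * ((p x)\<^sup>2 + (q x)\<^sup>2) + \<zeta> * (q x * a x - p x * b x) - f0 * p x
      - ((a x)\<^sup>2 + (b x)\<^sup>2) * (J x - J 0) - \<omega> / (4 * d) * ((a x)\<^sup>2 + (b x)\<^sup>2)\<^sup>2" for x
  define w where "w x = (p x)\<^sup>2 + (q x)\<^sup>2 - 2 * (p x * a x + q x * b x) * (J x - J 0)" for x
  have W': "(W has_field_derivative w x) (at x)" for x
  proof -
    let ?R = "p x * a x + q x * b x" and ?n = "(a x)\<^sup>2 + (b x)\<^sup>2"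
    have "(W has_field_derivative
        (p x * p x + a x * r x + (q x * q x + b x * s x) - \<omega> / 2 * (2 * p x * r x + 2 * q x * s x)
        + \<zeta> * (s x * a x + q x * p x - (r x * b x + p x * q x)) - f0 * r x
        - ((2 * a x * p x + 2 * b x * q x) * (J x - J 0) + ?n * (- g x / d))
        - \<omega> / (4 * d) * (2 * ?n * (2 * a x * p x + 2 * b x * q x)))) (at x)"
      unfolding W_def by (auto intro!: derivative_eq_intros D J' simp: d)
        (simp add: d field_simps power2_eq_square)
    moreover have "p x * p x + a x * r x + (q x * q x + b x * s x) - \<omega> / 2 * (2 * p x * r x + 2 * q x * s x)
        + \<zeta> * (s x * a x + q x * p x - (r x * b x + p x * q x)) - f0 * r x
        - ((2 * a x * p x + 2 * b x * q x) * (J x - J 0) + ?n * (- g x / d))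
        - \<omega> / (4 * d) * (2 * ?n * (2 * a x * p x + 2 * b x * q x)) = w x" (is "?W = _")
    proof -
      have gd: "- g x / d = s x * a x - r x * b x - \<omega> / d * ?R"
      proof -
        have "d * (s x * a x - r x * b x - \<omega> / d * ?R) = (d * s x) * a x - (d * r x) * b x - \<omega> * ?R"
          using d by (simp add: field_simps)
        also have "\<dots> = - g x" unfolding r s g_def by (simp add: algebra_simps power2_eq_square)
        finally show ?thesis using d by (metis nonzero_mult_div_cancel_left)
      qed
      \<comment> \<open>The two brackets are \<open>- d * s x\<close> and \<open>d * r x\<close> by the equation, so the products cancel.\<close>
      have "?W - w x = r x * (a x - \<omega> * p x - \<zeta> * b x - f0 + ?n * b x) + s x * (b x - \<omega> * q x + \<zeta> * a x - ?n * a x)"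
        unfolding gd w_def using d by (simp add: field_simps power2_eq_square)
      also have "\<dots> = r x * (- (d * s x)) + s x * (d * r x)" unfolding r s by (simp add: algebra_simps)
      also have "\<dots> = 0" by simp
      finally show ?thesis by simp
    qed
    ultimately show ?thesis by simp
  qed
  have wc: "continuous_on UNIV w" unfolding w_def by (intro continuous_intros c Jc)
  have "integral period w = 0"
    using primitiveD(2)[OF prim[OF W' wc], of 0 "2 * pi"] by (simp add: W_def per Jper)
  moreover have "integral period (\<lambda>x. ((p x)\<^sup>2 + (q x)\<^sup>2) / 2 - 2 * S\<^sup>2 * ((a x)\<^sup>2 + (b x)\<^sup>2)) \<le> integral period w"
  proof (rule integral_le)
    show "(\<lambda>x. ((p x)\<^sup>2 + (q x)\<^sup>2) / 2 - 2 * S\<^sup>2 * ((a x)\<^sup>2 + (b x)\<^sup>2)) integrable_on period"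
      by (intro integrable_continuous_real continuous_intros c) auto
    show "w integrable_on period" by (intro integrable_continuous_real continuous_on_subset[OF wc]) auto
    fix x assume "x \<in> period"
    define t where "t = J x - J 0"
    have "t\<^sup>2 \<le> S\<^sup>2" using JS[OF \<open>x \<in> period\<close>] by (simp add: t_def abs_le_square_iff[symmetric])
    then have "2 * ((a x)\<^sup>2 + (b x)\<^sup>2) * t\<^sup>2 \<le> 2 * ((a x)\<^sup>2 + (b x)\<^sup>2) * S\<^sup>2" by (intro mult_left_mono) auto
    moreover have "2 * (p x * a x + q x * b x) * t \<le> ((p x)\<^sup>2 + (q x)\<^sup>2) / 2 + 2 * ((a x)\<^sup>2 + (b x)\<^sup>2) * t\<^sup>2"
    proof -
      have "2 * (y * z) * t \<le> y\<^sup>2 / 2 + 2 * z\<^sup>2 * t\<^sup>2" for y z :: real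
        using zero_le_power2[of "y - 2 * z * t"] by (simp add: power2_eq_square algebra_simps)
      from this[of "p x" "a x"] this[of "q x" "b x"] show ?thesis
        by (simp add: distrib_left distrib_right add_divide_distrib)
    qed
    ultimately show "((p x)\<^sup>2 + (q x)\<^sup>2) / 2 - 2 * S\<^sup>2 * ((a x)\<^sup>2 + (b x)\<^sup>2) \<le> w x"
      unfolding w_def t_def[symmetric] by (simp add: algebra_simps add_divide_distrib)
  qed
  moreover have "integral period (\<lambda>x. ((p x)\<^sup>2 + (q x)\<^sup>2) / 2 - 2 * S\<^sup>2 * ((a x)\<^sup>2 + (b x)\<^sup>2)) =
      integral period (\<lambda>x. (p x)\<^sup>2 + (q x)\<^sup>2) / 2 - 2 * S\<^sup>2 * n0"
    unfolding n0_def
    by (subst integral_diff) (auto intro!: integrable_continuous_real continuous_intros c)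
  ultimately have "integral period (\<lambda>x. (p x)\<^sup>2 + (q x)\<^sup>2) \<le> (2 * S)\<^sup>2 * n0" by (simp add: power_mult_distrib)
  then show "integral period (\<lambda>x. (p x)\<^sup>2 + (q x)\<^sup>2) \<le> (pi * f0\<^sup>2 / \<bar>d\<bar>)\<^sup>2 * integral period (\<lambda>x. (a x)\<^sup>2 + (b x)\<^sup>2)"
    by (simp add: S_def n0_def)
qed

text \<open>
  Under constant forcing the second derivative of a solution is continuous by the equation, so
  solutions are classical and \<open>real_system_estimate\<close> applies.
\<close>

lemma constant_forcing_estimate:
  assumes d: "d \<noteq> 0"
    and eq: "AE s in lebesgue. LLop d \<zeta> \<omega> u s = of_real ((cmod (h2per_fun u s))\<^sup>2) * h2per_fun u s - \<i> * of_real f0"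
  shows "L2sq (h2per_fun u) \<le> 2 * pi * f0\<^sup>2"
    and "L2sq (h2per_fun' u) \<le>
      (pi * f0\<^sup>2 / \<bar>d\<bar>)\<^sup>2 * L2sq (h2per_fun u)"
proof -
  let ?F = "h2per_fun u" and ?G = "h2per_fun' u"
  define H where "H s = (\<i> * of_real \<omega> * ?G s + (of_real \<zeta> - \<i>) * ?F s - of_real ((cmod (?F s))\<^sup>2) * ?F s + \<i> * of_real f0) / of_real d" for s
  have Hc: "continuous_on UNIV H"
    unfolding H_def by (intro continuous_intros h2per_fun_continuous) (use d in auto)
  have "AE s in lebesgue. h2per_deriv 2 u s = H s"
    using eq by eventually_elim (use d in \<open>simp add: LLop_def H_def field_simps\<close>)
  then have GH: "primitive ?G H" by (rule primitive_AE_cong[OF h2per_primitive'])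
  have D: "(?F has_vector_derivative ?G x) (at x)" "(?G has_vector_derivative H x) (at x)" for x
    by (intro primitive_deriv h2per_primitive h2per_fun_continuous GH Hc)+
  have lin: "((\<lambda>x. h (f x)) has_field_derivative h (f' x)) (at x)"
    if "bounded_linear h" "\<And>x. (f has_vector_derivative f' x) (at x)" for h :: "complex \<Rightarrow> real" and f f' x
    using bounded_linear.has_vector_derivative[OF that(1) that(2)[of x]]
    by (simp add: has_real_derivative_iff_has_vector_derivative)
  have dH: "of_real d * H x = \<i> * of_real \<omega> * ?G x + (of_real \<zeta> - \<i>) * ?F x - of_real ((cmod (?F x))\<^sup>2) * ?F x + \<i> * of_real f0" for x
    using d by (simp add: H_def)
  have dr: "d * Re (H x) = - \<omega> * Im (?G x) + \<zeta> * Re (?F x) + Im (?F x) - ((Re (?F x))\<^sup>2 + (Im (?F x))\<^sup>2) * Re (?F x)"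
    "d * Im (H x) = \<omega> * Re (?G x) + \<zeta> * Im (?F x) - Re (?F x) - ((Re (?F x))\<^sup>2 + (Im (?F x))\<^sup>2) * Im (?F x) + f0" for x
    using arg_cong[OF dH[of x], of Re] arg_cong[OF dH[of x], of Im] by (simp_all add: cmod_power2)
  note per = h2per_fun_periodic[of u 0, simplified] h2per_fun'_periodic[of u 0, simplified]
  note est = real_system_estimate[OF d lin[OF bounded_linear_Re D(1)] lin[OF bounded_linear_Im D(1)]
      lin[OF bounded_linear_Re D(2)] lin[OF bounded_linear_Im D(2)] _ _ _ _ _ _ dr]
  show "L2sq ?F \<le> 2 * pi * f0\<^sup>2"
    unfolding cmod_power2 by (rule est(1)) (auto intro!: continuous_intros Hc simp: per)
  show "L2sq ?G \<le> (pi * f0\<^sup>2 / \<bar>d\<bar>)\<^sup>2 * L2sq ?F"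
    unfolding cmod_power2 by (rule est(2)) (auto intro!: continuous_intros Hc simp: per)
qed

lemma constant_forcing_sup:
  assumes d: "d \<noteq> 0"
    and eq: "AE s in lebesgue. LLop d \<zeta> \<omega> u s = of_real ((cmod (h2per_fun u s))\<^sup>2) * h2per_fun u s - \<i> * of_real f0"
    and m: "0 \<le> m" "L2sq (h2per_fun u) \<le> 2 * pi * m\<^sup>2"
    and x: "x \<in> period"
  shows "cmod (h2per_fun u x) \<le> m * (1 + 2 * pi\<^sup>2 * f0\<^sup>2 / \<bar>d\<bar>)"
proof -
  have "L2sq (h2per_fun' u) \<le> (pi * f0\<^sup>2 / \<bar>d\<bar>)\<^sup>2 * (2 * pi * m\<^sup>2)"
    using constant_forcing_estimate(2)[OF d eq] m(2) by (meson mult_left_mono order_trans zero_le_power2)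
  also have "\<dots> = 2 * pi * (pi * f0\<^sup>2 / \<bar>d\<bar> * m)\<^sup>2" by (simp add: power_mult_distrib power_divide)
  finally have "integral period (\<lambda>s. cmod (h2per_fun' u s)) \<le> 2 * pi * (pi * f0\<^sup>2 / \<bar>d\<bar> * m)"
    by (intro integral_norm_le_of_sq h2per_fun_int integrable_continuous_real continuous_intros h2per_fun_continuous)
      (use m in auto)
  then show ?thesis
    using norm_le_rms_plus_variation[OF h2per_primitive m x] by (simp add: algebra_simps power2_eq_square)
qed

section \<open>Uniqueness without the second pump mode\<close>

abbreviation (input) far_focusing :: "real \<Rightarrow> real \<Rightarrow> real \<Rightarrow> real \<Rightarrow> bool" where
  "far_focusing d \<zeta> \<omega> f0 \<equiv> sgn d * \<zeta> < - ((C_bound d f0)\<^sup>2 * of_bool (d < 0))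
     - 27 * (1 + pi * f0\<^sup>2 * \<bar>\<omega>\<bar> / \<bar>d\<bar> + pi\<^sup>2 * f0 ^ 4 / \<bar>d\<bar>) * (C_bound d f0) ^ 6"

abbreviation (input) far_defocusing :: "real \<Rightarrow> real \<Rightarrow> real \<Rightarrow> real \<Rightarrow> bool" where
  "far_defocusing d \<zeta> \<omega> f0 \<equiv> sgn d * \<zeta> > 3 * (C_bound d f0)\<^sup>2 + \<omega>\<^sup>2 / (4 * \<bar>d\<bar>)"

context pumped_LLE
begin

lemma T_0_eq_iff:
  "T 0 u = u \<longleftrightarrow> (AE s in lebesgue. L u s = of_real ((cmod (h2per_fun u s))\<^sup>2) * h2per_fun u s - \<i> * of_real f0)"
  by (simp add: T_eq_iff rhs_def forcing_def)

lemma C_bound_nonneg: "0 \<le> C_bound d f0"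
  by (simp add: C_bound_def)

lemma C_bound_sup:
  assumes "T 0 u = u" "x \<in> period"
  shows "cmod (h2per_fun u x) \<le> C_bound d f0"
  unfolding C_bound_def
  by (rule constant_forcing_sup[OF d assms(1)[unfolded T_0_eq_iff] _ _ assms(2)])
    (use constant_forcing_estimate(1)[OF d assms(1)[unfolded T_0_eq_iff]] in auto)

lemma zero_mean_square_imp_eq:
  assumes "L2sq (h2per_fun (u - v)) \<le> 0"
  shows "u = v"
proof -
  let ?F = "h2per_fun (u - v)"
  have "L2sq ?F = 0" using assms integral_sq_nonneg[of period ?F] by linarith
  then have "\<forall>s\<in>period. (cmod (?F s))\<^sup>2 = 0"
    by (subst (asm) integral_eq_0_iff) (auto intro!: continuous_intros h2per_fun_continuous)
  then have "?F s = 0" for s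
    using periodic_reduce[of ?F s, OF h2per_fun_periodic] by (metis norm_eq_zero zero_eq_power2)
  then have "h2per_fun u = h2per_fun v" by (intro ext) (simp add: h2per_fun_diff)
  then show ?thesis by (rule h2per_fun_inject)
qed

lemma sgn_mult_self: "sgn d * d = \<bar>d\<bar>"
  by (simp add: abs_sgn mult.commute)

text \<open>
  Both parts of the energy of a difference are bounded by the Lipschitz constant \<open>3 * B\<^sup>2\<close> of the
  cubic term times its mean square.
\<close>

lemma difference_estimate:
  assumes "T 0 u = u" "T 0 v = v"
    and B: "\<And>s. s \<in> period \<Longrightarrow> cmod (h2per_fun u s) \<le> B" "\<And>s. s \<in> period \<Longrightarrow> cmod (h2per_fun v s) \<le> B"
  defines "N \<equiv> L2sq (h2per_fun (u - v))"
  shows "N \<le> 3 * B\<^sup>2 * N"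
    and "\<bar>integral period (\<lambda>s. Re (L (u - v) s * cnj (h2per_fun (u - v) s)))\<bar> \<le> 3 * B\<^sup>2 * N"
proof -
  let ?F = "h2per_fun u" and ?G = "h2per_fun v" and ?W = "h2per_fun (u - v)"
  define n where "n s = (of_real ((cmod (?F s))\<^sup>2) * ?F s - of_real ((cmod (?G s))\<^sup>2) * ?G s) * cnj (?W s)" for s
  have ae: "AE s in lebesgue. L (u - v) s * cnj (?W s) = n s"
    using assms(1,2)[unfolded T_0_eq_iff] LLop_diff[of d \<zeta> \<omega> u v] by eventually_elim (simp add: n_def)
  have n: "cmod (n s) \<le> 3 * B\<^sup>2 * (cmod (?W s))\<^sup>2" if "s \<in> period" for s
  proof -
    have "cmod (n s) \<le> (3 * B\<^sup>2 * cmod (?F s - ?G s)) * cmod (?W s)"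
      unfolding n_def norm_mult complex_mod_cnj by (intro mult_right_mono cubic_lipschitz B that) auto
    then show ?thesis by (simp add: h2per_fun_diff power2_eq_square mult.assoc)
  qed
  have ni: "n integrable_on period" by (rule integrable_AE_cong[OF h2per_energy_int ae])
  have bi: "(\<lambda>s. 3 * B\<^sup>2 * (cmod (?W s))\<^sup>2) integrable_on period" by (intro integrable_on_mult_right h2per_fun_int)
  have "norm (integral period n) \<le> integral period (\<lambda>s. 3 * B\<^sup>2 * (cmod (?W s))\<^sup>2)"
    by (rule integral_norm_bound_integral[OF ni bi n])
  also have "\<dots> = 3 * B\<^sup>2 * N" by (simp add: N_def)
  finally have I: "cmod (integral period n) \<le> 3 * B\<^sup>2 * N" .
  have eq: "integral period (\<lambda>s. L (u - v) s * cnj (?W s)) = integral period n" by (rule integral_AE_cong[OF ae])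
  have "- N = integral period (\<lambda>s. Im (L (u - v) s * cnj (?W s)))" by (simp only: h2per_energy_Im N_def)
  also have "\<dots> = Im (integral period n)"
    using integral_linear[OF h2per_energy_int[of d \<zeta> \<omega> "u - v"] bounded_linear_Im] eq by (simp add: o_def)
  finally show "N \<le> 3 * B\<^sup>2 * N" using I abs_Im_le_cmod[of "integral period n"] by linarith
  have "integral period (\<lambda>s. Re (L (u - v) s * cnj (?W s))) = Re (integral period n)"
    using integral_linear[OF h2per_energy_int[of d \<zeta> \<omega> "u - v"] bounded_linear_Re] eq by (simp add: o_def)
  then show "\<bar>integral period (\<lambda>s. Re (L (u - v) s * cnj (?W s)))\<bar> \<le> 3 * B\<^sup>2 * N"
    using I abs_Re_le_cmod[of "integral period n"] by linarith
qed

lemma unique_if_small: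
  assumes "T 0 u = u" "T 0 v = v"
    and B: "\<And>s. s \<in> period \<Longrightarrow> cmod (h2per_fun u s) \<le> B" "\<And>s. s \<in> period \<Longrightarrow> cmod (h2per_fun v s) \<le> B"
    and small: "3 * B\<^sup>2 < 1"
  shows "u = v"
proof (rule zero_mean_square_imp_eq, rule ccontr)
  define N where "N = L2sq (h2per_fun (u - v))"
  assume "\<not> L2sq (h2per_fun (u - v)) \<le> 0"
  then have "3 * B\<^sup>2 * N < 1 * N" using small by (intro mult_strict_right_mono) (auto simp: N_def)
  with difference_estimate(1)[OF assms(1,2) B] show False by (simp add: N_def)
qed

text \<open>
  The terms \<open>\<bar>d\<bar> * N1\<close> and \<open>sgn d * \<zeta> * N\<close> in the real part of the energy have the same sign and
  dominate the \<open>\<omega>\<close>-term, after completing the square, and the nonlinear term.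
\<close>

lemma unique_if_defocusing:
  assumes "T 0 u = u" "T 0 v = v"
    and large: "far_defocusing d \<zeta> \<omega> f0"
  shows "u = v"
proof (rule zero_mean_square_imp_eq)
  define N N1 X where "N = L2sq (h2per_fun (u - v))"
    "N1 = L2sq (h2per_fun' (u - v))"
    "X = momentum (u - v)"
  define Y where "Y = d * N1 - \<omega> * X + \<zeta> * N"
  have "\<bar>Y\<bar> \<le> 3 * (C_bound d f0)\<^sup>2 * N"
    using difference_estimate(2)[OF assms(1,2) C_bound_sup C_bound_sup] assms(1,2)
    unfolding h2per_energy_Re N_N1_X_def Y_def by blast
  moreover have "\<bar>\<omega> * X\<bar> \<le> \<bar>d\<bar> * N1 + \<omega>\<^sup>2 / (4 * \<bar>d\<bar>) * N"
    using energy_cross_term[of "\<bar>d\<bar>" \<omega> "u - v"] d by (simp add: N_N1_X_def)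
  moreover have "sgn d * Y = \<bar>d\<bar> * N1 - sgn d * (\<omega> * X) + sgn d * \<zeta> * N"
    unfolding Y_def sgn_mult_self[symmetric] by (simp add: algebra_simps)
  moreover have "\<bar>sgn d * Y\<bar> = \<bar>Y\<bar>" "\<bar>sgn d * (\<omega> * X)\<bar> = \<bar>\<omega> * X\<bar>" using d by (simp_all add: abs_mult)
  ultimately have "sgn d * \<zeta> * N \<le> 3 * (C_bound d f0)\<^sup>2 * N + \<omega>\<^sup>2 / (4 * \<bar>d\<bar>) * N" by linarith
  then have "(sgn d * \<zeta> - (3 * (C_bound d f0)\<^sup>2 + \<omega>\<^sup>2 / (4 * \<bar>d\<bar>))) * N \<le> 0" by (simp add: algebra_simps)
  then show "L2sq (h2per_fun (u - v)) \<le> 0"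
    unfolding N_N1_X_def[symmetric] using large by (simp add: mult_le_0_iff)
qed

text \<open>
  The real part of the energy of a single solution: \<open>- sgn d * \<zeta>\<close> times the mean square must be
  balanced by the remaining terms. Those with \<open>u'\<close> are estimated by \<open>constant_forcing_estimate\<close>, the quartic term
  has the wrong sign only for \<open>d < 0\<close>, and the forcing is linear in the root mean square \<open>m\<close>.
\<close>

lemma focusing_rms_bound:
  assumes u: "T 0 u = u" and m: "0 \<le> m" "L2sq (h2per_fun u) = 2 * pi * m\<^sup>2"
  shows "(- (sgn d * \<zeta>) - (C_bound d f0)\<^sup>2 * of_bool (d < 0) - (pi * f0\<^sup>2 * \<bar>\<omega>\<bar> / \<bar>d\<bar> + pi\<^sup>2 * f0 ^ 4 / \<bar>d\<bar>)) * m \<le> \<bar>f0\<bar>"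
proof (cases "m = 0")
  case False
  then have "0 < m" using m(1) by simp
  let ?F = "h2per_fun u" and ?G = "h2per_fun' u"
  define n0 n1 X where "n0 = L2sq ?F" "n1 = L2sq ?G"
    "X = momentum u"
  note defs = n0_n1_X_def
  have n0: "0 \<le> n0" by (simp add: defs integral_sq_nonneg)
  define \<beta> where "\<beta> = pi * f0\<^sup>2 / \<bar>d\<bar>"
  have "f0 \<noteq> 0"
    using constant_forcing_estimate(1)[OF d u[unfolded T_0_eq_iff]] m(2) \<open>0 < m\<close> by (auto simp: mult_le_0_iff)
  then have \<beta>: "0 < \<beta>" using d by (simp add: \<beta>_def)
  have n1: "n1 \<le> \<beta>\<^sup>2 * n0"
    using constant_forcing_estimate(2)[OF d u[unfolded T_0_eq_iff]] by (simp add: defs \<beta>_def)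
  have X: "\<bar>\<omega> * X\<bar> \<le> \<beta> * \<bar>\<omega>\<bar> * n0"
  proof (cases "\<omega> = 0")
    case False
    then have k: "0 < \<bar>\<omega>\<bar> / (2 * \<beta>)" using \<beta> by simp
    have "\<bar>\<omega> * X\<bar> \<le> \<bar>\<omega>\<bar> / (2 * \<beta>) * n1 + \<omega>\<^sup>2 / (4 * (\<bar>\<omega>\<bar> / (2 * \<beta>))) * n0"
      using energy_cross_term[OF k, of \<omega> u] by (simp add: defs)
    also have "\<dots> \<le> \<bar>\<omega>\<bar> / (2 * \<beta>) * (\<beta>\<^sup>2 * n0) + \<omega>\<^sup>2 / (4 * (\<bar>\<omega>\<bar> / (2 * \<beta>))) * n0"
      using n1 k by (intro add_right_mono mult_left_mono) auto
    also have "\<dots> = \<beta> * \<bar>\<omega>\<bar> * n0"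
    proof -
      have "\<omega>\<^sup>2 = \<bar>\<omega>\<bar> * \<bar>\<omega>\<bar>" by (simp add: power2_eq_square)
      then show ?thesis using False \<beta> by (simp add: field_simps power2_eq_square)
    qed
    finally show ?thesis .
  qed simp
  have eq: "AE s in lebesgue. L u s = of_real (1 * (cmod (?F s))\<^sup>2) * ?F s - \<i> * of_real f0"
    using u[unfolded T_0_eq_iff] by simp
  note en = nonlinear_energy_Re[OF eq]
  define P Q where "P = integral period (\<lambda>s. cmod (?F s) ^ 4)" "Q = integral period (\<lambda>s. Im (?F s))"
  have i: "(\<lambda>s. cmod (?F s) ^ 4) integrable_on period" "(\<lambda>s. Im (?F s)) integrable_on period"
    "(\<lambda>s. cmod (?F s)) integrable_on period"
    by (intro integrable_continuous_real continuous_intros h2per_fun_continuous)+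
  have "((\<lambda>s. 1 * cmod (?F s) ^ 4 + Im (of_real f0 * cnj (?F s))) has_integral P - f0 * Q) period"
  proof -
    have "((\<lambda>s. cmod (?F s) ^ 4 - f0 * Im (?F s)) has_integral P - f0 * Q) period"
      unfolding P_Q_def by (intro has_integral_diff has_integral_mult_right integrable_integral i)
    then show ?thesis by simp
  qed
  from has_integral_unique[OF en this]
  have energy: "d * n1 - \<omega> * X + \<zeta> * n0 = P - f0 * Q" by (simp only: defs)
  have P: "0 \<le> P" "P \<le> (C_bound d f0)\<^sup>2 * n0"
  proof -
    show "0 \<le> P" unfolding P_Q_def by (intro integral_nonneg i) auto
    have "P \<le> integral period (\<lambda>s. (C_bound d f0)\<^sup>2 * (cmod (?F s))\<^sup>2)"
      unfolding P_Q_def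
    proof (rule integral_le)
      fix s assume "s \<in> period"
      have "cmod (?F s) ^ 4 = (cmod (?F s))\<^sup>2 * (cmod (?F s))\<^sup>2" by (simp add: power4_eq_xxxx power2_eq_square)
      also have "\<dots> \<le> (C_bound d f0)\<^sup>2 * (cmod (?F s))\<^sup>2"
        using C_bound_sup[OF u \<open>s \<in> period\<close>] by (intro mult_right_mono power_mono) auto
      finally show "cmod (?F s) ^ 4 \<le> (C_bound d f0)\<^sup>2 * (cmod (?F s))\<^sup>2" .
    qed (intro i integrable_on_mult_right h2per_fun_int)+
    then show "P \<le> (C_bound d f0)\<^sup>2 * n0" by (simp add: defs)
  qed
  have "\<bar>Q\<bar> \<le> integral period (\<lambda>s. cmod (?F s))"
    unfolding P_Q_def real_norm_def[symmetric]
    by (intro integral_norm_bound_integral i) (simp add: abs_Im_le_cmod)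
  also have "\<dots> \<le> 2 * pi * m" by (intro integral_norm_le_of_sq i h2per_fun_int) (use m in auto)
  finally have Q: "\<bar>f0 * Q\<bar> \<le> \<bar>f0\<bar> * (2 * pi * m)" unfolding abs_mult by (intro mult_left_mono) auto
  have "sgn d * (d * n1 - \<omega> * X + \<zeta> * n0) = \<bar>d\<bar> * n1 - sgn d * (\<omega> * X) + sgn d * \<zeta> * n0"
    unfolding sgn_mult_self[symmetric] by (simp add: algebra_simps)
  moreover have "\<bar>sgn d * (\<omega> * X)\<bar> = \<bar>\<omega> * X\<bar>" "\<bar>sgn d * (f0 * Q)\<bar> = \<bar>f0 * Q\<bar>" using d by (simp_all add: abs_mult)
  moreover have "sgn d * (P - f0 * Q) = sgn d * P - sgn d * (f0 * Q)" by (simp add: algebra_simps)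
  moreover have "- (sgn d * P) \<le> (C_bound d f0)\<^sup>2 * of_bool (d < 0) * n0" using P d by (cases "d < 0") auto
  moreover have "sgn d * (d * n1 - \<omega> * X + \<zeta> * n0) = sgn d * (P - f0 * Q)" by (simp only: energy)
  moreover have "- (sgn d * \<zeta>) * n0 = - (sgn d * \<zeta> * n0)" by simp
  ultimately have "- (sgn d * \<zeta>) * n0 \<le> \<bar>d\<bar> * n1 + \<bar>\<omega> * X\<bar> + (C_bound d f0)\<^sup>2 * of_bool (d < 0) * n0 + \<bar>f0 * Q\<bar>"
    by linarith
  also have "\<dots> \<le> \<bar>d\<bar> * (\<beta>\<^sup>2 * n0) + \<beta> * \<bar>\<omega>\<bar> * n0 + (C_bound d f0)\<^sup>2 * of_bool (d < 0) * n0 + \<bar>f0\<bar> * (2 * pi * m)"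
    using n1 X Q by (intro add_mono mult_left_mono) auto
  finally have "(- (sgn d * \<zeta>) - (C_bound d f0)\<^sup>2 * of_bool (d < 0) - (\<beta> * \<bar>\<omega>\<bar> + \<bar>d\<bar> * \<beta>\<^sup>2)) * n0 \<le> \<bar>f0\<bar> * (2 * pi * m)"
    by (simp add: algebra_simps)
  moreover have "n0 = m * (2 * pi * m)" using m(2) by (simp add: defs power2_eq_square)
  ultimately have "((- (sgn d * \<zeta>) - (C_bound d f0)\<^sup>2 * of_bool (d < 0) - (\<beta> * \<bar>\<omega>\<bar> + \<bar>d\<bar> * \<beta>\<^sup>2)) * m) * (2 * pi * m) \<le> \<bar>f0\<bar> * (2 * pi * m)"
    by (simp only: mult.assoc)
  then have "(- (sgn d * \<zeta>) - (C_bound d f0)\<^sup>2 * of_bool (d < 0) - (\<beta> * \<bar>\<omega>\<bar> + \<bar>d\<bar> * \<beta>\<^sup>2)) * m \<le> \<bar>f0\<bar>"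
    using \<open>0 < m\<close> by (simp only: mult_le_cancel_right_pos mult_pos_pos pi_gt_zero zero_less_numeral)
  moreover have "\<beta> * \<bar>\<omega>\<bar> = pi * f0\<^sup>2 * \<bar>\<omega>\<bar> / \<bar>d\<bar>" by (simp add: \<beta>_def)
  moreover have "\<bar>d\<bar> * \<beta>\<^sup>2 = pi\<^sup>2 * f0 ^ 4 / \<bar>d\<bar>" 
  proof -
    have "D * (y / D)\<^sup>2 = y\<^sup>2 / D" if "D \<noteq> 0" for y D :: real
      using that by (simp add: power2_eq_square)
    then have "\<bar>d\<bar> * (y / \<bar>d\<bar>)\<^sup>2 = y\<^sup>2 / \<bar>d\<bar>" for y using d by simp
    then show ?thesis by (simp add: \<beta>_def power_mult_distrib flip: power_mult)
  qed
  ultimately show ?thesis by (simp only:)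
qed simp

text \<open>
  For every solution \<open>focusing_rms_bound\<close> and \<open>constant_forcing_sup\<close> give \<open>\<bar>u\<bar> \<le> B = C / Z\<close>, and \<open>Z\<close>
  exceeds \<open>27 * C ^ 6 = x ^ 6\<close> with \<open>x = sqrt 3 * C \<ge> 1\<close>. Hence \<open>sqrt 3 * B < x / x ^ 6 \<le> 1\<close>, which is the
  smallness needed for \<open>unique_if_small\<close>.
\<close>

lemma unique_if_focusing:
  assumes uv: "T 0 u = u" "T 0 v = v"
    and neg: "far_focusing d \<zeta> \<omega> f0"
    and large: "1 \<le> sqrt 3 * C_bound d f0"
  shows "u = v"
proof -
  define A where "A = pi * f0\<^sup>2 * \<bar>\<omega>\<bar> / \<bar>d\<bar> + pi\<^sup>2 * f0 ^ 4 / \<bar>d\<bar>"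
  define x where "x = sqrt 3 * C_bound d f0"
  define Z where "Z = - (sgn d * \<zeta>) - (C_bound d f0)\<^sup>2 * of_bool (d < 0) - A"
  define B where "B = C_bound d f0 / Z"
  have A: "0 \<le> A" by (simp add: A_def)
  have x: "1 \<le> x" using large by (simp add: x_def)
  have "C_bound d f0 \<noteq> 0" using x by (auto simp: x_def)
  then have C: "C_bound d f0 > 0" using C_bound_nonneg by simp
  have x6: "x ^ 6 = 27 * (C_bound d f0) ^ 6"
  proof -
    have "sqrt 3 ^ 6 = (sqrt 3 ^ 2) ^ 3" by (simp only: power_mult[symmetric]) simp
    then show ?thesis by (simp add: x_def power_mult_distrib)
  qed
  have "1 \<le> x ^ 6" using x by (rule one_le_power)
  then have "A * 1 \<le> A * x ^ 6" using A by (intro mult_left_mono) auto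
  moreover have "27 * (1 + A) * (C_bound d f0) ^ 6 = x ^ 6 + A * x ^ 6" by (simp add: x6 algebra_simps)
  ultimately have Z: "x ^ 6 < Z" using neg unfolding Z_def A_def by (simp add: add.assoc)
  have Zpos: "0 < Z" using Z \<open>1 \<le> x ^ 6\<close> by linarith
  have sup: "cmod (h2per_fun w s) \<le> B" if w: "T 0 w = w" and s: "s \<in> period" for w s
  proof -
    define n0 where "n0 = L2sq (h2per_fun w)"
    define m where "m = sqrt (n0 / (2 * pi))"
    have "0 \<le> n0" by (simp add: n0_def integral_sq_nonneg)
    then have m: "0 \<le> m" "n0 = 2 * pi * m\<^sup>2" by (simp_all add: m_def)
    have "Z * m \<le> \<bar>f0\<bar>"
      using focusing_rms_bound[OF w m(1)] m(2) by (simp add: n0_def Z_def A_def)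
    then have "m \<le> \<bar>f0\<bar> / Z" using Zpos by (simp add: field_simps)
    have "cmod (h2per_fun w s) \<le> m * (1 + 2 * pi\<^sup>2 * f0\<^sup>2 / \<bar>d\<bar>)"
      using constant_forcing_sup[OF d w[unfolded T_0_eq_iff] m(1) _ s] m(2) by (simp add: n0_def)
    also have "\<dots> \<le> \<bar>f0\<bar> / Z * (1 + 2 * pi\<^sup>2 * f0\<^sup>2 / \<bar>d\<bar>)"
      using \<open>m \<le> \<bar>f0\<bar> / Z\<close> by (intro mult_right_mono) auto
    also have "\<dots> = B" by (simp add: B_def C_bound_def)
    finally show ?thesis .
  qed
  have "sqrt 3 * B = x / Z" by (simp add: B_def x_def)
  also have "\<dots> < x / x ^ 6" using x Z Zpos by (intro divide_strict_left_mono) (auto intro!: mult_pos_pos)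
  also have "\<dots> = 1 / x ^ 5" using x by (simp add: eval_nat_numeral)
  also have "\<dots> \<le> 1" using one_le_power[OF x, of 5] x by (subst pos_divide_le_eq) auto
  finally have "sqrt 3 * B < 1" .
  moreover have "0 \<le> sqrt 3 * B" using C Zpos by (simp add: B_def)
  ultimately have "(sqrt 3 * B)\<^sup>2 < 1\<^sup>2" by (intro power_strict_mono) auto
  then have "3 * B\<^sup>2 < 1" by (simp add: power_mult_distrib)
  then show ?thesis using unique_if_small[OF uv sup sup] uv by blast
qed

lemma unique_solution:
  assumes uv: "T 0 u = u" "T 0 v = v"
    and cases: "far_focusing d \<zeta> \<omega> f0 \<or> far_defocusing d \<zeta> \<omega> f0 \<or> sqrt 3 * C_bound d f0 < 1"
  shows "u = v"
proof (cases "sqrt 3 * C_bound d f0 < 1")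
  case True
  then have "(sqrt 3 * C_bound d f0)\<^sup>2 < 1\<^sup>2" using C_bound_nonneg by (intro power_strict_mono) auto
  then have "3 * (C_bound d f0)\<^sup>2 < 1" by (simp add: power_mult_distrib)
  then show ?thesis using unique_if_small[OF uv C_bound_sup C_bound_sup] uv by blast
next
  case False
  then show ?thesis using cases unique_if_focusing[OF uv] unique_if_defocusing[OF uv] by linarith
qed

section \<open>The continuum\<close>

lemma solution_set_eq: "LLE_solution_set d \<zeta> \<omega> f0 e = {(l, u). 0 \<le> l \<and> T l u = u}"
  by (simp add: LLE_solution_set_def LLE_solution_iff)

lemma closed_solution_set: "closed (LLE_solution_set d \<zeta> \<omega> f0 e)"
proof -
  have "LLE_solution_set d \<zeta> \<omega> f0 e = {x. 0 \<le> fst x} \<inter> {x. (case x of (l, u) \<Rightarrow> T l u) = snd x}"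
    by (auto simp: solution_set_eq)
  then show ?thesis
    by (simp only:) (intro closed_Int closed_Collect_le closed_Collect_eq T_continuous continuous_intros)
qed

text \<open>
  For every \<open>M\<close> the component inside the part of the solution set with parameters in \<open>{0..M}\<close>
  reaches \<open>M\<close>, and it is contained in the full component.
\<close>

theorem continuum_unbounded:
  assumes u0: "LLE_solution d \<zeta> \<omega> f0 e 0 u0" and uniq: "\<And>u. LLE_solution d \<zeta> \<omega> f0 e 0 u \<Longrightarrow> u = u0"
  shows "fst ` maximal_continuum (LLE_solution_set d \<zeta> \<omega> f0 e) (0, u0) = {0..}"
proof -
  let ?S = "LLE_solution_set d \<zeta> \<omega> f0 e"
  have "(0, u0) \<in> ?S" using u0 by (simp add: LLE_solution_set_def)
  then have eq: "maximal_continuum ?S (0, u0) = connected_component_set ?S (0, u0)"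
    by (rule maximal_continuum_eq_component[OF closed_solution_set])
  have "M \<in> fst ` connected_component_set ?S (0, u0)" if M: "0 \<le> M" for M
  proof -
    obtain R where R: "\<forall>l\<in>{0..M}. \<forall>t\<in>{0..1}. \<forall>u. u = t *\<^sub>R T l u \<longrightarrow> norm u < R" using T_bound[OF M] by blast
    have "\<exists>u. connected_component {(l, u). l \<in> {0..M} \<and> T l u = u} (0, u0) (M, u)"
    proof (rule leray_schauder_continuum[OF M T_continuous T_compact])
      show "norm u < R" if "l \<in> {0..M}" "t \<in> {0..1}" "u = t *\<^sub>R T l u" for l t u using R that by blast
      show "T 0 u0 = u0" using u0 by (simp add: LLE_solution_iff)
      show "u = u0" if "T 0 u = u" for u using that uniq by (simp add: LLE_solution_iff)
    qed
    then obtain u where "connected_component {(l, u). l \<in> {0..M} \<and> T l u = u} (0, u0) (M, u)" by blast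
    then have "connected_component ?S (0, u0) (M, u)"
      by (rule connected_component_of_subset) (auto simp: solution_set_eq)
    then show ?thesis by force
  qed
  moreover have "fst ` connected_component_set ?S (0, u0) \<subseteq> {0..}"
    using connected_component_subset[of ?S "(0, u0)"] by (auto simp: solution_set_eq)
  ultimately show ?thesis unfolding eq by auto
qed

end

lemma continuum_of_cases:
  assumes "d \<noteq> 0" "e \<in> sobolev_H2 {0<..<2 * pi}" "LLE_solution d \<zeta> \<omega> f0 e 0 u0"
    and cases: "far_focusing d \<zeta> \<omega> f0 \<or> far_defocusing d \<zeta> \<omega> f0 \<or> sqrt 3 * C_bound d f0 < 1"
  shows "fst ` maximal_continuum (LLE_solution_set d \<zeta> \<omega> f0 e) (0, u0) = {0..}"
proof -
  interpret pumped_LLE d \<zeta> \<omega> f0 e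
    by unfold_locales (use assms(1,2) in \<open>auto simp: sobolev_H2_def\<close>)
  show ?thesis
    using assms(3) unique_solution[OF _ _ cases] by (intro continuum_unbounded) (auto simp: LLE_solution_iff)
qed

theorem corollary8:
  fixes d :: real
  assumes "d \<noteq> 0"
  shows
    "(\<forall>\<zeta> \<omega> f\<^sub>0 e u\<^sub>0.
        e \<in> sobolev_H2 {0<..<2 * pi} \<and>
        LLE_solution d \<zeta> \<omega> f\<^sub>0 e 0 (const_h2per u\<^sub>0) \<and>
        nondegenerate d \<zeta> \<omega> (const_h2per u\<^sub>0) \<and>
        (sgn d * \<zeta> < - ((C_bound d f\<^sub>0)\<^sup>2 * of_bool (d < 0))
            - 27 * (1 + pi * f\<^sub>0\<^sup>2 * \<bar>\<omega>\<bar> / \<bar>d\<bar> + pi\<^sup>2 * f\<^sub>0 ^ 4 / \<bar>d\<bar>) * (C_bound d f\<^sub>0) ^ 6 \<or>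
         sgn d * \<zeta> > 3 * (C_bound d f\<^sub>0)\<^sup>2 + \<omega>\<^sup>2 / (4 * \<bar>d\<bar>) \<or>
         sqrt 3 * C_bound d f\<^sub>0 < 1) \<longrightarrow>
        fst ` maximal_continuum (LLE_solution_set d \<zeta> \<omega> f\<^sub>0 e) (0, const_h2per u\<^sub>0) = {0..}) \<and>
     (\<forall>\<omega> f\<^sub>0. \<exists>Z. \<forall>\<zeta> e u\<^sub>0.
        \<bar>\<zeta>\<bar> > Z \<and>
        e \<in> sobolev_H2 {0<..<2 * pi} \<and>
        LLE_solution d \<zeta> \<omega> f\<^sub>0 e 0 (const_h2per u\<^sub>0) \<and>
        nondegenerate d \<zeta> \<omega> (const_h2per u\<^sub>0) \<longrightarrow>
        fst ` maximal_continuum (LLE_solution_set d \<zeta> \<omega> f\<^sub>0 e) (0, const_h2per u\<^sub>0) = {0..}) \<and>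
     (\<exists>\<delta>>0. \<forall>\<zeta> \<omega> f\<^sub>0 e u\<^sub>0.
        \<bar>f\<^sub>0\<bar> < \<delta> \<and>
        e \<in> sobolev_H2 {0<..<2 * pi} \<and>
        LLE_solution d \<zeta> \<omega> f\<^sub>0 e 0 (const_h2per u\<^sub>0) \<and>
        nondegenerate d \<zeta> \<omega> (const_h2per u\<^sub>0) \<longrightarrow>
        fst ` maximal_continuum (LLE_solution_set d \<zeta> \<omega> f\<^sub>0 e) (0, const_h2per u\<^sub>0) = {0..})"
proof (intro conjI, goal_cases)
  case 1
  show ?case
    by (intro allI impI, elim conjE) (rule continuum_of_cases[OF assms])
next
  case 2
  have "\<exists>Z. \<forall>\<zeta>. \<bar>\<zeta>\<bar> > Z \<longrightarrow> far_focusing d \<zeta> \<omega> f0 \<or> far_defocusing d \<zeta> \<omega> f0" for \<omega> f0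
  proof -
    define lo where "lo = - ((C_bound d f0)\<^sup>2 * of_bool (d < 0)) -
      27 * (1 + pi * f0\<^sup>2 * \<bar>\<omega>\<bar> / \<bar>d\<bar> + pi\<^sup>2 * f0 ^ 4 / \<bar>d\<bar>) * (C_bound d f0) ^ 6"
    define hi where "hi = 3 * (C_bound d f0)\<^sup>2 + \<omega>\<^sup>2 / (4 * \<bar>d\<bar>)"
    have "sgn d * \<zeta> < lo \<or> sgn d * \<zeta> > hi" if "\<bar>\<zeta>\<bar> > max (- lo) hi" for \<zeta>
    proof -
      have "\<bar>sgn d * \<zeta>\<bar> = \<bar>\<zeta>\<bar>" using assms by (simp add: abs_mult)
      then show ?thesis using that by linarith
    qed
    then show ?thesis unfolding lo_def hi_def by blast
  qed
  then show ?case using continuum_of_cases[OF assms] by meson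
next
  case 3
  \<comment> \<open>For \<open>\<bar>f0\<bar> \<le> 1\<close> the constant \<open>C(d, f0)\<close> is at most \<open>\<bar>f0\<bar> * D\<close>, and \<open>sqrt 3 \<le> 2\<close>.\<close>
  define D where "D = 1 + 2 * pi\<^sup>2 / \<bar>d\<bar>"
  have D: "1 \<le> D" by (simp add: D_def)
  have small: "sqrt 3 * C_bound d f\<^sub>0 < 1" if "\<bar>f\<^sub>0\<bar> < 1 / (2 * D)" for f\<^sub>0
  proof -
    have "1 / (2 * D) \<le> 1" using D by simp
    then have "f\<^sub>0\<^sup>2 \<le> 1" using that by (simp add: abs_square_le_1)
    then have "2 * pi\<^sup>2 * f\<^sub>0\<^sup>2 / \<bar>d\<bar> \<le> 2 * pi\<^sup>2 * 1 / \<bar>d\<bar>" by (intro divide_right_mono mult_left_mono) auto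
    then have "C_bound d f\<^sub>0 \<le> \<bar>f\<^sub>0\<bar> * D" unfolding C_bound_def D_def by (intro mult_left_mono) auto
    also have "\<dots> < 1 / (2 * D) * D" using that D by (intro mult_strict_right_mono) auto
    also have "\<dots> = 1 / 2" using D by simp
    finally have C: "C_bound d f\<^sub>0 < 1 / 2" .
    have "sqrt 3 \<le> 2" by (rule real_le_lsqrt) auto
    then have "sqrt 3 * C_bound d f\<^sub>0 \<le> 2 * C_bound d f\<^sub>0"
      by (intro mult_right_mono) (simp_all add: C_bound_def)
    with C show ?thesis by linarith
  qed
  show ?case
  proof (intro exI[of _ "1 / (2 * D)"] conjI allI impI)
    show "0 < 1 / (2 * D)" using D by simp
  qed (elim conjE, intro continuum_of_cases[OF assms] disjI2 small)
qed

end
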